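(* There exists a weak simulation quasimetric $\mathbf m$ on networks of pTCWS such that $\mathbf m(M,N)\le d(M,N)$ for every weak simulation quasimetric $d$ and all networks $M,N$.
   Context: The process calculus pTCWS. Processes $P,Q$ and probabilistic choices $C,D$ are $P ::= \mathsf{nil} \mid {!}\langle u\rangle.C \mid \lfloor ?(x).C\rfloor D \mid \tau.C \mid \sigma.C \mid X \mid \mathsf{fix}\,X.P$ and $C ::= \bigoplus_{i\in I} p_i{:}P_i$ ($I$ finite non-empty, $p_i\in(0,1]$, $\sum_i p_i=1$); in $\mathsf{fix}\,X.P$ every occurrence of $X$ is time-guarded (under a $\sigma$-prefix or in a timeout branch $D$). $1{:}P$ is written $P$; ${!}\langle v\rangle$ is ${!}\langle v\rangle.\mathsf{nil}$. Networks: $M::=\mathbf 0\mid M_1\mid M_2\mid n[P]^\nu\mid\bot$, where $n[P]^\nu$ is a node named $n$ running closed process $P$ with neighbour set $\nu$, and $\bot$ is a stuck network; $\mathrm{nds}(M)$ is the set of node names. Structural congruence $\equiv$: least equivalence preserved by $\mid$, making $\mid$ a commutative monoid with unit $\mathbf 0$, with $n[\mathsf{fix}\,X.P]^\nu\equiv n[P\{\mathsf{fix}\,X.P/X\}]^\nu$. Networks are assumed well-formed (no node is its own neighbour, distinct names, symmetric neighbourhood, connected neighbour graph). $\mathrm{rcv}(P)$ holds iff $n[P]^\nu\equiv n[\lfloor ?(x).C\rfloor D]^\nu$ for some $x,C,D$. Semantics: $\mathcal D(\mathcal N)$ is the set of finite-support probability distributions on networks, $|\Delta|$ the total mass of a sub-distribution,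 $\overline M$ the Dirac distribution; $[\![n[\bigoplus_i p_i{:}P_i]^\nu]\!]=\sum_ip_i\overline{n[P_i]^\nu}$; $(\Delta\mid\Theta)(M_1\mid M_2)=\Delta(M_1)\Theta(M_2)$. Transitions $M\xrightarrow{\lambda}\Delta$, $\lambda\in\{m!v\triangleright\nu, m?v,\tau,\sigma\}$, form the least relation closed under: (Snd) $m[{!}\langle v\rangle.C]^\nu\xrightarrow{m!v\triangleright\nu}[\![m[C]^\nu]\!]$; (Rcv) if $m\in\nu$: $n[\lfloor ?(x).C\rfloor D]^\nu\xrightarrow{m?v}[\![n[C\{v/x\}]^\nu]\!]$; $\mathbf 0\xrightarrow{m?v}\overline{\mathbf 0}$; (RcvEnb) if $\neg(m\in\nu\wedge\mathrm{rcv}(P))$ and $m\ne n$: $n[P]^\nu\xrightarrow{m?v}\overline{n[P]^\nu}$; (RcvPar) $M\xrightarrow{m?v}\Delta$, $N\xrightarrow{m?v}\Theta$ give $M\mid N\xrightarrow{m?v}\Delta\mid\Theta$; (Bcast) $M\xrightarrow{m!v\triangleright\nu}\Delta$, $N\xrightarrow{m?v}\Theta$ give $M\mid N\xrightarrow{m!v\triangleright(\nu\setminus\mathrm{nds}(N))}\Delta\mid\Theta$ (and symmetrically); (Tau) $m[\tau.C]^\nu\xrightarrow{\tau}[\![m[C]^\nu]\!]$; (TauPar) $M\xrightarrow{\tau}\Delta$ and $N$ not of the form $\bot\mid N'$ give $M\mid N\xrightarrow{\tau}\Delta\mid\overline N$ (and symmetrically); $\mathbf 0\xrightarrow{\sigma}\overline{\mathbf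 0}$; $n[\mathsf{nil}]^\nu\xrightarrow{\sigma}\overline{n[\mathsf{nil}]^\nu}$; (Timeout) $n[\lfloor ?(x).C\rfloor D]^\nu\xrightarrow{\sigma}[\![n[D]^\nu]\!]$; (Sleep) $n[\sigma.C]^\nu\xrightarrow{\sigma}[\![n[C]^\nu]\!]$; ($\sigma$-Par) $M\xrightarrow{\sigma}\Delta$, $N\xrightarrow{\sigma}\Theta$ give $M\mid N\xrightarrow{\sigma}\Delta\mid\Theta$; (Rec) $n[P\{\mathsf{fix}\,X.P/X\}]^\nu\xrightarrow{\lambda}\Delta$ gives $n[\mathsf{fix}\,X.P]^\nu\xrightarrow{\lambda}\Delta$; (ShhSnd) $M\xrightarrow{m!v\triangleright\emptyset}\Delta$ gives $M\xrightarrow{\tau}\Delta$; (ObsSnd) $M\xrightarrow{m!v\triangleright\nu}\Delta$ with $\nu\ne\emptyset$ gives $M\xrightarrow{!v\triangleright\nu}\Delta$. $\bot$ has no transitions. $\alpha$ ranges over $!v\triangleright\nu$, $m?v$, $\sigma$, $\tau$. Weak transitions: $M\xrightarrow{\hat\tau}\Delta$ iff $M\xrightarrow{\tau}\Delta$ or $\Delta=\overline M$; for $\alpha\ne\tau$, $\xrightarrow{\hat\alpha}=\xrightarrow{\alpha}$. For $\Delta=\sum_{i\in I}p_i\overline{M_i}$, $\Delta\xrightarrow{\hat\alpha}\Theta$ iff for some non-empty $J\subseteq I$, $M_j\xrightarrow{\hat\alpha}\Theta_j$ ($j\in J$), $M_i$ has no $\hat\alpha$-transition ($i\notin J$), and $\Theta=\sum_{j\in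 J}p_j\Theta_j$. $\overset{\hat\tau}{\Longrightarrow}$ is the reflexive-transitive closure of $\xrightarrow{\hat\tau}$, and $\overset{\hat\alpha}{\Longrightarrow}=\overset{\hat\tau}{\Longrightarrow}\xrightarrow{\hat\alpha}\overset{\hat\tau}{\Longrightarrow}$ for $\alpha\neq\tau$. A (1-bounded) pseudoquasimetric is $d:\mathcal N\times\mathcal N\to[0,1]$ with $d(M,M)=0$ and $d(M,N)\le d(M,O)+d(O,N)$. A matching $\omega\in\Omega(\Delta,\Theta)$ is a distribution on $\mathcal N\times\mathcal N$ with marginals $\Delta,\Theta$; $\mathcal K(d)(\Delta,\Theta)=\min_{\omega\in\Omega(\Delta,\Theta)}\sum_{M,N}\omega(M,N)d(M,N)$. A weak simulation quasimetric is a pseudoquasimetric $d$ such that for all $M,N$ with $d(M,N)<1$, whenever $M\xrightarrow{\alpha}\Delta$ there is $\Theta$ with $N\overset{\hat\alpha}{\Longrightarrow}\Theta$ and $\mathcal K(d)(\Delta,\Theta+(1-|\Theta|)\overline\bot)\le d(M,N)$. *)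

theory Defs
  imports Complex_Main
begin

text \<open>Node names, value variables and process variables are natural numbers;
  values range over an arbitrary type 'v.\<close>

datatype 'v msg = MVar nat | MVal 'v

text \<open>A probabilistic choice (sum over i of p_i : P_i) is represented as a list of pairs (p_i, P_i).\<close>
datatype 'v proc =
    PNil
  | PSnd "'v msg" "(real \<times> 'v proc) list"
  | PRcv nat "(real \<times> 'v proc) list" "(real \<times> 'v proc) list"      \<comment> \<open>floor ?(x).C ceil D\<close>
  | PTau "(real \<times> 'v proc) list"
  | PSigma "(real \<times> 'v proc) list"
  | PVar nat
  | PFix nat "'v proc"

datatype 'v net =
    Zero
  | Par "'v net" "'v net"
  | Node nat "'v proc" "nat set"
  | Bot                                \<comment> \<open>stuck network\<close>

text \<open>Value substitution C{v/x}; the binder ?(x) binds x in C only.\<close>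
fun vsubst :: "nat \<Rightarrow> 'v \<Rightarrow> 'v proc \<Rightarrow> 'v proc" where
  "vsubst x v PNil = PNil"
| "vsubst x v (PSnd u C) =
     PSnd (case u of MVar y \<Rightarrow> (if y = x then MVal v else MVar y) | MVal w \<Rightarrow> MVal w)
          (map (\<lambda>(p, Q). (p, vsubst x v Q)) C)"
| "vsubst x v (PRcv y C D) =
     PRcv y (if y = x then C else map (\<lambda>(p, Q). (p, vsubst x v Q)) C)
            (map (\<lambda>(p, Q). (p, vsubst x v Q)) D)"
| "vsubst x v (PTau C) = PTau (map (\<lambda>(p, Q). (p, vsubst x v Q)) C)"
| "vsubst x v (PSigma C) = PSigma (map (\<lambda>(p, Q). (p, vsubst x v Q)) C)"
| "vsubst x v (PVar Y) = PVar Y"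
| "vsubst x v (PFix Y P) = PFix Y (vsubst x v P)"

text \<open>Process substitution P{Q/X} (only used with closed Q, so no capture).\<close>
fun psubst :: "nat \<Rightarrow> 'v proc \<Rightarrow> 'v proc \<Rightarrow> 'v proc" where
  "psubst X Q PNil = PNil"
| "psubst X Q (PSnd u C) = PSnd u (map (\<lambda>(p, R). (p, psubst X Q R)) C)"
| "psubst X Q (PRcv y C D) =
     PRcv y (map (\<lambda>(p, R). (p, psubst X Q R)) C) (map (\<lambda>(p, R). (p, psubst X Q R)) D)"
| "psubst X Q (PTau C) = PTau (map (\<lambda>(p, R). (p, psubst X Q R)) C)"
| "psubst X Q (PSigma C) = PSigma (map (\<lambda>(p, R). (p, psubst X Q R)) C)"
| "psubst X Q (PVar Y) = (if Y = X then Q else PVar Y)"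
| "psubst X Q (PFix Y P) = (if Y = X then PFix Y P else PFix Y (psubst X Q P))"

fun fv :: "'v proc \<Rightarrow> nat set" where
  "fv PNil = {}"
| "fv (PSnd u C) = (case u of MVar y \<Rightarrow> {y} | MVal _ \<Rightarrow> {}) \<union> (\<Union>(p, Q)\<in>set C. fv Q)"
| "fv (PRcv y C D) = ((\<Union>(p, Q)\<in>set C. fv Q) - {y}) \<union> (\<Union>(p, Q)\<in>set D. fv Q)"
| "fv (PTau C) = (\<Union>(p, Q)\<in>set C. fv Q)"
| "fv (PSigma C) = (\<Union>(p, Q)\<in>set C. fv Q)"
| "fv (PVar Y) = {}"
| "fv (PFix Y P) = fv P"

fun fpv :: "'v proc \<Rightarrow> nat set" where
  "fpv PNil = {}"
| "fpv (PSnd u C) = (\<Union>(p, Q)\<in>set C. fpv Q)"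
| "fpv (PRcv y C D) = (\<Union>(p, Q)\<in>set C. fpv Q) \<union> (\<Union>(p, Q)\<in>set D. fpv Q)"
| "fpv (PTau C) = (\<Union>(p, Q)\<in>set C. fpv Q)"
| "fpv (PSigma C) = (\<Union>(p, Q)\<in>set C. fpv Q)"
| "fpv (PVar Y) = {Y}"
| "fpv (PFix Y P) = fpv P - {Y}"

text \<open>tguarded X P: every free occurrence of X in P is time-guarded, i.e. lies under a
  sigma-prefix or inside a timeout branch D.\<close>
fun tguarded :: "nat \<Rightarrow> 'v proc \<Rightarrow> bool" where
  "tguarded X PNil = True"
| "tguarded X (PSnd u C) = (\<forall>(p, Q)\<in>set C. tguarded X Q)"
| "tguarded X (PRcv y C D) = (\<forall>(p, Q)\<in>set C. tguarded X Q)"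
| "tguarded X (PTau C) = (\<forall>(p, Q)\<in>set C. tguarded X Q)"
| "tguarded X (PSigma C) = True"
| "tguarded X (PVar Y) = (Y \<noteq> X)"
| "tguarded X (PFix Y P) = (Y = X \<or> tguarded X P)"

definition wf_choice :: "(real \<times> 'v proc) list \<Rightarrow> bool" where
  "wf_choice C \<longleftrightarrow> C \<noteq> [] \<and> (\<forall>(p, Q)\<in>set C. 0 < p \<and> p \<le> 1) \<and> sum_list (map fst C) = 1"

fun wf_proc :: "'v proc \<Rightarrow> bool" where
  "wf_proc PNil = True"
| "wf_proc (PSnd u C) = (wf_choice C \<and> (\<forall>(p, Q)\<in>set C. wf_proc Q))"
| "wf_proc (PRcv y C D) = (wf_choice C \<and> wf_choice D \<and>
      (\<forall>(p, Q)\<in>set C. wf_proc Q) \<and> (\<forall>(p, Q)\<in>set D. wf_proc Q))"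
| "wf_proc (PTau C) = (wf_choice C \<and> (\<forall>(p, Q)\<in>set C. wf_proc Q))"
| "wf_proc (PSigma C) = (wf_choice C \<and> (\<forall>(p, Q)\<in>set C. wf_proc Q))"
| "wf_proc (PVar Y) = True"
| "wf_proc (PFix Y P) = (tguarded Y P \<and> wf_proc P)"

definition closed_proc :: "'v proc \<Rightarrow> bool" where
  "closed_proc P \<longleftrightarrow> fv P = {} \<and> fpv P = {}"

fun nds :: "'v net \<Rightarrow> nat set" where
  "nds Zero = {}"
| "nds (Par M N) = nds M \<union> nds N"
| "nds (Node n P \<nu>) = {n}"
| "nds Bot = {}"

fun nodes :: "'v net \<Rightarrow> (nat \<times> 'v proc \<times> nat set) set" where
  "nodes Zero = {}"
| "nodes (Par M N) = nodes M \<union> nodes N"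
| "nodes (Node n P \<nu>) = {(n, P, \<nu>)}"
| "nodes Bot = {}"

fun distinct_names :: "'v net \<Rightarrow> bool" where
  "distinct_names (Par M N) = (distinct_names M \<and> distinct_names N \<and> nds M \<inter> nds N = {})"
| "distinct_names _ = True"

definition nbr :: "'v net \<Rightarrow> nat \<Rightarrow> nat \<Rightarrow> bool" where
  "nbr M n m \<longleftrightarrow> (\<exists>P \<nu>. (n, P, \<nu>) \<in> nodes M \<and> m \<in> \<nu>)"

definition wf_net :: "'v net \<Rightarrow> bool" where
  "wf_net M \<longleftrightarrow>
     (\<forall>(n, P, \<nu>)\<in>nodes M. closed_proc P \<and> wf_proc P \<and> n \<notin> \<nu>) \<and>
     distinct_names M \<and>
     (\<forall>n\<in>nds M. \<forall>m\<in>nds M. nbr M n m \<longrightarrow> nbr M m n) \<and>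
     (\<forall>n\<in>nds M. \<forall>m\<in>nds M. (\<lambda>a b. nbr M a b \<and> a \<in> nds M \<and> b \<in> nds M)\<^sup>*\<^sup>* n m)"

inductive scong :: "'v net \<Rightarrow> 'v net \<Rightarrow> bool" where
  sc_refl: "scong M M"
| sc_sym: "scong M N \<Longrightarrow> scong N M"
| sc_trans: "scong M N \<Longrightarrow> scong N L \<Longrightarrow> scong M L"
| sc_parL: "scong M M' \<Longrightarrow> scong (Par M N) (Par M' N)"
| sc_parR: "scong N N' \<Longrightarrow> scong (Par M N) (Par M N')"
| sc_comm: "scong (Par M N) (Par N M)"
| sc_assoc: "scong (Par (Par M N) L) (Par M (Par N L))"
| sc_unit: "scong (Par M Zero) M"
| sc_fix: "scong (Node n (PFix X P) \<nu>) (Node n (psubst X (PFix X P) P) \<nu>)"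

definition rcv :: "nat \<Rightarrow> nat set \<Rightarrow> 'v proc \<Rightarrow> bool" where
  "rcv n \<nu> P \<longleftrightarrow> (\<exists>x C D. scong (Node n P \<nu>) (Node n (PRcv x C D) \<nu>))"

text \<open>A (sub-)distribution is a function from networks to reals (with finite support).\<close>
type_synonym 'v dist = "'v net \<Rightarrow> real"

definition dirac :: "'v net \<Rightarrow> 'v dist" where
  "dirac M = (\<lambda>N. if N = M then 1 else 0)"

definition supp :: "('a \<Rightarrow> real) \<Rightarrow> 'a set" where
  "supp f = {x. f x \<noteq> 0}"

definition mass :: "'v dist \<Rightarrow> real" where
  "mass \<Delta> = sum \<Delta> (supp \<Delta>)"

definition sem :: "nat \<Rightarrow> (real \<times> 'v proc) list \<Rightarrow> nat set \<Rightarrow> 'v dist" where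
  "sem n C \<nu> = (\<lambda>N. sum_list (map (\<lambda>(p, P). if N = Node n P \<nu> then p else 0) C))"

definition par_dist :: "'v dist \<Rightarrow> 'v dist \<Rightarrow> 'v dist" where
  "par_dist \<Delta> \<Theta> = (\<lambda>N. case N of Par M1 M2 \<Rightarrow> \<Delta> M1 * \<Theta> M2 | _ \<Rightarrow> 0)"

datatype 'v lab =
    LSnd nat 'v "nat set"
  | LObs 'v "nat set"
  | LRcv nat 'v
  | LTau
  | LSigma

fun obs_lab :: "'v lab \<Rightarrow> bool" where
  "obs_lab (LSnd _ _ _) = False"
| "obs_lab _ = True"

inductive trans :: "'v net \<Rightarrow> 'v lab \<Rightarrow> 'v dist \<Rightarrow> bool" where
  Snd: "trans (Node m (PSnd (MVal v) C) \<nu>) (LSnd m v \<nu>) (sem m C \<nu>)"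
| Rcv: "m \<in> \<nu> \<Longrightarrow>
     trans (Node n (PRcv x C D) \<nu>) (LRcv m v) (sem n (map (\<lambda>(p, Q). (p, vsubst x v Q)) C) \<nu>)"
| RcvZero: "trans Zero (LRcv m v) (dirac Zero)"
| RcvEnb: "\<not> (m \<in> \<nu> \<and> rcv n \<nu> P) \<Longrightarrow> m \<noteq> n \<Longrightarrow> trans (Node n P \<nu>) (LRcv m v) (dirac (Node n P \<nu>))"
| RcvPar: "trans M (LRcv m v) \<Delta> \<Longrightarrow> trans N (LRcv m v) \<Theta> \<Longrightarrow>
     trans (Par M N) (LRcv m v) (par_dist \<Delta> \<Theta>)"
| BcastL: "trans M (LSnd m v \<nu>) \<Delta> \<Longrightarrow> trans N (LRcv m v) \<Theta> \<Longrightarrow>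
     trans (Par M N) (LSnd m v (\<nu> - nds N)) (par_dist \<Delta> \<Theta>)"
| BcastR: "trans M (LSnd m v \<nu>) \<Delta> \<Longrightarrow> trans N (LRcv m v) \<Theta> \<Longrightarrow>
     trans (Par N M) (LSnd m v (\<nu> - nds N)) (par_dist \<Theta> \<Delta>)"
| Tau: "trans (Node m (PTau C) \<nu>) LTau (sem m C \<nu>)"
| TauParL: "trans M LTau \<Delta> \<Longrightarrow> \<not> (\<exists>N'. scong N (Par Bot N')) \<Longrightarrow>
     trans (Par M N) LTau (par_dist \<Delta> (dirac N))"
| TauParR: "trans M LTau \<Delta> \<Longrightarrow> \<not> (\<exists>N'. scong N (Par Bot N')) \<Longrightarrow>
     trans (Par N M) LTau (par_dist (dirac N) \<Delta>)"
| SigmaZero: "trans Zero LSigma (dirac Zero)"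
| SigmaNil: "trans (Node n PNil \<nu>) LSigma (dirac (Node n PNil \<nu>))"
| Timeout: "trans (Node n (PRcv x C D) \<nu>) LSigma (sem n D \<nu>)"
| Sleep: "trans (Node n (PSigma C) \<nu>) LSigma (sem n C \<nu>)"
| SigmaPar: "trans M LSigma \<Delta> \<Longrightarrow> trans N LSigma \<Theta> \<Longrightarrow> trans (Par M N) LSigma (par_dist \<Delta> \<Theta>)"
| Rec: "trans (Node n (psubst X (PFix X P) P) \<nu>) l \<Delta> \<Longrightarrow> trans (Node n (PFix X P) \<nu>) l \<Delta>"
| ShhSnd: "trans M (LSnd m v {}) \<Delta> \<Longrightarrow> trans M LTau \<Delta>"
| ObsSnd: "trans M (LSnd m v \<nu>) \<Delta> \<Longrightarrow> \<nu> \<noteq> {} \<Longrightarrow> trans M (LObs v \<nu>) \<Delta>"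

definition hat_trans :: "'v net \<Rightarrow> 'v lab \<Rightarrow> 'v dist \<Rightarrow> bool" where
  "hat_trans M \<alpha> \<Theta> \<longleftrightarrow> (if \<alpha> = LTau then trans M LTau \<Theta> \<or> \<Theta> = dirac M else trans M \<alpha> \<Theta>)"

definition lift_trans :: "'v dist \<Rightarrow> 'v lab \<Rightarrow> 'v dist \<Rightarrow> bool" where
  "lift_trans \<Delta> \<alpha> \<Theta> \<longleftrightarrow>
     (\<exists>(ps :: (real \<times> 'v net) list) (\<Theta>s :: nat \<Rightarrow> 'v dist) J.
        (\<forall>i<length ps. 0 < fst (ps ! i)) \<and>
        \<Delta> = (\<lambda>N. \<Sum>i<length ps. fst (ps ! i) * dirac (snd (ps ! i)) N) \<and>
        J \<subseteq> {..<length ps} \<and> J \<noteq> {} \<and>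
        (\<forall>j\<in>J. hat_trans (snd (ps ! j)) \<alpha> (\<Theta>s j)) \<and>
        (\<forall>i<length ps. i \<notin> J \<longrightarrow> \<not> (\<exists>\<Theta>'. hat_trans (snd (ps ! i)) \<alpha> \<Theta>')) \<and>
        \<Theta> = (\<lambda>N. \<Sum>j\<in>J. fst (ps ! j) * \<Theta>s j N))"

definition weak_tau :: "'v dist \<Rightarrow> 'v dist \<Rightarrow> bool" where
  "weak_tau = (\<lambda>\<Delta> \<Theta>. lift_trans \<Delta> LTau \<Theta>)\<^sup>*\<^sup>*"

definition weak_trans :: "'v net \<Rightarrow> 'v lab \<Rightarrow> 'v dist \<Rightarrow> bool" where
  "weak_trans M \<alpha> \<Theta> \<longleftrightarrow>
     (if \<alpha> = LTau then weak_tau (dirac M) \<Theta>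
      else (\<exists>\<Delta>1 \<Delta>2. weak_tau (dirac M) \<Delta>1 \<and> lift_trans \<Delta>1 \<alpha> \<Delta>2 \<and> weak_tau \<Delta>2 \<Theta>))"

definition Nets :: "'v net set" where
  "Nets = {M. wf_net M}"

definition pseudoquasimetric :: "('v net \<Rightarrow> 'v net \<Rightarrow> real) \<Rightarrow> bool" where
  "pseudoquasimetric d \<longleftrightarrow>
     (\<forall>M\<in>Nets. \<forall>N\<in>Nets. 0 \<le> d M N \<and> d M N \<le> 1) \<and>
     (\<forall>M\<in>Nets. d M M = 0) \<and>
     (\<forall>M\<in>Nets. \<forall>N\<in>Nets. \<forall>L\<in>Nets. d M N \<le> d M L + d L N)"

definition matching :: "'v dist \<Rightarrow> 'v dist \<Rightarrow> ('v net \<times> 'v net \<Rightarrow> real) set" where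
  "matching \<Delta> \<Theta> = {\<omega>. finite (supp \<omega>) \<and> (\<forall>x. 0 \<le> \<omega> x) \<and>
       (\<forall>M. \<Delta> M = (\<Sum>N\<in>{N. \<omega> (M, N) \<noteq> 0}. \<omega> (M, N))) \<and>
       (\<forall>N. \<Theta> N = (\<Sum>M\<in>{M. \<omega> (M, N) \<noteq> 0}. \<omega> (M, N)))}"

definition kantorovich :: "('v net \<Rightarrow> 'v net \<Rightarrow> real) \<Rightarrow> 'v dist \<Rightarrow> 'v dist \<Rightarrow> real" where
  "kantorovich d \<Delta> \<Theta> =
     Inf ((\<lambda>\<omega>. \<Sum>(M, N)\<in>supp \<omega>. \<omega> (M, N) * d M N) ` matching \<Delta> \<Theta>)"

definition pad_bot :: "'v dist \<Rightarrow> 'v dist" where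
  "pad_bot \<Theta> = (\<lambda>N. \<Theta> N + (if N = Bot then 1 - mass \<Theta> else 0))"

definition weak_sim_quasimetric :: "('v net \<Rightarrow> 'v net \<Rightarrow> real) \<Rightarrow> bool" where
  "weak_sim_quasimetric d \<longleftrightarrow>
     pseudoquasimetric d \<and>
     (\<forall>M\<in>Nets. \<forall>N\<in>Nets. d M N < 1 \<longrightarrow>
        (\<forall>\<alpha> \<Delta>. obs_lab \<alpha> \<longrightarrow> trans M \<alpha> \<Delta> \<longrightarrow>
           (\<exists>\<Theta>. weak_trans N \<alpha> \<Theta> \<and> kantorovich d \<Delta> (pad_bot \<Theta>) \<le> d M N)))"

end

theory Submission
  imports Defs "HOL-Probability.Product_PMF"
begin

text \<open>Work with schedulers: a weak derivative of a state is the outcome of resolving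
  non-determinism at finitely many states, possibly at random.  Time-guardedness makes internal
  moves well-founded and every state has finitely many derivatives, so the weak derivatives of a
  state are exactly the mixtures of finitely many of them; hence the cost of matching a strong
  move, minimised over weak derivatives, is attained.

  Therefore it suffices to look for the least function \<open>d\<close> that has the transfer
  property up to an arbitrarily small error.  Such functions are closed under pointwise infima, so
  there is a least one, \<open>m\<close>.  They are also closed under \<open>d \<mapsto> inf\<^sub>z (d x z + d z y)\<close>, because
  couplings can be glued, and this gives the triangle inequality for \<open>m\<close>.

  The missing mass of a sub-distribution is put on \<open>Bot\<close>.  A network without \<open>Bot\<close> can
  always receive from a fresh sender, so it is at distance 1 from every network containing
  \<open>Bot\<close>, which is stuck; this prevents a transition from being matched by one that loses all mass.\<close>

section \<open>Couplings of finitely supported distributions\<close>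

text \<open>A pointwise infimum of quasimetrics is in general not a quasimetric, so the triangle
  inequality is kept out of the closure property and returns only through minimality. The slack has
  a similar origin: below any threshold above \<open>m x y\<close>, one member of the family already
  answers the move, whereas an exact answer for \<open>m\<close> requires a limit of answers taken
  from different members. That limit is formed once, for \<open>m\<close> itself. For the triangle
  inequality a weak answer must be answered again. Transfer is therefore lifted to coupled
  distributions and then along whole weak moves, each step consuming part of the slack. Placing lost
  mass on \<open>Bot\<close> turns partial moves into liftings of a total relation, but it also
  admits an outcome that is entirely \<open>Bot\<close>; no weak transition of a live network has
  it, because the index set \<open>J\<close> is non-empty. Such an answer costs 1, so it never
  arises at distance below 1.\<close>

lemma disintegrate_pmf:
  obtains \<kappa> where "\<rho> = bind_pmf (map_pmf fst \<rho>) (\<lambda>x. map_pmf (Pair x) (\<kappa> x))"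
    and "\<And>x. x \<in> fst ` set_pmf \<rho> \<Longrightarrow> set_pmf (\<kappa> x) = {y. (x, y) \<in> set_pmf \<rho>}"
proof -
  define \<kappa> where "\<kappa> x = map_pmf snd (cond_pmf \<rho> {z. fst z = x})" for x
  have ne: "set_pmf \<rho> \<inter> {z. fst z = x} \<noteq> {}" if "x \<in> fst ` set_pmf \<rho>" for x
    using that by auto
  have "map_pmf (Pair x) (\<kappa> x) = cond_pmf \<rho> {z. fst z = x}" if "x \<in> fst ` set_pmf \<rho>" for x
    unfolding \<kappa>_def map_pmf_comp
    by (rule map_pmf_idI) (use ne[OF that] in \<open>auto simp: set_cond_pmf\<close>)
  then have "bind_pmf (map_pmf fst \<rho>) (\<lambda>x. map_pmf (Pair x) (\<kappa> x))
      = bind_pmf (map_pmf fst \<rho>) (\<lambda>x. cond_pmf \<rho> {z. fst z = x})"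
    by (intro bind_pmf_cong refl) auto
  also have "\<dots> = \<rho>"
    by (rule bind_cond_pmf_cancel) (auto simp: vimage_def intro!: arg_cong[where f="measure _"])
  finally have "\<rho> = bind_pmf (map_pmf fst \<rho>) (\<lambda>x. map_pmf (Pair x) (\<kappa> x))" ..
  moreover have "set_pmf (\<kappa> x) = {y. (x, y) \<in> set_pmf \<rho>}" if "x \<in> fst ` set_pmf \<rho>" for x
    using ne[OF that] unfolding \<kappa>_def by (force simp: set_cond_pmf)
  ultimately show thesis by (rule that)
qed

text \<open>Sample \<open>(x, z)\<close> from the first coupling, then \<open>y\<close> from the
  conditional law of the second one given \<open>z\<close>: \<open>x\<close> and \<open>y\<close>
  become independent given the shared middle coordinate.\<close>

lemma glue_pmf:
  assumes "map_pmf snd \<omega>1 = map_pmf fst \<omega>2"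
  obtains \<omega> where "map_pmf (\<lambda>(x, z, y). (x, z)) \<omega> = \<omega>1"
    and "map_pmf (\<lambda>(x, z, y). (z, y)) \<omega> = \<omega>2"
proof -
  obtain \<kappa> where \<kappa>: "\<omega>2 = bind_pmf (map_pmf fst \<omega>2) (\<lambda>z. map_pmf (Pair z) (\<kappa> z))"
    by (rule disintegrate_pmf)
  define \<omega> where "\<omega> = bind_pmf \<omega>1 (\<lambda>(x, z). map_pmf (\<lambda>y. (x, z, y)) (\<kappa> z))"
  have "map_pmf (\<lambda>(x, z, y). (x, z)) \<omega> = \<omega>1"
    unfolding \<omega>_def map_bind_pmf by (simp add: split_def map_pmf_comp bind_return_pmf')
  moreover have "map_pmf (\<lambda>(x, z, y). (z, y)) \<omega> = bind_pmf (map_pmf snd \<omega>1) (\<lambda>z. map_pmf (Pair z) (\<kappa> z))"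
    unfolding \<omega>_def map_bind_pmf bind_map_pmf
    by (intro bind_pmf_cong refl) (simp add: case_prod_unfold pmf.map_comp o_def)
  then have "map_pmf (\<lambda>(x, z, y). (z, y)) \<omega> = \<omega>2"
    unfolding assms \<kappa>[symmetric] .
  ultimately show thesis by (rule that)
qed

lemma expectation_finite_mono:
  fixes f g :: "'a \<Rightarrow> real"
  assumes "finite (set_pmf p)" "\<And>x. x \<in> set_pmf p \<Longrightarrow> f x \<le> g x"
  shows "measure_pmf.expectation p f \<le> measure_pmf.expectation p g"
  using assms by (intro integral_mono_AE integrable_measure_pmf_finite) (auto simp: AE_measure_pmf_iff)

lemma expectation_finite_const:
  fixes f :: "'a \<Rightarrow> real"
  assumes "\<And>x. x \<in> set_pmf p \<Longrightarrow> f x = c"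
  shows "measure_pmf.expectation p f = c"
proof -
  have "measure_pmf.expectation p f = measure_pmf.expectation p (\<lambda>_. c)"
    using assms by (intro integral_cong_AE) (auto simp: AE_measure_pmf_iff)
  then show ?thesis by simp
qed

lemma expectation_bind_finite:
  fixes h :: "'b \<Rightarrow> real"
  assumes "finite (set_pmf p)" "\<And>x. x \<in> set_pmf p \<Longrightarrow> finite (set_pmf (f x))"
  shows "measure_pmf.expectation (bind_pmf p f) h
    = measure_pmf.expectation p (\<lambda>x. measure_pmf.expectation (f x) h)"
  using assms by (subst pmf_expectation_bind[of "set_pmf p"]) (auto simp: integral_measure_pmf[of "set_pmf p"])

section \<open>Compactness of distributions on a fixed finite set\<close>

lemma bounded_seq_convergent_subseq_on_finite:
  fixes f :: "nat \<Rightarrow> 'a \<Rightarrow> real"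
  assumes "finite B" "\<And>k b. b \<in> B \<Longrightarrow> \<bar>f k b\<bar> \<le> C"
  shows "\<exists>r l. strict_mono r \<and> (\<forall>b\<in>B. (\<lambda>k. f (r k) b) \<longlonglongrightarrow> l b)"
  using assms
proof (induction B rule: finite_induct)
  case empty
  have "strict_mono (id :: nat \<Rightarrow> nat)" by (simp add: strict_mono_def)
  then show ?case by blast
next
  case (insert b B)
  then obtain r l where r: "strict_mono (r :: nat \<Rightarrow> nat)" "\<forall>b\<in>B. (\<lambda>k. f (r k) b) \<longlonglongrightarrow> l b"
    by auto
  have "bounded (range (\<lambda>k. f (r k) b))"
    using insert.prems by (auto simp: bounded_real)
  then obtain x s where s: "strict_mono (s :: nat \<Rightarrow> nat)" "((\<lambda>k. f (r k) b) \<circ> s) \<longlonglongrightarrow> x"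
    using bounded_imp_convergent_subsequence by blast
  have "(\<lambda>k. f ((r \<circ> s) k) b') \<longlonglongrightarrow> (l(b := x)) b'" if "b' \<in> insert b B" for b'
    using that s(2) LIMSEQ_subseq_LIMSEQ[OF _ s(1)] r(2) by (auto simp: o_def)
  then show ?case
    using strict_mono_o[OF r(1) s(1)] by blast
qed

lemma finite_support_pmf:
  assumes "finite B" "\<And>b. b \<in> B \<Longrightarrow> 0 \<le> f b" "\<And>b. b \<notin> B \<Longrightarrow> f b = 0" "sum f B = 1"
  obtains p where "pmf p = f" "set_pmf p \<subseteq> B"
proof -
  have nn: "0 \<le> f b" for b using assms by (cases "b \<in> B") auto
  have "(\<integral>\<^sup>+x. ennreal (f x) \<partial>count_space UNIV) = (\<Sum>x\<in>B. ennreal (f x))"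
    using assms by (intro nn_integral_count_space') auto
  also have "\<dots> = 1" using assms nn by (simp add: sum_ennreal)
  finally have "pmf (embed_pmf f) = f" using nn by (intro ext pmf_embed_pmf) auto
  moreover from this have "set_pmf (embed_pmf f) \<subseteq> B"
    using assms(3) by (auto simp: set_pmf_eq)
  ultimately show thesis by (rule that)
qed

lemma pmf_seq_compact:
  fixes p :: "nat \<Rightarrow> 'a pmf"
  assumes "finite B" "\<And>k. set_pmf (p k) \<subseteq> B"
  obtains r q where "strict_mono r" "set_pmf q \<subseteq> B" "\<And>b. (\<lambda>k. pmf (p (r k)) b) \<longlonglongrightarrow> pmf q b"
proof -
  obtain r l where r: "strict_mono (r :: nat \<Rightarrow> nat)" and l: "\<And>b. b \<in> B \<Longrightarrow> (\<lambda>k. pmf (p (r k)) b) \<longlonglongrightarrow> l b"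
    using bounded_seq_convergent_subseq_on_finite[OF assms(1), of "\<lambda>k. pmf (p k)" 1]
    by (auto simp: pmf_le_1)
  have "(\<lambda>k. \<Sum>b\<in>B. pmf (p (r k)) b) \<longlonglongrightarrow> sum l B"
    by (intro tendsto_sum l)
  moreover have "(\<Sum>b\<in>B. pmf (p (r k)) b) = 1" for k
    using assms by (intro sum_pmf_eq_1) auto
  ultimately have sum: "sum l B = 1"
    by (simp add: LIMSEQ_const_iff)
  define f where "f b = (if b \<in> B then l b else 0)" for b
  obtain q where q: "pmf q = f" "set_pmf q \<subseteq> B"
  proof (rule finite_support_pmf[OF assms(1), of f])
    show "0 \<le> f b" if "b \<in> B" for b
      using l[OF that] that unfolding f_def by (auto intro: LIMSEQ_le_const)
  qed (auto simp: f_def sum)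
  have "(\<lambda>k. pmf (p (r k)) b) \<longlonglongrightarrow> pmf q b" for b
  proof (cases "b \<in> B")
    case False
    then have "pmf (p k) b = 0" for k using assms(2)[of k] by (auto simp: set_pmf_eq)
    then show ?thesis using False by (simp add: q f_def)
  qed (simp add: q f_def l)
  then show thesis using that r q by blast
qed

lemma expectation_tendsto_finite:
  fixes h :: "'a \<Rightarrow> real"
  assumes "finite B" "\<And>k. set_pmf (p k) \<subseteq> B" "set_pmf q \<subseteq> B"
    and "\<And>b. (\<lambda>k. pmf (p k) b) \<longlonglongrightarrow> pmf q b"
  shows "(\<lambda>k. measure_pmf.expectation (p k) h) \<longlonglongrightarrow> measure_pmf.expectation q h"
proof -
  have "measure_pmf.expectation s h = (\<Sum>b\<in>B. h b * pmf s b)" if "set_pmf s \<subseteq> B" for s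
    using that assms(1) by (intro integral_measure_pmf_real) auto
  then show ?thesis
    using assms by (simp add: tendsto_sum tendsto_mult)
qed

lemma bind_pmf_tendsto_finite:
  assumes "finite B" "\<And>k. set_pmf (p k) \<subseteq> B" "set_pmf q \<subseteq> B"
    and "\<And>b. (\<lambda>k. pmf (p k) b) \<longlonglongrightarrow> pmf q b"
  shows "(\<lambda>k. pmf (bind_pmf (p k) f) y) \<longlonglongrightarrow> pmf (bind_pmf q f) y"
  unfolding pmf_bind by (rule expectation_tendsto_finite[OF assms])

section \<open>Transport cost below a threshold\<close>

text \<open>A cost bound is the existence of one coupling, not a comparison with an infimum.
  Witnesses can be glued and mixed directly, and attainment of the infimum becomes a separate
  question.\<close>

definition coupling_le :: "('s \<Rightarrow> 's \<Rightarrow> real) \<Rightarrow> 's pmf \<Rightarrow> 's pmf \<Rightarrow> real \<Rightarrow> bool" where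
  "coupling_le d \<Delta> \<Theta> c \<longleftrightarrow> (\<exists>\<omega>. map_pmf fst \<omega> = \<Delta> \<and> map_pmf snd \<omega> = \<Theta> \<and>
     measure_pmf.expectation \<omega> (\<lambda>(x, y). d x y) \<le> c)"

lemma set_pmf_marginals:
  assumes "(x, y) \<in> set_pmf \<omega>"
  shows "x \<in> set_pmf (map_pmf fst \<omega>)" "y \<in> set_pmf (map_pmf snd \<omega>)"
  using assms by force+

lemma finite_set_pmf_marginals:
  assumes "finite (set_pmf (map_pmf fst \<omega>))" "finite (set_pmf (map_pmf snd \<omega>))"
  shows "finite (set_pmf \<omega>)"
  by (rule finite_subset[OF _ finite_cartesian_product[OF assms]]) force

lemma coupling_le_mono:
  assumes "coupling_le d \<Delta> \<Theta> c" "c \<le> c'" "finite (set_pmf \<Delta>)" "finite (set_pmf \<Theta>)"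
    and "\<And>x y. x \<in> set_pmf \<Delta> \<Longrightarrow> y \<in> set_pmf \<Theta> \<Longrightarrow> d' x y \<le> d x y"
  shows "coupling_le d' \<Delta> \<Theta> c'"
proof -
  obtain \<omega> where \<omega>: "map_pmf fst \<omega> = \<Delta>" "map_pmf snd \<omega> = \<Theta>"
      "measure_pmf.expectation \<omega> (\<lambda>(x, y). d x y) \<le> c"
    using assms(1) by (auto simp: coupling_le_def)
  have "measure_pmf.expectation \<omega> (\<lambda>(x, y). d' x y) \<le> measure_pmf.expectation \<omega> (\<lambda>(x, y). d x y)"
    using assms \<omega> finite_set_pmf_marginals[of \<omega>] set_pmf_marginals[of _ _ \<omega>]
    by (intro expectation_finite_mono) auto
  then show ?thesis using \<omega> assms(2) by (force simp: coupling_le_def)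
qed

text \<open>The independent coupling serves whenever the choice of coupling does not matter: below,
  one side is a Dirac distribution or the bound exceeds every value of the cost.\<close>

lemma coupling_le_product:
  assumes "finite (set_pmf \<Delta>)" "finite (set_pmf \<Theta>)"
    and "\<And>x y. x \<in> set_pmf \<Delta> \<Longrightarrow> y \<in> set_pmf \<Theta> \<Longrightarrow> d x y \<le> c"
  shows "coupling_le d \<Delta> \<Theta> c"
proof -
  have "measure_pmf.expectation (pair_pmf \<Delta> \<Theta>) (\<lambda>(x, y). d x y) \<le> measure_pmf.expectation (pair_pmf \<Delta> \<Theta>) (\<lambda>_. c)"
    using assms by (intro expectation_finite_mono) auto
  then show ?thesis
    unfolding coupling_le_def by (intro exI[of _ "pair_pmf \<Delta> \<Theta>"]) (auto simp: map_fst_pair_pmf map_snd_pair_pmf)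
qed

lemma coupling_le_diag:
  assumes "\<And>x. x \<in> set_pmf \<Delta> \<Longrightarrow> d x x = 0"
  shows "coupling_le d \<Delta> \<Delta> 0"
  unfolding coupling_le_def
proof (intro exI[of _ "map_pmf (\<lambda>x. (x, x)) \<Delta>"] conjI)
  show "measure_pmf.expectation (map_pmf (\<lambda>x. (x, x)) \<Delta>) (\<lambda>(x, y). d x y) \<le> 0"
    using expectation_finite_const[of \<Delta> "\<lambda>x. d x x" 0] assms by simp
qed (simp_all add: map_pmf_comp)

text \<open>Three cost functions occur because no triangle inequality is known for a single one when
  this is used: \<open>d\<close> will be a truncated infimum of \<open>d1 x z + d2 z y\<close> over
  \<open>z\<close>.\<close>

lemma coupling_le_trans:
  assumes "coupling_le d1 \<Delta> \<Theta> a" "coupling_le d2 \<Theta> \<Xi> b"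
    and fin: "finite (set_pmf \<Delta>)" "finite (set_pmf \<Theta>)" "finite (set_pmf \<Xi>)"
    and d: "\<And>x y z. \<lbrakk>x \<in> set_pmf \<Delta>; z \<in> set_pmf \<Theta>; y \<in> set_pmf \<Xi>\<rbrakk> \<Longrightarrow> d x y \<le> d1 x z + d2 z y"
  shows "coupling_le d \<Delta> \<Xi> (a + b)"
proof -
  obtain \<omega>1 where 1: "map_pmf fst \<omega>1 = \<Delta>" "map_pmf snd \<omega>1 = \<Theta>"
      "measure_pmf.expectation \<omega>1 (\<lambda>(x, y). d1 x y) \<le> a"
    using assms(1) by (auto simp: coupling_le_def)
  obtain \<omega>2 where 2: "map_pmf fst \<omega>2 = \<Theta>" "map_pmf snd \<omega>2 = \<Xi>"
      "measure_pmf.expectation \<omega>2 (\<lambda>(x, y). d2 x y) \<le> b"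
    using assms(2) by (auto simp: coupling_le_def)
  have "map_pmf snd \<omega>1 = map_pmf fst \<omega>2" unfolding 1 2 ..
  then obtain \<omega> where \<omega>1: "map_pmf (\<lambda>(x, z, y). (x, z)) \<omega> = \<omega>1"
    and \<omega>2: "map_pmf (\<lambda>(x, z, y). (z, y)) \<omega> = \<omega>2"
    by (rule glue_pmf)
  have m: "map_pmf fst \<omega> = \<Delta>" "map_pmf (\<lambda>(x, z, y). z) \<omega> = \<Theta>" "map_pmf (\<lambda>(x, z, y). y) \<omega> = \<Xi>"
    unfolding 1(1)[symmetric] 1(2)[symmetric] 2(2)[symmetric]
    by (simp_all add: \<omega>1[symmetric] \<omega>2[symmetric] map_pmf_comp split_def)
  have sub: "x \<in> set_pmf \<Delta> \<and> z \<in> set_pmf \<Theta> \<and> y \<in> set_pmf \<Xi>" if "(x, z, y) \<in> set_pmf \<omega>" for x y z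
    using that unfolding m[symmetric] by force
  have fin\<omega>: "finite (set_pmf \<omega>)"
    by (rule finite_subset[of _ "set_pmf \<Delta> \<times> set_pmf \<Theta> \<times> set_pmf \<Xi>"]) (use sub fin in auto)
  have "measure_pmf.expectation \<omega> (\<lambda>(x, z, y). d x y)
      \<le> measure_pmf.expectation \<omega> (\<lambda>u. (case u of (x, z, y) \<Rightarrow> d1 x z) + (case u of (x, z, y) \<Rightarrow> d2 z y))"
    using sub d by (intro expectation_finite_mono fin\<omega>) auto
  also have "\<dots> = measure_pmf.expectation \<omega>1 (\<lambda>(x, y). d1 x y) + measure_pmf.expectation \<omega>2 (\<lambda>(x, y). d2 x y)"
    unfolding \<omega>1[symmetric] \<omega>2[symmetric] integral_map_pmf
    by (subst Bochner_Integration.integral_add[symmetric])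
       (auto intro!: integrable_measure_pmf_finite fin\<omega> Bochner_Integration.integral_cong)
  also have "\<dots> \<le> a + b" using 1 2 by simp
  finally have "measure_pmf.expectation (map_pmf (\<lambda>(x, z, y). (x, y)) \<omega>) (\<lambda>(x, y). d x y) \<le> a + b"
    by (simp add: split_def)
  moreover have "map_pmf fst (map_pmf (\<lambda>(x, z, y). (x, y)) \<omega>) = \<Delta>"
    "map_pmf snd (map_pmf (\<lambda>(x, z, y). (x, y)) \<omega>) = \<Xi>"
    using m by (simp_all add: map_pmf_comp split_def)
  ultimately show ?thesis unfolding coupling_le_def by blast
qed

text \<open>Joint convexity of transport cost: mixing the couplings with the weights of
  \<open>\<iota>\<close> couples the mixtures, and the costs average.\<close>

lemma coupling_le_bind:
  assumes fin: "finite (set_pmf \<iota>)"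
    and c: "\<And>i. i \<in> set_pmf \<iota> \<Longrightarrow> coupling_le d (\<Delta> i) (\<Theta> i) (c i)"
    and fin': "\<And>i. i \<in> set_pmf \<iota> \<Longrightarrow> finite (set_pmf (\<Delta> i)) \<and> finite (set_pmf (\<Theta> i))"
  shows "coupling_le d (bind_pmf \<iota> \<Delta>) (bind_pmf \<iota> \<Theta>) (measure_pmf.expectation \<iota> c)"
proof -
  obtain \<omega> where \<omega>: "\<And>i. i \<in> set_pmf \<iota> \<Longrightarrow> map_pmf fst (\<omega> i) = \<Delta> i \<and> map_pmf snd (\<omega> i) = \<Theta> i \<and>
     measure_pmf.expectation (\<omega> i) (\<lambda>(x, y). d x y) \<le> c i"
    using c unfolding coupling_le_def by metis
  have "finite (set_pmf (\<omega> i))" if "i \<in> set_pmf \<iota>" for i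
    using \<omega>[OF that] fin'[OF that] finite_set_pmf_marginals[of "\<omega> i"] by simp
  then have "measure_pmf.expectation (bind_pmf \<iota> \<omega>) (\<lambda>(x, y). d x y) \<le> measure_pmf.expectation \<iota> c"
    using \<omega> fin by (subst expectation_bind_finite) (auto intro!: expectation_finite_mono)
  moreover have "map_pmf fst (bind_pmf \<iota> \<omega>) = bind_pmf \<iota> \<Delta>" "map_pmf snd (bind_pmf \<iota> \<omega>) = bind_pmf \<iota> \<Theta>"
    using \<omega> by (auto simp: map_bind_pmf intro!: bind_pmf_cong)
  ultimately show ?thesis unfolding coupling_le_def by blast
qed

text \<open>Transport to mixtures of finitely many distributions is a finite-dimensional linear programme, so its infimum is attained.\<close>

lemma coupling_le_mixture_attained:
  fixes d :: "'s \<Rightarrow> 's \<Rightarrow> real"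
  assumes fin: "finite E" "\<And>e. e \<in> E \<Longrightarrow> finite (set_pmf e)" "finite (set_pmf \<Delta>)"
    and approx: "\<And>c. c0 < c \<Longrightarrow> \<exists>\<mu>. set_pmf \<mu> \<subseteq> E \<and> coupling_le d \<Delta> (join_pmf \<mu>) c"
  shows "\<exists>\<mu>. set_pmf \<mu> \<subseteq> E \<and> coupling_le d \<Delta> (join_pmf \<mu>) c0"
proof -
  \<comment> \<open>The support of a mixture of elements of \<open>E\<close> lies in the union of
    their supports, so all couplings in question live on this one finite set.\<close>
  define B where "B = set_pmf \<Delta> \<times> (\<Union>e\<in>E. set_pmf e)"
  have finB: "finite B" using fin by (auto simp: B_def)
  obtain l w where l: "\<And>k. set_pmf (l k) \<subseteq> E"
    and w: "\<And>k::nat. map_pmf fst (w k) = \<Delta>" "\<And>k. map_pmf snd (w k) = join_pmf (l k)"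
      "\<And>k. measure_pmf.expectation (w k) (\<lambda>(x, y). d x y) \<le> c0 + inverse (real (Suc k))"
  proof -
    have "\<forall>k. \<exists>\<mu> \<omega>. set_pmf \<mu> \<subseteq> E \<and> map_pmf fst \<omega> = \<Delta> \<and> map_pmf snd \<omega> = join_pmf \<mu> \<and>
        measure_pmf.expectation \<omega> (\<lambda>(x, y). d x y) \<le> c0 + inverse (real (Suc k))"
      using approx[of "c0 + inverse (real (Suc k))" for k] unfolding coupling_le_def by simp
    then show thesis unfolding choice_iff using that by blast
  qed
  have wB: "set_pmf (w k) \<subseteq> B" for k
  proof
    fix u assume u: "u \<in> set_pmf (w k)"
    then have "fst u \<in> set_pmf \<Delta>" "snd u \<in> set_pmf (join_pmf (l k))"
      unfolding w(1)[of k, symmetric] w(2)[of k, symmetric] by auto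
    then show "u \<in> B" using l[of k] by (cases u) (auto simp: B_def join_pmf_def)
  qed
  \<comment> \<open>Extract twice: the mixing weights converge along \<open>r\<close>, the couplings
    along a further subsequence \<open>s\<close>, which keeps the first limit.\<close>
  obtain r L where r: "strict_mono r" "set_pmf L \<subseteq> E" "\<And>b. (\<lambda>k. pmf (l (r k)) b) \<longlonglongrightarrow> pmf L b"
    using pmf_seq_compact[OF fin(1), of l] l by auto
  obtain s W where s: "strict_mono s" "set_pmf W \<subseteq> B" "\<And>b. (\<lambda>k. pmf (w (r (s k))) b) \<longlonglongrightarrow> pmf W b"
    using pmf_seq_compact[OF finB, of "\<lambda>k. w (r k)"] wB by auto
  have L: "(\<lambda>k. pmf (l (r (s k))) b) \<longlonglongrightarrow> pmf L b" for b
    using LIMSEQ_subseq_LIMSEQ[OF r(3) s(1)] by (simp add: o_def)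
  \<comment> \<open>Binding with a fixed kernel is continuous in the first argument. Since
    \<open>map_pmf\<close> is such a bind, both marginals pass to the limit.\<close>
  have W: "(\<lambda>k. pmf (bind_pmf (w (r (s k))) f) y) \<longlonglongrightarrow> pmf (bind_pmf W f) y" for f :: "_ \<Rightarrow> 's pmf" and y
    using wB s by (intro bind_pmf_tendsto_finite[OF finB])
  have "(\<lambda>k. pmf (map_pmf fst (w (r (s k)))) y) \<longlonglongrightarrow> pmf (map_pmf fst W) y" for y
    unfolding map_pmf_def by (rule W)
  then have "map_pmf fst W = \<Delta>"
    unfolding w(1) by (intro pmf_eqI) (blast intro: LIMSEQ_unique tendsto_const)
  moreover have "(\<lambda>k. pmf (map_pmf snd (w (r (s k)))) y) \<longlonglongrightarrow> pmf (map_pmf snd W) y" for y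
    unfolding map_pmf_def by (rule W)
  then have "map_pmf snd W = join_pmf L"
    unfolding w(2) join_pmf_def using bind_pmf_tendsto_finite[OF fin(1) l r(2) L, of "\<lambda>x. x"]
    by (intro pmf_eqI) (blast intro: LIMSEQ_unique)
  moreover have "measure_pmf.expectation W (\<lambda>(x, y). d x y) \<le> c0 + 0"
  proof (rule LIMSEQ_le)
    show "(\<lambda>k. measure_pmf.expectation (w (r (s k))) (\<lambda>(x, y). d x y))
        \<longlonglongrightarrow> measure_pmf.expectation W (\<lambda>(x, y). d x y)"
      using wB s by (intro expectation_tendsto_finite[OF finB])
    show "(\<lambda>k. c0 + inverse (real (Suc (r (s k))))) \<longlonglongrightarrow> c0 + 0"
      using LIMSEQ_subseq_LIMSEQ[OF LIMSEQ_inverse_real_of_nat strict_mono_o[OF r(1) s(1)]]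
      by (intro tendsto_add tendsto_const) (simp add: o_def)
  qed (use w in blast)
  ultimately show ?thesis using r unfolding coupling_le_def by auto
qed

section \<open>Minimal simulation distances on a transition system\<close>

text \<open>Through \<open>\<rho>\<close> one state may be sent to several derivatives with
  different probabilities, so schedulers are randomised. This mirrors decompositions of a
  distribution into weighted states with repetitions.\<close>

definition lift_rel :: "('s \<Rightarrow> 's pmf set) \<Rightarrow> 's pmf \<Rightarrow> 's pmf \<Rightarrow> bool" where
  "lift_rel F \<Delta> \<Theta> \<longleftrightarrow> (\<exists>\<rho>. map_pmf fst \<rho> = \<Delta> \<and> bind_pmf \<rho> snd = \<Theta> \<and> (\<forall>(s, e)\<in>set_pmf \<rho>. e \<in> F s))"

lemma lift_relI:
  assumes "\<And>i. i \<in> set_pmf \<iota> \<Longrightarrow> e i \<in> F (s i)"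
  shows "lift_rel F (map_pmf s \<iota>) (bind_pmf \<iota> e)"
  unfolding lift_rel_def using assms
  by (intro exI[of _ "map_pmf (\<lambda>i. (s i, e i)) \<iota>"]) (auto simp: map_pmf_comp bind_map_pmf)

lemma lift_rel_return: "e \<in> F s \<Longrightarrow> lift_rel F (return_pmf s) e"
  using lift_relI[of "return_pmf ()" "\<lambda>_. e" F "\<lambda>_. s"] by (simp add: bind_return_pmf)

lemma lift_rel_mono: "lift_rel F \<Delta> \<Theta> \<Longrightarrow> (\<And>s. s \<in> set_pmf \<Delta> \<Longrightarrow> F s \<subseteq> G s) \<Longrightarrow> lift_rel G \<Delta> \<Theta>"
  unfolding lift_rel_def by force

lemma lift_rel_return_joinE:
  assumes "lift_rel F (return_pmf s) \<Theta>"
  obtains \<mu> where "set_pmf \<mu> \<subseteq> F s" "\<Theta> = join_pmf \<mu>"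
proof -
  obtain \<rho> where \<rho>: "map_pmf fst \<rho> = return_pmf s" "bind_pmf \<rho> snd = \<Theta>" "\<forall>(s, e)\<in>set_pmf \<rho>. e \<in> F s"
    using assms by (auto simp: lift_rel_def)
  have "fst u = s" if "u \<in> set_pmf \<rho>" for u
    using that arg_cong[OF \<rho>(1), of set_pmf] by auto
  then show thesis
    using \<rho> by (intro that[of "map_pmf snd \<rho>"]) (force simp: join_pmf_def bind_map_pmf)+
qed

text \<open>Convexity of the graph of \<open>R\<close>: source and target are mixed with the same
  weights. This assembles answers found state by state.\<close>

definition mixture_closed :: "('s pmf \<Rightarrow> 's pmf \<Rightarrow> bool) \<Rightarrow> bool" where
  "mixture_closed R \<longleftrightarrow> (\<forall>\<mu>. finite (set_pmf \<mu>) \<longrightarrow> (\<forall>(\<Delta>, \<Theta>)\<in>set_pmf \<mu>. R \<Delta> \<Theta>) \<longrightarrow>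
     R (bind_pmf \<mu> fst) (bind_pmf \<mu> snd))"

lemma mixture_closedD:
  assumes "mixture_closed R" "finite (set_pmf \<iota>)" "\<And>i. i \<in> set_pmf \<iota> \<Longrightarrow> R (\<Delta> i) (\<Theta> i)"
  shows "R (bind_pmf \<iota> \<Delta>) (bind_pmf \<iota> \<Theta>)"
  using assms(1)[unfolded mixture_closed_def, rule_format, of "map_pmf (\<lambda>i. (\<Delta> i, \<Theta> i)) \<iota>"] assms(2,3)
  by (auto simp: bind_map_pmf)

lemma mixture_closed_lift_rel: "mixture_closed (lift_rel F)"
  unfolding mixture_closed_def
proof (intro allI impI)
  fix \<mu> :: "('a pmf \<times> 'a pmf) pmf"
  assume "\<forall>(\<Delta>, \<Theta>)\<in>set_pmf \<mu>. lift_rel F \<Delta> \<Theta>"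
  then have "\<forall>u\<in>set_pmf \<mu>. \<exists>\<rho>. map_pmf fst \<rho> = fst u \<and> bind_pmf \<rho> snd = snd u \<and> (\<forall>(s, e)\<in>set_pmf \<rho>. e \<in> F s)"
    by (auto simp: lift_rel_def split_def)
  then obtain \<rho> where "\<forall>u\<in>set_pmf \<mu>. map_pmf fst (\<rho> u) = fst u \<and> bind_pmf (\<rho> u) snd = snd u \<and>
      (\<forall>(s, e)\<in>set_pmf (\<rho> u). e \<in> F s)"
    by (auto simp: bchoice_iff)
  then show "lift_rel F (bind_pmf \<mu> fst) (bind_pmf \<mu> snd)"
    unfolding lift_rel_def
    by (intro exI[of _ "bind_pmf \<mu> \<rho>"])
       (fastforce simp: map_bind_pmf bind_assoc_pmf intro!: bind_pmf_cong)
qed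

lemma mixture_closed_OO:
  assumes "mixture_closed R" "mixture_closed Q"
  shows "mixture_closed (R OO Q)"
  unfolding mixture_closed_def
proof (intro allI impI)
  fix \<mu> :: "('a pmf \<times> 'a pmf) pmf"
  assume fin: "finite (set_pmf \<mu>)" and "\<forall>(\<Delta>, \<Theta>)\<in>set_pmf \<mu>. (R OO Q) \<Delta> \<Theta>"
  then have "\<forall>u\<in>set_pmf \<mu>. \<exists>\<Xi>. R (fst u) \<Xi> \<and> Q \<Xi> (snd u)"
    by (auto simp: split_def OO_def)
  then obtain \<Xi> where "\<forall>u\<in>set_pmf \<mu>. R (fst u) (\<Xi> u) \<and> Q (\<Xi> u) (snd u)"
    by (auto simp: bchoice_iff)
  then show "(R OO Q) (bind_pmf \<mu> fst) (bind_pmf \<mu> snd)"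
    using mixture_closedD[OF assms(1) fin, of fst \<Xi>] mixture_closedD[OF assms(2) fin, of \<Xi> snd]
    by (intro relcomppI) auto
qed

text \<open>Reflexivity lets all components of a finite mixture run for the same number of steps.\<close>

lemma mixture_closed_rtranclp:
  assumes mix: "mixture_closed R" and refl: "\<And>\<Delta>. R \<Delta> \<Delta>"
  shows "mixture_closed R\<^sup>*\<^sup>*"
  unfolding mixture_closed_def
proof (intro allI impI)
  fix \<mu> :: "('a pmf \<times> 'a pmf) pmf"
  assume fin: "finite (set_pmf \<mu>)" and "\<forall>(\<Delta>, \<Theta>)\<in>set_pmf \<mu>. R\<^sup>*\<^sup>* \<Delta> \<Theta>"
  then have "\<forall>u\<in>set_pmf \<mu>. \<exists>n. (R ^^ n) (fst u) (snd u)"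
    by (auto simp: rtranclp_is_Sup_relpowp)
  then obtain n where n: "\<And>u. u \<in> set_pmf \<mu> \<Longrightarrow> (R ^^ n u) (fst u) (snd u)"
    by (auto simp: bchoice_iff)
  have step: "(R ^^ Suc k) \<Delta> \<Theta>" if "(R ^^ k) \<Delta> \<Theta>" for k \<Delta> \<Theta>
    using that refl by auto
  have mono: "(R ^^ k') \<Delta> \<Theta>" if "(R ^^ k) \<Delta> \<Theta>" "k \<le> k'" for k k' \<Delta> \<Theta>
    using that(2,1) by (induction k' rule: dec_induct) (auto intro: step simp del: relpowp.simps)
  have "mixture_closed (R ^^ k)" for k
  proof (induction k)
    case (Suc k)
    then show ?case using mix by (simp add: mixture_closed_OO)
  qed (auto simp: mixture_closed_def intro!: bind_pmf_cong)
  from mixture_closedD[OF this fin, of "Max (n ` set_pmf \<mu>)" fst snd]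
  show "R\<^sup>*\<^sup>* (bind_pmf \<mu> fst) (bind_pmf \<mu> snd)"
    using n fin by (intro relpowp_imp_rtranclp) (blast intro: mono Max_ge)
qed

section \<open>Deterministic two-stage choices\<close>

text \<open>The function \<open>g\<close> fixes one continuation per intermediate state, as a
  deterministic scheduler does; over a finite support only finitely many such functions
  matter.\<close>

definition comp_gen :: "('s \<Rightarrow> 's pmf set) \<Rightarrow> ('s \<Rightarrow> 's pmf set) \<Rightarrow> 's \<Rightarrow> 's pmf set" where
  "comp_gen F G s = {bind_pmf e g |e g. e \<in> F s \<and> (\<forall>s'\<in>set_pmf e. g s' \<in> G s')}"

lemma finite_comp_gen:
  assumes "finite (F s)" "\<And>e. e \<in> F s \<Longrightarrow> finite (set_pmf e)"
    and "\<And>e s'. e \<in> F s \<Longrightarrow> s' \<in> set_pmf e \<Longrightarrow> finite (G s')"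
  shows "finite (comp_gen F G s)"
proof (rule finite_subset)
  show "comp_gen F G s \<subseteq> (\<Union>e\<in>F s. bind_pmf e ` PiE (set_pmf e) G)"
  proof
    fix \<Theta> assume "\<Theta> \<in> comp_gen F G s"
    then obtain e g where eg: "\<Theta> = bind_pmf e g" "e \<in> F s" "\<forall>s'\<in>set_pmf e. g s' \<in> G s'"
      by (auto simp: comp_gen_def)
    have "\<Theta> = bind_pmf e (restrict g (set_pmf e))"
      unfolding eg by (rule bind_pmf_cong) auto
    then show "\<Theta> \<in> (\<Union>e\<in>F s. bind_pmf e ` PiE (set_pmf e) G)"
      using eg by (intro UN_I[of e] image_eqI[of _ _ "restrict g (set_pmf e)"]) auto
  qed
  show "finite (\<Union>e\<in>F s. bind_pmf e ` PiE (set_pmf e) G)"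
    using assms by (intro finite_UN_I finite_imageI finite_PiE) auto
qed

text \<open>Independently randomising the choice at each intermediate state is a mixture of deterministic
  choice functions, drawn from the product distribution.\<close>

lemma lift_rel_comp:
  assumes "lift_rel F \<Delta> \<Delta>1" "lift_rel G \<Delta>1 \<Theta>"
    and fin: "\<And>s e. s \<in> set_pmf \<Delta> \<Longrightarrow> e \<in> F s \<Longrightarrow> finite (set_pmf e)"
  shows "lift_rel (comp_gen F G) \<Delta> \<Theta>"
proof -
  obtain \<rho>1 where 1: "map_pmf fst \<rho>1 = \<Delta>" "bind_pmf \<rho>1 snd = \<Delta>1" "\<forall>(s, e)\<in>set_pmf \<rho>1. e \<in> F s"
    using assms(1) by (auto simp: lift_rel_def)
  obtain \<rho>2 where 2: "map_pmf fst \<rho>2 = \<Delta>1" "bind_pmf \<rho>2 snd = \<Theta>" "\<forall>(s, e)\<in>set_pmf \<rho>2. e \<in> G s"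
    using assms(2) by (auto simp: lift_rel_def)
  \<comment> \<open>The support of the kernel is needed too: whatever it draws at \<open>x\<close>
    must be one of the allowed derivatives of \<open>x\<close>.\<close>
  obtain \<kappa> where \<kappa>0: "\<rho>2 = bind_pmf (map_pmf fst \<rho>2) (\<lambda>x. map_pmf (Pair x) (\<kappa> x))"
    and "\<And>x. x \<in> fst ` set_pmf \<rho>2 \<Longrightarrow> set_pmf (\<kappa> x) = {y. (x, y) \<in> set_pmf \<rho>2}"
    by (rule disintegrate_pmf[of \<rho>2]) blast
  then have set\<kappa>: "\<And>x. x \<in> set_pmf \<Delta>1 \<Longrightarrow> set_pmf (\<kappa> x) = {y. (x, y) \<in> set_pmf \<rho>2}"
    unfolding 2(1)[symmetric] by simp
  have \<kappa>: "\<rho>2 = bind_pmf \<Delta>1 (\<lambda>x. map_pmf (Pair x) (\<kappa> x))"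
    using \<kappa>0 unfolding 2(1) .
  \<comment> \<open>The default \<open>undefined\<close> is taken only outside the support of
    \<open>e\<close>, where \<open>bind_pmf e g\<close> never looks.\<close>
  define P where "P e = Pi_pmf (set_pmf e) undefined \<kappa>" for e
  define \<iota> where "\<iota> = bind_pmf \<rho>1 (\<lambda>(s, e). map_pmf (\<lambda>g. (s, e, g)) (P e))"
  have fin1: "finite (set_pmf e)" if "(s, e) \<in> set_pmf \<rho>1" for s e
    using that 1 fin[of s e] by force
  \<comment> \<open>Drawing the state before the continuation amounts to drawing the whole choice
    function first: the component of the product at \<open>x\<close> has law
    \<open>\<kappa> x\<close>, and the two draws commute.\<close>
  have P: "bind_pmf e (\<lambda>x. bind_pmf (\<kappa> x) (\<lambda>u. u)) = bind_pmf (P e) (bind_pmf e)" if "finite (set_pmf e)" for e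
  proof -
    have "bind_pmf e (\<lambda>x. bind_pmf (\<kappa> x) (\<lambda>u. u)) = bind_pmf e (\<lambda>x. bind_pmf (map_pmf (\<lambda>g. g x) (P e)) (\<lambda>u. u))"
      unfolding P_def using that by (intro bind_pmf_cong refl) (simp add: Pi_pmf_component)
    also have "\<dots> = bind_pmf (P e) (bind_pmf e)"
      unfolding bind_map_pmf by (rule bind_commute_pmf)
    finally show ?thesis .
  qed
  have "\<Theta> = bind_pmf \<rho>1 (\<lambda>(s, e). bind_pmf e (\<lambda>x. bind_pmf (\<kappa> x) (\<lambda>u. u)))"
    unfolding 2(2)[symmetric] \<kappa> 1(2)[symmetric] by (simp add: bind_assoc_pmf bind_map_pmf split_def)
  also have "\<dots> = bind_pmf \<rho>1 (\<lambda>(s, e). bind_pmf (P e) (bind_pmf e))"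
    using P fin1 by (intro bind_pmf_cong refl) auto
  also have "\<dots> = bind_pmf \<iota> (\<lambda>(s, e, g). bind_pmf e g)"
    unfolding \<iota>_def bind_assoc_pmf by (simp add: split_def bind_map_pmf)
  finally have \<Theta>: "\<Theta> = bind_pmf \<iota> (\<lambda>(s, e, g). bind_pmf e g)" .
  have \<Delta>: "\<Delta> = map_pmf fst \<iota>"
    unfolding \<iota>_def 1(1)[symmetric] by (simp add: map_bind_pmf split_def map_pmf_comp map_pmf_def[symmetric])
  show ?thesis
    unfolding \<Theta> \<Delta>
  proof (rule lift_relI)
    fix i assume i: "i \<in> set_pmf \<iota>"
    then obtain s e g where seg: "i = (s, e, g)" "(s, e) \<in> set_pmf \<rho>1" "g \<in> set_pmf (P e)"
      by (auto simp: \<iota>_def)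
    have "g s' \<in> G s'" if "s' \<in> set_pmf e" for s'
    proof -
      have "g s' \<in> set_pmf (\<kappa> s')"
        using seg(3) that set_Pi_pmf[OF fin1[OF seg(2)], of undefined \<kappa>] by (auto simp: P_def PiE_dflt_def)
      moreover have "s' \<in> set_pmf \<Delta>1" using seg(2) that unfolding 1(2)[symmetric] by force
      ultimately show ?thesis using set\<kappa> 2(3) by auto
    qed
    then show "(case i of (s, e, g) \<Rightarrow> bind_pmf e g) \<in> comp_gen F G (fst i)"
      using seg 1(3) unfolding comp_gen_def by force
  qed
qed

definition finitary :: "'s set \<Rightarrow> ('s \<Rightarrow> 's pmf set) \<Rightarrow> bool" where
  "finitary S G \<longleftrightarrow> (\<forall>s\<in>S. finite (G s) \<and> (\<forall>e\<in>G s. finite (set_pmf e) \<and> set_pmf e \<subseteq> S))"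

lemma finitary_comp_gen: "finitary S F \<Longrightarrow> finitary S G \<Longrightarrow> finitary S (comp_gen F G)"
  unfolding finitary_def
proof (intro ballI conjI)
  fix s assume F: "\<forall>s\<in>S. finite (F s) \<and> (\<forall>e\<in>F s. finite (set_pmf e) \<and> set_pmf e \<subseteq> S)"
    and G: "\<forall>s\<in>S. finite (G s) \<and> (\<forall>e\<in>G s. finite (set_pmf e) \<and> set_pmf e \<subseteq> S)" and s: "s \<in> S"
  show "finite (comp_gen F G s)"
    using F G s by (intro finite_comp_gen) blast+
  fix e assume "e \<in> comp_gen F G s"
  then obtain e' g where e: "e = bind_pmf e' g" and e': "e' \<in> F s" and g: "\<forall>s'\<in>set_pmf e'. g s' \<in> G s'"
    by (auto simp: comp_gen_def)
  have "finite (set_pmf e') \<and> set_pmf e' \<subseteq> S" using F s e' by blast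
  moreover from this g have "\<forall>s'\<in>set_pmf e'. finite (set_pmf (g s')) \<and> set_pmf (g s') \<subseteq> S"
    using G by blast
  ultimately show "finite (set_pmf e)" "set_pmf e \<subseteq> S"
    unfolding e by auto
qed

definition finite_on :: "'s set \<Rightarrow> 's pmf \<Rightarrow> bool" where
  "finite_on S \<Delta> \<longleftrightarrow> finite (set_pmf \<Delta>) \<and> set_pmf \<Delta> \<subseteq> S"

lemma finite_on_return [simp]: "finite_on S (return_pmf s) \<longleftrightarrow> s \<in> S"
  by (simp add: finite_on_def)

lemma lift_rel_finite_support:
  assumes "finitary S G" "finite_on S \<Delta>" "lift_rel G \<Delta> \<Theta>"
  shows "finite_on S \<Theta>"
proof -
  obtain \<rho> where \<rho>: "map_pmf fst \<rho> = \<Delta>" "bind_pmf \<rho> snd = \<Theta>" "\<forall>(s, e)\<in>set_pmf \<rho>. e \<in> G s"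
    using assms(3) by (auto simp: lift_rel_def)
  have "set_pmf \<Theta> \<subseteq> (\<Union>s\<in>set_pmf \<Delta>. \<Union>e\<in>G s. set_pmf e)"
    using \<rho>(3) unfolding \<rho>(1,2)[symmetric] by (force simp: set_bind_pmf)
  moreover have "finite (\<Union>s\<in>set_pmf \<Delta>. \<Union>e\<in>G s. set_pmf e)" "(\<Union>s\<in>set_pmf \<Delta>. \<Union>e\<in>G s. set_pmf e) \<subseteq> S"
    using assms(1,2) unfolding finitary_def finite_on_def by blast+
  ultimately show ?thesis unfolding finite_on_def by (meson finite_subset order_trans)
qed

text \<open>\<open>F a s\<close> is the set of \<open>a\<close>-derivatives of \<open>s\<close>, made total by sending a state without
  any to the Dirac distribution at the sink \<open>bot\<close>.\<close>

locale weak_lts =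
  fixes S :: "'s set" and bot :: 's and F :: "'l \<Rightarrow> 's \<Rightarrow> 's pmf set" and tau :: 'l
    and rank :: "'s \<Rightarrow> nat" and Obs :: "'l set"
  assumes bot_in: "bot \<in> S"
    and F_bot: "F a bot = {return_pmf bot}"
    and F_nonempty: "s \<in> S \<Longrightarrow> F a s \<noteq> {}"
    and F_finitary: "finitary S (F a)"
    and F_tau_refl: "return_pmf s \<in> F tau s"
    and F_tau_rank: "\<lbrakk>s \<in> S; e \<in> F tau s; e \<noteq> return_pmf s; s' \<in> set_pmf e\<rbrakk> \<Longrightarrow> rank s' < rank s"
    and tau_Obs: "tau \<in> Obs"
begin

section \<open>Weak moves and their finite generation\<close>

definition tau_star :: "'s pmf \<Rightarrow> 's pmf \<Rightarrow> bool" where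
  "tau_star = (lift_rel (F tau))\<^sup>*\<^sup>*"

definition weak :: "'l \<Rightarrow> 's pmf \<Rightarrow> 's pmf \<Rightarrow> bool" where
  "weak a = (if a = tau then tau_star else tau_star OO lift_rel (F a) OO tau_star)"

lemma lift_rel_tau_refl: "lift_rel (F tau) \<Delta> \<Delta>"
  using lift_relI[of \<Delta> return_pmf "F tau" "\<lambda>s. s"] F_tau_refl by (simp add: bind_return_pmf')

lemma tau_star_refl: "tau_star \<Delta> \<Delta>"
  by (simp add: tau_star_def)

lemma tau_star_trans: "tau_star \<Delta> \<Theta> \<Longrightarrow> tau_star \<Theta> \<Xi> \<Longrightarrow> tau_star \<Delta> \<Xi>"
  unfolding tau_star_def by (rule rtranclp_trans)

lemma mixture_closed_tau_star: "mixture_closed tau_star"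
  unfolding tau_star_def by (intro mixture_closed_rtranclp mixture_closed_lift_rel lift_rel_tau_refl)

lemma mixture_closed_weak: "mixture_closed (weak a)"
  unfolding weak_def
  by (simp add: mixture_closed_OO mixture_closed_tau_star mixture_closed_lift_rel)

text \<open>Excluding the idle derivative from \<open>go\<close> makes every unfolding lower the
  rank of all successors; idling is represented by \<open>stop\<close>.\<close>

inductive sched :: "'s \<Rightarrow> 's pmf \<Rightarrow> bool" where
  stop: "sched s (return_pmf s)"
| go: "\<lbrakk>\<Delta> \<in> F tau s; \<Delta> \<noteq> return_pmf s; \<And>s'. s' \<in> set_pmf \<Delta> \<Longrightarrow> sched s' (g s')\<rbrakk> \<Longrightarrow> sched s (bind_pmf \<Delta> g)"

text \<open>Induction on the rank: a scheduler either stops or makes one of finitely many proper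
  moves and then continues at lower-ranked successors, where only finitely many outcomes exist by
  induction.\<close>

lemma finitary_sched: "finitary S (\<lambda>s. {\<Theta>. sched s \<Theta>})"
  unfolding finitary_def
proof
  fix s assume "s \<in> S"
  then show "finite {\<Theta>. sched s \<Theta>} \<and> (\<forall>e\<in>{\<Theta>. sched s \<Theta>}. finite (set_pmf e) \<and> set_pmf e \<subseteq> S)"
  proof (induction "rank s" arbitrary: s rule: less_induct)
    case less
    let ?T = "\<lambda>s. F tau s - {return_pmf s}" and ?E = "\<lambda>s. {\<Theta>. sched s \<Theta>}"
    have T: "finite (?T s)" "\<And>e. e \<in> ?T s \<Longrightarrow> finite (set_pmf e) \<and> set_pmf e \<subseteq> S"
      using F_finitary[of tau] less.prems by (auto simp: finitary_def)
    have IH: "finite (?E s') \<and> (\<forall>e\<in>?E s'. finite (set_pmf e) \<and> set_pmf e \<subseteq> S)"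
      if "e \<in> ?T s" "s' \<in> set_pmf e" for e s'
      using that T(2)[OF that(1)] F_tau_rank[OF less.prems, of e s'] by (intro less.hyps) auto
    have sub: "?E s \<subseteq> insert (return_pmf s) (comp_gen ?T ?E s)"
    proof
      fix \<Theta> assume "\<Theta> \<in> ?E s"
      then have "sched s \<Theta>" by simp
      then show "\<Theta> \<in> insert (return_pmf s) (comp_gen ?T ?E s)"
        by cases (auto simp: comp_gen_def)
    qed
    have "finite (comp_gen ?T ?E s)"
      using T IH by (intro finite_comp_gen) blast+
    moreover have "finite (set_pmf e) \<and> set_pmf e \<subseteq> S" if e: "e \<in> comp_gen ?T ?E s" for e
    proof -
      obtain e' g where e': "e = bind_pmf e' g" "e' \<in> ?T s" "\<forall>s'\<in>set_pmf e'. g s' \<in> ?E s'"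
        using e unfolding comp_gen_def by blast
      have "finite (set_pmf (g s')) \<and> set_pmf (g s') \<subseteq> S" if "s' \<in> set_pmf e'" for s'
        using IH[OF e'(2) that] e'(3) that by blast
      then show ?thesis using T(2)[OF e'(2)] e'(1) by (auto simp: set_bind_pmf)
    qed
    ultimately show ?case
      using finite_subset[OF sub] subsetD[OF sub] less.prems by fastforce
  qed
qed

text \<open>Branches of a scheduler may stop after different numbers of moves; mixture closure of
  \<open>tau_star\<close>, which rests on idling, runs them side by side.\<close>

lemma sched_tau_star: "sched s \<Theta> \<Longrightarrow> s \<in> S \<Longrightarrow> tau_star (return_pmf s) \<Theta>"
proof (induction rule: sched.induct)
  case (stop s)
  show ?case by (rule tau_star_refl)
next
  case (go \<Delta> s g)
  have \<Delta>: "finite (set_pmf \<Delta>)" "set_pmf \<Delta> \<subseteq> S"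
    using F_finitary[of tau] go by (auto simp: finitary_def)
  have "tau_star (bind_pmf \<Delta> return_pmf) (bind_pmf \<Delta> g)"
    using go.IH \<Delta> by (intro mixture_closedD[OF mixture_closed_tau_star]) auto
  moreover have "tau_star (return_pmf s) \<Delta>"
    using lift_rel_return[where F = "F tau", OF go.hyps(1)] unfolding tau_star_def by (rule r_into_rtranclp)
  ultimately show ?case using tau_star_trans by (simp add: bind_return_pmf')
qed

lemma tau_star_imp_lift_sched:
  assumes "tau_star \<Delta> \<Theta>" "finite_on S \<Delta>"
  shows "lift_rel (\<lambda>s. {\<Theta>. sched s \<Theta>}) \<Delta> \<Theta>"
  using assms unfolding tau_star_def
proof (induction rule: converse_rtranclp_induct)
  case base
  show ?case
    using lift_relI[of \<Theta> return_pmf "\<lambda>s. {\<Theta>. sched s \<Theta>}" "\<lambda>s. s"] sched.stop by (simp add: bind_return_pmf')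
next
  case (step \<Delta> \<Delta>1)
  have fin: "finite (set_pmf e)" if "s \<in> set_pmf \<Delta>" "e \<in> F tau s" for s e
    using that step.prems F_finitary[of tau] by (auto simp: finitary_def finite_on_def)
  have "lift_rel (\<lambda>s. {\<Theta>. sched s \<Theta>}) \<Delta>1 \<Theta>"
    using step.prems step.hyps(1) lift_rel_finite_support[OF F_finitary] by (intro step.IH) blast
  then have "lift_rel (comp_gen (F tau) (\<lambda>s. {\<Theta>. sched s \<Theta>})) \<Delta> \<Theta>"
    by (rule lift_rel_comp[OF step.hyps(1) _ fin])
  then show ?case
  proof (rule lift_rel_mono)
    fix s
    show "comp_gen (F tau) (\<lambda>s. {\<Theta>. sched s \<Theta>}) s \<subseteq> {\<Theta>. sched s \<Theta>}"
    proof
      fix \<Theta> assume "\<Theta> \<in> comp_gen (F tau) (\<lambda>s. {\<Theta>. sched s \<Theta>}) s"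
      then obtain e g where eg: "\<Theta> = bind_pmf e g" "e \<in> F tau s" "\<forall>s'\<in>set_pmf e. sched s' (g s')"
        by (auto simp: comp_gen_def)
      \<comment> \<open>If the first move idles, the composite is already the outcome
        \<open>g s\<close>.\<close>
      then show "\<Theta> \<in> {\<Theta>. sched s \<Theta>}"
        by (cases "e = return_pmf s") (auto simp: bind_return_pmf intro: sched.go)
    qed
  qed
qed

text \<open>For a mixture-closed \<open>R\<close> this says that the targets of the Dirac
  distribution at \<open>s\<close> are the convex hull of the finite set \<open>G s\<close>. The
  last clause admits arbitrary finite sources because a composition continues from the non-Dirac
  outcome of its first factor.\<close>

definition generates :: "('s \<Rightarrow> 's pmf set) \<Rightarrow> ('s pmf \<Rightarrow> 's pmf \<Rightarrow> bool) \<Rightarrow> bool" where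
  "generates G R \<longleftrightarrow> finitary S G \<and> (\<forall>s\<in>S. \<forall>e\<in>G s. R (return_pmf s) e) \<and>
     (\<forall>\<Delta> \<Theta>. finite_on S \<Delta> \<longrightarrow> R \<Delta> \<Theta> \<longrightarrow> lift_rel G \<Delta> \<Theta>)"

lemma generates_OO:
  assumes G: "generates G R" and H: "generates H Q" and mix: "mixture_closed Q"
  shows "generates (comp_gen G H) (R OO Q)"
  unfolding generates_def
proof (intro conjI ballI allI impI)
  show "finitary S (comp_gen G H)"
    using G H by (simp add: generates_def finitary_comp_gen)
next
  fix s \<Theta> assume s: "s \<in> S" and "\<Theta> \<in> comp_gen G H s"
  then obtain e g where eg: "\<Theta> = bind_pmf e g" "e \<in> G s" "\<forall>s'\<in>set_pmf e. g s' \<in> H s'"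
    by (auto simp: comp_gen_def)
  have "finite (set_pmf e)" "set_pmf e \<subseteq> S"
    using G s eg by (auto simp: generates_def finitary_def)
  then have "Q (bind_pmf e return_pmf) (bind_pmf e g)"
    using H eg by (intro mixture_closedD[OF mix]) (auto simp: generates_def)
  moreover have "R (return_pmf s) e" using G s eg by (auto simp: generates_def)
  ultimately show "(R OO Q) (return_pmf s) \<Theta>" unfolding eg by (auto simp: bind_return_pmf')
next
  fix \<Delta> \<Theta> assume \<Delta>: "finite_on S \<Delta>" and "(R OO Q) \<Delta> \<Theta>"
  then obtain \<Delta>1 where 1: "R \<Delta> \<Delta>1" "Q \<Delta>1 \<Theta>" by auto
  have "lift_rel G \<Delta> \<Delta>1" using 1 G \<Delta> by (auto simp: generates_def)
  moreover from this have "lift_rel H \<Delta>1 \<Theta>"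
    using 1 G H \<Delta> lift_rel_finite_support[of S G \<Delta> \<Delta>1] by (auto simp: generates_def)
  ultimately show "lift_rel (comp_gen G H) \<Delta> \<Theta>"
    using G \<Delta> by (intro lift_rel_comp) (auto simp: generates_def finitary_def finite_on_def)
qed

lemma generates_tau_star: "generates (\<lambda>s. {\<Theta>. sched s \<Theta>}) tau_star"
  using finitary_sched sched_tau_star tau_star_imp_lift_sched by (auto simp: generates_def)

lemma generates_lift_F: "generates (F a) (lift_rel (F a))"
  using F_finitary lift_rel_return by (auto simp: generates_def)

lemma weak_generated: "\<exists>G. generates G (weak a)"
proof -
  have "generates (\<lambda>s. {\<Theta>. sched s \<Theta>}) (weak tau)"
    using generates_tau_star by (simp add: weak_def)
  moreover have "\<exists>G. generates G (tau_star OO lift_rel (F a) OO tau_star)"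
    by (rule exI, rule generates_OO[OF generates_tau_star generates_OO[OF generates_lift_F
      generates_tau_star mixture_closed_tau_star]])
      (intro mixture_closed_OO mixture_closed_lift_rel mixture_closed_tau_star)
  ultimately show ?thesis by (cases "a = tau") (auto simp: weak_def)
qed

lemma weak_finite_support: "finite_on S \<Delta> \<Longrightarrow> weak a \<Delta> \<Theta> \<Longrightarrow> finite_on S \<Theta>"
  using weak_generated[of a] lift_rel_finite_support unfolding generates_def by metis

lemma weak_step:
  assumes "e \<in> F a s"
  shows "weak a (return_pmf s) e"
  using lift_rel_return[where F = "F a", OF assms] by (auto simp: weak_def tau_star_def)

lemma weak_total: "s \<in> S \<Longrightarrow> \<exists>\<Theta>. weak a (return_pmf s) \<Theta>"
  using F_nonempty weak_step by blast

section \<open>Simulation functions and their lifting to distributions\<close>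

text \<open>Closure under infima dictates the form: no triangle inequality, and an answer for each
  threshold strictly above \<open>d x y\<close> in place of an exact one. The sink only idles, so it
  is placed below everything; the value 1 in the converse direction charges lost mass as much as
  possible.\<close>

definition sim :: "('s \<Rightarrow> 's \<Rightarrow> real) \<Rightarrow> bool" where
  "sim d \<longleftrightarrow> (\<forall>x\<in>S. \<forall>y\<in>S. 0 \<le> d x y \<and> d x y \<le> 1) \<and> (\<forall>y\<in>S. d bot y = 0) \<and>
     (\<forall>x\<in>S - {bot}. d x bot = 1) \<and>
     (\<forall>x\<in>S. \<forall>y\<in>S. \<forall>a\<in>Obs. \<forall>e\<in>F a x. \<forall>c. d x y < c \<longrightarrow> c < 1 \<longrightarrow>
        (\<exists>\<Theta>. weak a (return_pmf y) \<Theta> \<and> coupling_le d e \<Theta> c))"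

lemma sim_bounds: "sim d \<Longrightarrow> x \<in> S \<Longrightarrow> y \<in> S \<Longrightarrow> 0 \<le> d x y \<and> d x y \<le> 1"
  by (simp add: sim_def)

lemma sim_transfer:
  assumes d: "sim d" and "x \<in> S" "y \<in> S" "a \<in> Obs" "e \<in> F a x" "d x y < c"
  shows "\<exists>\<Theta>. weak a (return_pmf y) \<Theta> \<and> coupling_le d e \<Theta> c"
proof -
  have e: "finite (set_pmf e)" "set_pmf e \<subseteq> S"
    using F_finitary[of a] assms by (auto simp: finitary_def)
  show ?thesis
  proof (cases "c \<le> 1")
    case False
    obtain \<Theta> where \<Theta>: "weak a (return_pmf y) \<Theta>" using weak_total[OF \<open>y \<in> S\<close>] by blast
    moreover have "finite (set_pmf \<Theta>)" "set_pmf \<Theta> \<subseteq> S"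
      using weak_finite_support[OF _ \<Theta>] \<open>y \<in> S\<close> by (auto simp: finite_on_def)
    then have "coupling_le d e \<Theta> c"
      using e False sim_bounds[OF d] by (intro coupling_le_product) (auto simp: subset_eq, fastforce)
    ultimately show ?thesis by blast
  next
    case True
    \<comment> \<open>At \<open>c = 1\<close> the definition of \<open>sim\<close> is silent; the
      midpoint lies strictly between \<open>d x y\<close> and \<open>c\<close>, hence below
      1.\<close>
    define c' where "c' = (d x y + c) / 2"
    have "d x y < c'" "c' < c" using assms(6) by (auto simp: c'_def)
    then obtain \<Theta> where \<Theta>: "weak a (return_pmf y) \<Theta>" "coupling_le d e \<Theta> c'"
      using assms(1-5) True unfolding sim_def by (meson less_le_trans)
    moreover have "finite (set_pmf \<Theta>)"
      using weak_finite_support[OF _ \<Theta>(1)] \<open>y \<in> S\<close> by (auto simp: finite_on_def)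
    ultimately show ?thesis
      using e \<open>c' < c\<close> coupling_le_mono[OF \<Theta>(2), of c d] by auto
  qed
qed

text \<open>Every coupled pair, together with a derivative chosen for its left state, is answered
  separately; mixture closure combines the answers into one weak move of
  \<open>\<Theta>\<close>.\<close>

lemma sim_lift_step:
  assumes d: "sim d" and a: "a \<in> Obs" and \<Delta>: "finite_on S \<Delta>" and \<Theta>: "finite_on S \<Theta>"
    and "lift_rel (F a) \<Delta> \<Delta>'" "coupling_le d \<Delta> \<Theta> b" "b < b'"
  shows "\<exists>\<Theta>'. weak a \<Theta> \<Theta>' \<and> coupling_le d \<Delta>' \<Theta>' b'"
proof -
  obtain \<rho> where \<rho>: "map_pmf fst \<rho> = \<Delta>" "bind_pmf \<rho> snd = \<Delta>'" "\<forall>(s, e)\<in>set_pmf \<rho>. e \<in> F a s"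
    using assms(5) by (auto simp: lift_rel_def)
  obtain \<omega> where \<omega>: "map_pmf fst \<omega> = \<Delta>" "map_pmf snd \<omega> = \<Theta>"
      "measure_pmf.expectation \<omega> (\<lambda>(x, y). d x y) \<le> b"
    using assms(6) by (auto simp: coupling_le_def)
  \<comment> \<open>Gluing happens at the middle coordinate, which here is the moving state
    \<open>x\<close>; hence the swap.\<close>
  have "map_pmf snd (map_pmf prod.swap \<omega>) = map_pmf fst \<rho>"
    using \<rho> \<omega> by (simp add: map_pmf_comp)
  then obtain \<iota> where "map_pmf (\<lambda>(y, x, e). (y, x)) \<iota> = map_pmf prod.swap \<omega>"
    and \<iota>2: "map_pmf (\<lambda>(y, x, e). (x, e)) \<iota> = \<rho>"
    by (rule glue_pmf)
  from arg_cong[OF this(1), of "map_pmf prod.swap"] have \<iota>1: "map_pmf (\<lambda>(y, x, e). (x, y)) \<iota> = \<omega>"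
    by (simp add: map_pmf_comp split_def prod.swap_def)
  have mem: "y \<in> set_pmf \<Theta> \<and> x \<in> set_pmf \<Delta> \<and> e \<in> F a x \<and> x \<in> S \<and> y \<in> S \<and> finite (set_pmf e)"
    if "(y, x, e) \<in> set_pmf \<iota>" for y x e
  proof -
    have "(x, y) \<in> set_pmf \<omega>" "(x, e) \<in> set_pmf \<rho>"
      unfolding \<iota>1[symmetric] \<iota>2[symmetric] using that by force+
    then have "y \<in> set_pmf \<Theta>" "x \<in> set_pmf \<Delta>" "e \<in> F a x"
      using \<omega> \<rho>(3) set_pmf_marginals[of x y \<omega>] by auto
    then show ?thesis
      using \<Delta> \<Theta> F_finitary[of a] unfolding finite_on_def finitary_def by blast
  qed
  have fin: "finite (set_pmf \<iota>)"
  proof (rule finite_subset)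
    show "set_pmf \<iota> \<subseteq> set_pmf \<Theta> \<times> (SIGMA x:set_pmf \<Delta>. F a x)"
      using mem by fastforce
    show "finite (set_pmf \<Theta> \<times> (SIGMA x:set_pmf \<Delta>. F a x))"
      using \<Delta> \<Theta> F_finitary[of a] unfolding finite_on_def finitary_def by (intro finite_cartesian_product finite_SigmaI) auto
  qed
  \<comment> \<open>Each answer gets the full slack \<open>b' - b\<close>: it is averaged and not
    added over the pairs, so the total stays at most \<open>b + (b' - b)\<close>.\<close>
  have "\<forall>i\<in>set_pmf \<iota>. \<exists>\<Xi>. case i of (y, x, e) \<Rightarrow> weak a (return_pmf y) \<Xi> \<and> coupling_le d e \<Xi> (d x y + (b' - b))"
    using sim_transfer[OF d] mem a \<open>b < b'\<close> by fastforce
  then obtain \<Xi> where \<Xi>: "\<And>y x e. (y, x, e) \<in> set_pmf \<iota> \<Longrightarrow>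
      weak a (return_pmf y) (\<Xi> (y, x, e)) \<and> coupling_le d e (\<Xi> (y, x, e)) (d x y + (b' - b))"
    unfolding bchoice_iff by fast
  define \<Theta>' where "\<Theta>' = bind_pmf \<iota> \<Xi>"
  have "weak a (bind_pmf \<iota> (\<lambda>(y, x, e). return_pmf y)) \<Theta>'"
    unfolding \<Theta>'_def using \<Xi> by (intro mixture_closedD[OF mixture_closed_weak fin]) auto
  also have "bind_pmf \<iota> (\<lambda>(y, x, e). return_pmf y) = \<Theta>"
    unfolding \<omega>(2)[symmetric] \<iota>1[symmetric] by (simp add: map_pmf_def bind_assoc_pmf bind_return_pmf split_def)
  finally have "weak a \<Theta> \<Theta>'" .
  moreover have "coupling_le d (bind_pmf \<iota> (\<lambda>(y, x, e). e)) \<Theta>' (measure_pmf.expectation \<iota> (\<lambda>(y, x, e). d x y + (b' - b)))"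
    unfolding \<Theta>'_def
  proof (rule coupling_le_bind[OF fin])
    fix i assume "i \<in> set_pmf \<iota>"
    moreover obtain y x e where i: "i = (y, x, e)" by (cases i)
    ultimately have m: "(y, x, e) \<in> set_pmf \<iota>" by simp
    show "coupling_le d (case i of (y, x, e) \<Rightarrow> e) (\<Xi> i) (case i of (y, x, e) \<Rightarrow> d x y + (b' - b))"
      using \<Xi>[OF m] by (simp add: i)
    have "finite_on S (\<Xi> i)"
      using \<Xi>[OF m] mem[OF m] weak_finite_support[of "return_pmf y" a "\<Xi> i"] by (simp add: i)
    then show "finite (set_pmf (case i of (y, x, e) \<Rightarrow> e)) \<and> finite (set_pmf (\<Xi> i))"
      using mem[OF m] by (simp add: i finite_on_def)
  qed
  moreover have "bind_pmf \<iota> (\<lambda>(y, x, e). e) = \<Delta>'"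
    unfolding \<rho>(2)[symmetric] \<iota>2[symmetric] by (simp add: bind_map_pmf split_def)
  moreover have "measure_pmf.expectation \<iota> (\<lambda>(y, x, e). d x y + (b' - b)) \<le> b'"
  proof -
    have "measure_pmf.expectation \<iota> (\<lambda>(y, x, e). d x y + (b' - b))
        = measure_pmf.expectation \<iota> (\<lambda>u. (case u of (y, x, e) \<Rightarrow> d x y) + (b' - b))"
      by (simp add: split_def)
    also have "\<dots> = measure_pmf.expectation \<iota> (\<lambda>(y, x, e). d x y) + (b' - b)"
      by (subst Bochner_Integration.integral_add) (auto intro!: integrable_measure_pmf_finite fin)
    also have "measure_pmf.expectation \<iota> (\<lambda>(y, x, e). d x y) = measure_pmf.expectation \<omega> (\<lambda>(x, y). d x y)"
      unfolding \<iota>1[symmetric] integral_map_pmf by (simp add: split_def)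
    finally show ?thesis using \<omega> by simp
  qed
  moreover have "finite_on S \<Theta>'" "finite_on S \<Delta>'"
    using weak_finite_support[OF \<Theta> \<open>weak a \<Theta> \<Theta>'\<close>] lift_rel_finite_support[OF F_finitary \<Delta> assms(5)] .
  ultimately show ?thesis
    using coupling_le_mono[of d \<Delta>' \<Theta>' _ b' d] unfolding finite_on_def by auto
qed

lemma sim_lift_tau_star:
  assumes d: "sim d"
  shows "\<lbrakk>tau_star \<Delta> \<Delta>'; finite_on S \<Delta>; finite_on S \<Theta>; coupling_le d \<Delta> \<Theta> b; b < b'\<rbrakk>
    \<Longrightarrow> \<exists>\<Theta>'. tau_star \<Theta> \<Theta>' \<and> coupling_le d \<Delta>' \<Theta>' b'"
  unfolding tau_star_def
proof (induction arbitrary: b' rule: rtranclp_induct)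
  case base
  have "coupling_le d \<Delta> \<Theta> b'"
    using base.prems coupling_le_mono[OF base.prems(3), of b' d] by (auto simp: finite_on_def)
  then show ?case by blast
next
  case (step \<Delta>1 \<Delta>2)
  \<comment> \<open>The threshold is generalised, so all steps before the last use half of the slack
    and the last one the other half.\<close>
  obtain \<Theta>1 where 1: "(lift_rel (F tau))\<^sup>*\<^sup>* \<Theta> \<Theta>1" "coupling_le d \<Delta>1 \<Theta>1 ((b + b') / 2)"
    using step.IH[of "(b + b') / 2"] step.prems by auto
  have "finite_on S \<Delta>1" "finite_on S \<Theta>1"
    using step.hyps(1) step.prems 1(1) weak_finite_support[of _ tau]
    by (auto simp: weak_def tau_star_def)
  from sim_lift_step[OF d tau_Obs this step.hyps(2) 1(2), of b'] obtain \<Theta>2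
    where "weak tau \<Theta>1 \<Theta>2" "coupling_le d \<Delta>2 \<Theta>2 b'" using step.prems by auto
  then show ?case using rtranclp_trans[OF 1(1)] by (auto simp: weak_def tau_star_def)
qed

lemma sim_lift_weak:
  assumes d: "sim d" and a: "a \<in> Obs" and "weak a \<Delta> \<Delta>'" and fin: "finite_on S \<Delta>" "finite_on S \<Theta>"
    and "coupling_le d \<Delta> \<Theta> b" "b < b'"
  shows "\<exists>\<Theta>'. weak a \<Theta> \<Theta>' \<and> coupling_le d \<Delta>' \<Theta>' b'"
proof (cases "a = tau")
  case True
  then show ?thesis using assms sim_lift_tau_star by (auto simp: weak_def)
next
  case False
  have \<tau>: "finite_on S \<Xi>'" if "tau_star \<Xi> \<Xi>'" "finite_on S \<Xi>" for \<Xi> \<Xi>'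
    using weak_finite_support[of \<Xi> tau] that by (simp add: weak_def)
  \<comment> \<open>One third of the slack for each phase of a weak move: internal,
    \<open>a\<close>, internal.\<close>
  define \<eta> where "\<eta> = (b' - b) / 3"
  have \<eta>: "b < b + \<eta>" "b + \<eta> < b + 2 * \<eta>" "b + 2 * \<eta> < b'"
    using \<open>b < b'\<close> by (auto simp: \<eta>_def field_simps)
  obtain \<Delta>1 \<Delta>2 where \<Delta>: "tau_star \<Delta> \<Delta>1" "lift_rel (F a) \<Delta>1 \<Delta>2" "tau_star \<Delta>2 \<Delta>'"
    using assms(3) False by (auto simp: weak_def)
  obtain \<Theta>1 where 1: "tau_star \<Theta> \<Theta>1" "coupling_le d \<Delta>1 \<Theta>1 (b + \<eta>)"
    using sim_lift_tau_star[OF d \<Delta>(1) fin assms(6) \<eta>(1)] by blast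
  have fin1: "finite_on S \<Delta>1" "finite_on S \<Theta>1" using \<tau> fin \<Delta> 1 by auto
  obtain \<Theta>2 where 2: "weak a \<Theta>1 \<Theta>2" "coupling_le d \<Delta>2 \<Theta>2 (b + 2 * \<eta>)"
    using sim_lift_step[OF d a fin1 \<Delta>(2) 1(2) \<eta>(2)] by blast
  have fin2: "finite_on S \<Delta>2" "finite_on S \<Theta>2"
    using lift_rel_finite_support[OF F_finitary fin1(1) \<Delta>(2)] weak_finite_support[OF fin1(2) 2(1)] .
  obtain \<Theta>3 where 3: "tau_star \<Theta>2 \<Theta>3" "coupling_le d \<Delta>' \<Theta>3 b'"
    using sim_lift_tau_star[OF d \<Delta>(3) fin2 2(2) \<eta>(3)] by blast
  \<comment> \<open>The middle answer is itself a weak \<open>a\<close>-move; its internal prefix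
    and suffix merge with the surrounding internal phases.\<close>
  have "weak a \<Theta> \<Theta>3"
    using 2(1) False tau_star_trans[OF 1(1)] tau_star_trans[OF _ 3(1)] unfolding weak_def
    by (simp add: OO_def) blast
  then show ?thesis using 3 by blast
qed

section \<open>Self-composition of a simulation function\<close>

definition comp_dist :: "('s \<Rightarrow> 's \<Rightarrow> real) \<Rightarrow> 's \<Rightarrow> 's \<Rightarrow> real" where
  "comp_dist d x y = (INF z\<in>S. min 1 (d x z + d z y))"

lemma comp_dist_props:
  assumes "sim d" "x \<in> S" "y \<in> S"
  shows "0 \<le> comp_dist d x y" "comp_dist d x y \<le> 1"
    and "z \<in> S \<Longrightarrow> comp_dist d x y \<le> d x z + d z y"
proof -
  have nn: "0 \<le> min 1 (d x z + d z y)" if "z \<in> S" for z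
    using sim_bounds[OF assms(1)] assms that by (simp add: add_nonneg_nonneg)
  then have bdd: "bdd_below ((\<lambda>z. min 1 (d x z + d z y)) ` S)"
    by (intro bdd_belowI2[of _ 0])
  show "0 \<le> comp_dist d x y"
    unfolding comp_dist_def using bot_in nn by (intro cINF_greatest) auto
  have le: "comp_dist d x y \<le> min 1 (d x z + d z y)" if "z \<in> S" for z
    unfolding comp_dist_def by (rule cINF_lower[OF bdd that])
  show "comp_dist d x y \<le> 1" using le[OF bot_in] by simp
  show "z \<in> S \<Longrightarrow> comp_dist d x y \<le> d x z + d z y" using le by fastforce
qed

text \<open>A move of \<open>x\<close> is answered by a suitable \<open>z\<close>, and that weak
  answer is answered by \<open>y\<close>. Gluing the couplings adds the costs, because the composed
  function satisfies the required inequality through \<open>z\<close> by construction.\<close>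

lemma sim_comp_dist:
  assumes d: "sim d"
  shows "sim (comp_dist d)"
  unfolding sim_def
proof (intro conjI ballI allI impI)
  fix x y assume xy: "x \<in> S" "y \<in> S"
  show "0 \<le> comp_dist d x y" "comp_dist d x y \<le> 1" using comp_dist_props[OF d xy] by auto
next
  fix y assume "y \<in> S"
  then show "comp_dist d bot y = 0"
    using comp_dist_props(1)[OF d bot_in \<open>y \<in> S\<close>] comp_dist_props(3)[OF d bot_in \<open>y \<in> S\<close> bot_in]
      bot_in d by (simp add: sim_def)
next
  fix x assume x: "x \<in> S - {bot}"
  \<comment> \<open>A detour through the sink pays 1 in the first summand, any other detour pays 1
    in the second.\<close>
  have "min 1 (d x z + d z bot) = 1" if "z \<in> S" for z
    using d x that sim_bounds[OF d, of x z] by (cases "z = bot") (auto simp: sim_def)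
  then have "comp_dist d x bot = (INF z\<in>S. 1)"
    unfolding comp_dist_def by (intro INF_cong) auto
  moreover have "S \<noteq> {}" using bot_in by blast
  ultimately show "comp_dist d x bot = 1" by (simp add: image_constant_conv)
next
  fix x y a e c
  assume xy: "x \<in> S" "y \<in> S" and a: "a \<in> Obs" and e: "e \<in> F a x" and c: "comp_dist d x y < c" "c < 1"
  have bdd: "bdd_below ((\<lambda>z. min 1 (d x z + d z y)) ` S)"
    using sim_bounds[OF d] xy by (intro bdd_belowI2[of _ 0]) (simp add: add_nonneg_nonneg)
  obtain z where z: "z \<in> S" "min 1 (d x z + d z y) < c"
    using c(1) cINF_less_iff[OF _ bdd] bot_in unfolding comp_dist_def by blast
  \<comment> \<open>The gap is halved, one half for each answer; \<open>c < 1\<close> ensures that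
    the truncation is inactive at \<open>z\<close>.\<close>
  define \<eta> where "\<eta> = (c - (d x z + d z y)) / 2"
  have \<eta>: "0 < \<eta>" "(d x z + \<eta>) + (d z y + \<eta>) = c" using z c(2) by (auto simp: \<eta>_def)
  obtain \<Theta>1 where 1: "weak a (return_pmf z) \<Theta>1" "coupling_le d e \<Theta>1 (d x z + \<eta>)"
    using sim_transfer[OF d xy(1) z(1) a e, of "d x z + \<eta>"] \<eta> by auto
  have "coupling_le d (return_pmf z) (return_pmf y) (d z y)" by (rule coupling_le_product) auto
  then obtain \<Theta>2 where 2: "weak a (return_pmf y) \<Theta>2" "coupling_le d \<Theta>1 \<Theta>2 (d z y + \<eta>)"
    using sim_lift_weak[OF d a 1(1), of "return_pmf y" "d z y" "d z y + \<eta>"] z xy \<eta> by auto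
  have "finite_on S e" "finite_on S \<Theta>1" "finite_on S \<Theta>2"
    using F_finitary[of a] xy e weak_finite_support[OF _ 1(1)] weak_finite_support[OF _ 2(1)] z
    by (auto simp: finite_on_def finitary_def)
  then have "coupling_le (comp_dist d) e \<Theta>2 ((d x z + \<eta>) + (d z y + \<eta>))"
    unfolding finite_on_def
    by (intro coupling_le_trans[OF 1(2) 2(2)]) (auto intro!: comp_dist_props(3)[OF d])
  then show "\<exists>\<Theta>. weak a (return_pmf y) \<Theta> \<and> coupling_le (comp_dist d) e \<Theta> c"
    using 2 \<eta> by auto
qed

section \<open>The least simulation function\<close>

definition min_sim :: "'s \<Rightarrow> 's \<Rightarrow> real" where
  "min_sim x y = (INF d\<in>Collect sim. d x y)"

text \<open>Makes the family under the infimum non-empty; being 0 on the diagonal, it also gives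
  reflexivity of the minimum.\<close>

lemma sim_discrete: "sim (\<lambda>x y. if x = bot \<or> x = y then 0 else 1)" (is "sim ?d")
  unfolding sim_def
proof (intro conjI ballI allI impI)
  fix x y a e c
  assume xy: "x \<in> S" "y \<in> S" "a \<in> Obs" "e \<in> F a x" "?d x y < c" "c < 1"
  then have c: "0 < c" "x = y \<or> x = bot" by (auto split: if_splits)
  have e: "finite_on S e"
    using F_finitary[of a] xy by (auto simp: finite_on_def finitary_def)
  show "\<exists>\<Theta>. weak a (return_pmf y) \<Theta> \<and> coupling_le ?d e \<Theta> c"
  proof (cases "x = y")
    case True
    have "coupling_le ?d e e 0" by (rule coupling_le_diag) simp
    then have "coupling_le ?d e e c" using c e by (auto simp: finite_on_def elim!: coupling_le_mono)
    then show ?thesis using weak_step xy True by blast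
  next
    case False
    obtain \<Theta> where \<Theta>: "weak a (return_pmf y) \<Theta>" using weak_total[OF \<open>y \<in> S\<close>] by blast
    have "finite_on S \<Theta>" using weak_finite_support[OF _ \<Theta>] xy by simp
    moreover have "e = return_pmf bot" using False c xy F_bot by auto
    ultimately have "coupling_le ?d e \<Theta> c"
      using e c(1) by (intro coupling_le_product) (auto simp: finite_on_def)
    then show ?thesis using \<Theta> by blast
  qed
qed auto

lemma min_sim_le:
  assumes "sim d" "x \<in> S" "y \<in> S"
  shows "min_sim x y \<le> d x y"
  unfolding min_sim_def using assms by (intro cINF_lower bdd_belowI2[of _ 0]) (auto simp: sim_def)

lemma min_sim_nonneg:
  assumes "x \<in> S" "y \<in> S"
  shows "0 \<le> min_sim x y"
  unfolding min_sim_def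
proof (rule cINF_greatest)
  show "Collect sim \<noteq> {}" using sim_discrete by blast
qed (use assms in \<open>simp add: sim_def\<close>)

text \<open>A threshold above the infimum is above the value of one member \<open>d\<close>, whose
  answer can be used; its coupling only gets cheaper when measured by the smaller
  \<open>min_sim\<close>.\<close>

lemma sim_min_sim: "sim min_sim"
  unfolding sim_def
proof (intro conjI ballI allI impI)
  fix x y assume xy: "x \<in> S" "y \<in> S"
  show "0 \<le> min_sim x y" by (rule min_sim_nonneg[OF xy])
  show "min_sim x y \<le> 1" using min_sim_le[OF sim_discrete xy] by (auto split: if_splits)
next
  fix y assume "y \<in> S"
  then show "min_sim bot y = 0"
    using min_sim_le[OF sim_discrete bot_in] min_sim_nonneg[OF bot_in] by force
next
  fix x assume "x \<in> S - {bot}"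
  then have "d x bot = 1" if "sim d" for d using that by (simp add: sim_def)
  then have "min_sim x bot = (INF d\<in>Collect sim. 1)"
    unfolding min_sim_def by (intro INF_cong) auto
  moreover have "Collect sim \<noteq> {}" using sim_discrete by blast
  ultimately show "min_sim x bot = 1" by (auto simp: image_constant_conv)
next
  fix x y a e c
  assume *: "x \<in> S" "y \<in> S" "a \<in> Obs" "e \<in> F a x" "min_sim x y < c" "c < 1"
  have "bdd_below ((\<lambda>d. d x y) ` Collect sim)"
    using * by (intro bdd_belowI2[of _ 0]) (auto simp: sim_def)
  then obtain d where d: "sim d" "d x y < c"
    using \<open>min_sim x y < c\<close> cINF_less_iff[of "Collect sim" "\<lambda>d. d x y" c] sim_discrete
    unfolding min_sim_def by blast
  obtain \<Theta> where \<Theta>: "weak a (return_pmf y) \<Theta>" "coupling_le d e \<Theta> c"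
    using sim_transfer[OF d(1) *(1-4) d(2)] by blast
  have "finite_on S e" "finite_on S \<Theta>"
    using F_finitary[of a] * weak_finite_support[OF _ \<Theta>(1)] by (auto simp: finite_on_def finitary_def)
  then have "coupling_le min_sim e \<Theta> c"
    using min_sim_le[OF d(1)] by (intro coupling_le_mono[OF \<Theta>(2)]) (auto simp: finite_on_def)
  then show "\<exists>\<Theta>. weak a (return_pmf y) \<Theta> \<and> coupling_le min_sim e \<Theta> c" using \<Theta> by blast
qed

lemma min_sim_refl: "x \<in> S \<Longrightarrow> min_sim x x = 0"
  using min_sim_le[OF sim_discrete, of x x] min_sim_nonneg[of x x] by simp

lemma min_sim_triangle:
  assumes "x \<in> S" "y \<in> S" "z \<in> S"
  shows "min_sim x y \<le> min_sim x z + min_sim z y"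
  using min_sim_le[OF sim_comp_dist[OF sim_min_sim] assms(1,2)]
    comp_dist_props(3)[OF sim_min_sim assms] by linarith

lemma min_sim_transfer:
  assumes "x \<in> S" "y \<in> S" "a \<in> Obs" "e \<in> F a x"
  shows "\<exists>\<Theta>. weak a (return_pmf y) \<Theta> \<and> coupling_le min_sim e \<Theta> (min_sim x y)"
proof -
  obtain G where G: "generates G (weak a)" using weak_generated by blast
  have e: "finite (set_pmf e)" using F_finitary[of a] assms by (auto simp: finitary_def)
  have Gy: "finite (G y)" "\<And>g. g \<in> G y \<Longrightarrow> finite (set_pmf g)"
    using G assms by (auto simp: generates_def finitary_def)
  have "\<exists>\<mu>. set_pmf \<mu> \<subseteq> G y \<and> coupling_le min_sim e (join_pmf \<mu>) c" if c: "min_sim x y < c" for c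
  proof -
    obtain \<Theta> where \<Theta>: "weak a (return_pmf y) \<Theta>" "coupling_le min_sim e \<Theta> c"
      using sim_transfer[OF sim_min_sim assms c] by blast
    then have "lift_rel G (return_pmf y) \<Theta>" using G assms by (auto simp: generates_def)
    then show ?thesis using \<Theta>(2) by (elim lift_rel_return_joinE) blast
  qed
  from coupling_le_mixture_attained[OF Gy e this]
  obtain \<mu> where \<mu>: "set_pmf \<mu> \<subseteq> G y" "coupling_le min_sim e (join_pmf \<mu>) (min_sim x y)" by blast
  have "weak a (bind_pmf \<mu> (\<lambda>_. return_pmf y)) (bind_pmf \<mu> (\<lambda>g. g))"
    using G \<mu> Gy assms
    by (intro mixture_closedD[OF mixture_closed_weak]) (auto simp: generates_def intro: finite_subset)
  then show ?thesis using \<mu> by (auto simp: join_pmf_def)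
qed

end

section \<open>Transitions of networks\<close>

text \<open>The source of the rank. Sigma-prefixes and timeout branches contribute nothing, and they
  are the only places where a guarded variable may occur free, so unfolding a recursion leaves the
  number unchanged. Summing over the branches of a choice bounds each of them.\<close>

fun unguarded_size :: "'v proc \<Rightarrow> nat" where
  "unguarded_size PNil = 0"
| "unguarded_size (PSnd u C) = Suc (\<Sum>(p, Q)\<leftarrow>C. unguarded_size Q)"
| "unguarded_size (PRcv x C D) = Suc (\<Sum>(p, Q)\<leftarrow>C. unguarded_size Q)"
| "unguarded_size (PTau C) = Suc (\<Sum>(p, Q)\<leftarrow>C. unguarded_size Q)"
| "unguarded_size (PSigma C) = 0"
| "unguarded_size (PVar Y) = 0"
| "unguarded_size (PFix Y P) = unguarded_size P"

lemma unguarded_size_vsubst [simp]: "unguarded_size (vsubst x v P) = unguarded_size P"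
  by (induction x v P rule: vsubst.induct)
     (auto simp: o_def split_def intro!: arg_cong[where f=sum_list] map_cong)

lemma unguarded_size_psubst: "tguarded X P \<Longrightarrow> unguarded_size (psubst X Q P) = unguarded_size P"
  by (induction X Q P rule: psubst.induct)
     (fastforce simp: o_def split_def intro!: arg_cong[where f=sum_list] map_cong)+

lemma tguarded_vsubst [simp]: "tguarded X (vsubst x v P) = tguarded X P"
  by (induction x v P rule: vsubst.induct) (auto; fastforce)+

lemma wf_choice_map [simp]: "wf_choice (map (\<lambda>(p, Q). (p, f Q)) C) = wf_choice C"
  by (auto simp: wf_choice_def o_def split_def)

lemma wf_proc_vsubst: "wf_proc P \<Longrightarrow> wf_proc (vsubst x v P)"
  by (induction x v P rule: vsubst.induct) (auto; fastforce)+

lemma fv_vsubst: "fv (vsubst x v P) \<subseteq> fv P - {x}"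
  by (induction x v P rule: vsubst.induct) (auto split: msg.splits if_splits; fastforce)+

lemma fpv_vsubst: "fpv (vsubst x v P) = fpv P"
  by (induction x v P rule: vsubst.induct) (auto; fastforce)+

lemma tguarded_if_not_free: "X \<notin> fpv P \<Longrightarrow> tguarded X P"
  by (induction X P rule: tguarded.induct) auto

lemma tguarded_psubst: "tguarded Y P \<Longrightarrow> fpv Q = {} \<Longrightarrow> tguarded Y (psubst X Q P)"
  by (induction X Q P rule: psubst.induct) (auto simp: tguarded_if_not_free; fastforce)+

lemma wf_proc_psubst: "wf_proc P \<Longrightarrow> wf_proc Q \<Longrightarrow> fpv Q = {} \<Longrightarrow> wf_proc (psubst X Q P)"
  by (induction X Q P rule: psubst.induct) (auto simp: tguarded_psubst; fastforce)+

lemma fv_psubst: "fv (psubst X Q P) \<subseteq> fv P \<union> fv Q"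
  by (induction X Q P rule: psubst.induct) (auto; fastforce)+

lemma fpv_psubst: "fpv Q = {} \<Longrightarrow> fpv (psubst X Q P) \<subseteq> fpv P - {X}"
  by (induction X Q P rule: psubst.induct) (auto; fastforce)+

definition good_proc :: "'v proc \<Rightarrow> bool" where
  "good_proc P \<longleftrightarrow> closed_proc P \<and> wf_proc P"

lemma good_proc_unfold: "good_proc (PFix X P) \<Longrightarrow> good_proc (psubst X (PFix X P) P)"
  using fv_psubst[of X "PFix X P" P] fpv_psubst[of "PFix X P" X P] wf_proc_psubst[of P "PFix X P" X]
  by (auto simp: good_proc_def closed_proc_def)

lemma good_proc_rcv:
  assumes "good_proc (PRcv x C D)" "(p, Q) \<in> set C"
  shows "good_proc (vsubst x v Q)"
  using assms fv_vsubst[of x v Q] fpv_vsubst[of x v Q] wf_proc_vsubst[of Q x v]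
  by (fastforce simp: good_proc_def closed_proc_def)

fun good_net :: "'v net \<Rightarrow> bool" where
  "good_net (Par M N) = (good_net M \<and> good_net N)"
| "good_net (Node n P \<nu>) = good_proc P"
| "good_net _ = True"

fun live :: "'v net \<Rightarrow> bool" where
  "live (Par M N) = (live M \<and> live N)"
| "live Bot = False"
| "live _ = True"

text \<open>Transitions rewrite only the processes inside nodes. Names, neighbourhoods and the
  presence of \<open>Bot\<close> can be read off this erased term, so well-formedness and liveness
  survive a transition as soon as the new processes are good.\<close>

fun skel :: "'v net \<Rightarrow> 'v net" where
  "skel (Par M N) = Par (skel M) (skel N)"
| "skel (Node n P \<nu>) = Node n PNil \<nu>"
| "skel M = M"

fun net_unguarded_size :: "'v net \<Rightarrow> nat" where
  "net_unguarded_size (Par M N) = net_unguarded_size M + net_unguarded_size N"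
| "net_unguarded_size (Node n P \<nu>) = unguarded_size P"
| "net_unguarded_size _ = 0"

lemma live_skel [simp]: "live (skel M) = live M"
  by (induction M) auto

lemma nds_skel [simp]: "nds (skel M) = nds M"
  by (induction M) auto

lemma distinct_names_skel [simp]: "distinct_names (skel M) = distinct_names M"
  by (induction M) auto

lemma nodes_skel: "nodes (skel M) = (\<lambda>(n, P, \<nu>). (n, PNil, \<nu>)) ` nodes M"
  by (induction M) (auto simp: image_Un)

lemma nbr_skel [simp]: "nbr (skel M) = nbr M"
  by (intro ext) (force simp: nbr_def nodes_skel)

lemma good_iff: "good_net M \<longleftrightarrow> (\<forall>(n, P, \<nu>)\<in>nodes M. good_proc P)"
  by (induction M) (simp_all add: ball_Un)

lemma wf_net_iff: "wf_net M \<longleftrightarrow> good_net M \<and> wf_net (skel M)"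
  unfolding wf_net_def good_iff
  by (fastforce simp: nodes_skel good_proc_def closed_proc_def)

lemma finite_nds: "finite (nds M)"
  by (induction M) auto

section \<open>Transitions as finitely supported distributions\<close>

lemma dirac_eq_pmf: "dirac M = pmf (return_pmf M)"
  by (auto simp: dirac_def)

lemma par_dist_pmf: "par_dist (pmf p) (pmf q) = pmf (map_pmf (\<lambda>(a, b). Par a b) (pair_pmf p q))"
proof
  fix N :: "'a net"
  have inj: "inj (\<lambda>(a, b). Par a b :: 'a net)" by (auto intro: injI)
  show "par_dist (pmf p) (pmf q) N = pmf (map_pmf (\<lambda>(a, b). Par a b) (pair_pmf p q)) N"
  proof (cases "\<exists>a b. N = Par a b")
    case True
    then obtain a b where "N = Par a b" by blast
    then show ?thesis
      using pmf_map_inj'[OF inj, of "pair_pmf p q" "(a, b)"] by (simp add: par_dist_def pmf_pair)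
  next
    case False
    then have "pmf (map_pmf (\<lambda>(a, b). Par a b) (pair_pmf p q)) N = 0"
      by (intro pmf_map_outside) auto
    then show ?thesis using False by (auto simp: par_dist_def split: net.splits)
  qed
qed

lemma sem_pmf:
  assumes "wf_choice C"
  obtains p where "sem n C \<nu> = pmf p" "finite (set_pmf p)" "set_pmf p \<subseteq> (\<lambda>(r, P). Node n P \<nu>) ` set C"
proof -
  define xs where "xs = map (\<lambda>(r, P). (Node n P \<nu>, r)) C"
  have wf: "pmf_of_list_wf xs"
    using assms by (auto simp: pmf_of_list_wf_def wf_choice_def xs_def o_def split_def fst_def[symmetric] less_imp_le)
  have "sem n C \<nu> N = pmf (pmf_of_list xs) N" for N
  proof -
    have "sem n C \<nu> N = sum_list (map snd (filter (\<lambda>z. fst z = N) xs))"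
      unfolding sem_def xs_def by (induction C) auto
    then show ?thesis using pmf_pmf_of_list[OF wf, of N] by simp
  qed
  moreover have "set_pmf (pmf_of_list xs) \<subseteq> (\<lambda>(r, P). Node n P \<nu>) ` set C"
    using set_pmf_of_list[OF wf] by (auto simp: xs_def)
  ultimately show thesis
    by (intro that[of "pmf_of_list xs"]) (auto intro: finite_subset)
qed

text \<open>Internal moves are the goal; the other labels are there for the induction. A broadcast
  combines a sender that loses a prefix with receivers that may stay unchanged, and passing time may
  release guarded code, so nothing is claimed for it.\<close>

fun decreases :: "'v lab \<Rightarrow> nat \<Rightarrow> nat \<Rightarrow> bool" where
  "decreases LSigma k' k = True"
| "decreases (LRcv m v) k' k = (k' \<le> k)"
| "decreases _ k' k = (k' < k)"

definition deriv_ok :: "'v net \<Rightarrow> 'v lab \<Rightarrow> 'v net pmf \<Rightarrow> bool" where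
  "deriv_ok M l p \<longleftrightarrow> finite (set_pmf p) \<and>
     (\<forall>M'\<in>set_pmf p. good_net M' \<and> skel M' = skel M \<and> decreases l (net_unguarded_size M') (net_unguarded_size M))"

lemma sem_deriv:
  assumes "wf_choice C" "\<And>r Q. (r, Q) \<in> set C \<Longrightarrow> good_proc Q \<and> decreases l (unguarded_size Q) (unguarded_size P)"
  shows "\<exists>p. sem n C \<nu> = pmf p \<and> deriv_ok (Node n P \<nu>) l p"
proof -
  obtain p where p: "sem n C \<nu> = pmf p" "finite (set_pmf p)" "set_pmf p \<subseteq> (\<lambda>(r, P). Node n P \<nu>) ` set C"
    by (rule sem_pmf[OF assms(1)])
  then show ?thesis using assms(2) by (fastforce simp: deriv_ok_def)
qed

lemma member_le_sum_unguarded_size: "(r, Q) \<in> set C \<Longrightarrow> unguarded_size Q \<le> (\<Sum>(p, Q)\<leftarrow>C. unguarded_size Q)"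
  by (rule member_le_sum_list) (force, simp)

lemma par_deriv:
  assumes "deriv_ok M l1 p" "deriv_ok N l2 q"
    and "\<And>a b. decreases l1 a (net_unguarded_size M) \<Longrightarrow> decreases l2 b (net_unguarded_size N) \<Longrightarrow> decreases l (a + b) (net_unguarded_size M + net_unguarded_size N)"
  shows "\<exists>r. par_dist (pmf p) (pmf q) = pmf r \<and> deriv_ok (Par M N) l r"
  using assms by (intro exI[of _ "map_pmf (\<lambda>(a, b). Par a b) (pair_pmf p q)"]) (auto simp: par_dist_pmf deriv_ok_def)

lemma trans_pmf:
  "Defs.trans M l \<Delta> \<Longrightarrow> good_net M \<Longrightarrow> \<exists>p. \<Delta> = pmf p \<and> deriv_ok M l p"
proof (induction rule: trans.induct)
  case (Snd m v C \<nu>)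
  then show ?case
    using member_le_sum_unguarded_size by (intro sem_deriv) (fastforce simp: good_proc_def closed_proc_def less_Suc_eq_le)+
next
  case (Rcv m \<nu> n x C D v)
  then show ?case
    using member_le_sum_unguarded_size[of _ _ C] good_proc_rcv[of x C D]
    by (intro sem_deriv) (auto simp: good_proc_def le_SucI)
next
  case (RcvEnb m \<nu> n P v)
  then show ?case by (intro exI[of _ "return_pmf (Node n P \<nu>)"]) (simp add: dirac_eq_pmf deriv_ok_def)
next
  case (RcvZero m v)
  then show ?case by (intro exI[of _ "return_pmf Zero"]) (simp add: dirac_eq_pmf deriv_ok_def)
next
  case (RcvPar M m v \<Delta> N \<Theta>)
  then show ?case using par_deriv[of M "LRcv m v" _ N "LRcv m v"] by fastforce
next
  case (BcastL M m v \<nu> \<Delta> N \<Theta>)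
  then show ?case using par_deriv[of M "LSnd m v \<nu>" _ N "LRcv m v"] by fastforce
next
  case (BcastR M m v \<nu> \<Delta> N \<Theta>)
  then show ?case using par_deriv[of N "LRcv m v" _ M "LSnd m v \<nu>"] by fastforce
next
  case (Tau m C \<nu>)
  then show ?case
    using member_le_sum_unguarded_size by (intro sem_deriv) (fastforce simp: good_proc_def closed_proc_def less_Suc_eq_le)+
next
  case (TauParL M \<Delta> N)
  \<comment> \<open>The idle component is treated as a receiver: this label, with arbitrary sender
    and value, carries the non-strict inequality.\<close>
  have "deriv_ok N (LRcv 0 undefined) (return_pmf N)" using TauParL by (simp add: deriv_ok_def)
  then show ?case using TauParL par_deriv[of M LTau _ N "LRcv 0 undefined"] by (fastforce simp: dirac_eq_pmf)
next
  case (TauParR M \<Delta> N)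
  have "deriv_ok N (LRcv 0 undefined) (return_pmf N)" using TauParR by (simp add: deriv_ok_def)
  then show ?case using TauParR par_deriv[of N "LRcv 0 undefined" _ M LTau] by (fastforce simp: dirac_eq_pmf)
next
  case SigmaZero
  then show ?case by (intro exI[of _ "return_pmf Zero"]) (simp add: dirac_eq_pmf deriv_ok_def)
next
  case (SigmaNil n \<nu>)
  then show ?case by (intro exI[of _ "return_pmf (Node n PNil \<nu>)"]) (simp add: dirac_eq_pmf deriv_ok_def)
next
  case (Timeout n x C D \<nu>)
  then show ?case by (intro sem_deriv) (fastforce simp: good_proc_def closed_proc_def)+
next
  case (Sleep n C \<nu>)
  then show ?case by (intro sem_deriv) (fastforce simp: good_proc_def closed_proc_def)+
next
  case (SigmaPar M \<Delta> N \<Theta>)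
  then show ?case using par_deriv[of M LSigma _ N LSigma] by fastforce
next
  case (Rec n X P \<nu> l \<Delta>)
  have "good_proc (psubst X (PFix X P) P)" using Rec good_proc_unfold by simp
  moreover have "unguarded_size (psubst X (PFix X P) P) = unguarded_size P"
    using Rec by (intro unguarded_size_psubst) (simp add: good_proc_def)
  ultimately show ?case using Rec by (simp add: deriv_ok_def)
next
  case (ShhSnd M m v \<Delta>)
  then show ?case by (auto simp: deriv_ok_def)
next
  case (ObsSnd M m v \<nu> \<Delta>)
  then show ?case by (auto simp: deriv_ok_def)
qed

section \<open>Finite branching\<close>

text \<open>Bounds how often \<open>Rec\<close> can be applied in succession: unfolding removes one
  leading binder, and by guardedness no copy of the recursion lands at the head.\<close>

fun head_fix :: "'v proc \<Rightarrow> nat" where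
  "head_fix (PFix X P) = Suc (head_fix P)"
| "head_fix _ = 0"

lemma head_fix_psubst: "tguarded X P \<Longrightarrow> head_fix (psubst X Q P) = head_fix P"
  by (induction P) auto

text \<open>Sends are finite over all labels together, because an internal move may hide a send by
  any sender of any value. Receptions are finite only label by label, since \<open>RcvEnb\<close>
  accepts arbitrarily many senders and values.\<close>

definition fin_branching :: "'v net \<Rightarrow> bool" where
  "fin_branching M \<longleftrightarrow> finite {(m, v, \<nu>, \<Delta>). Defs.trans M (LSnd m v \<nu>) \<Delta>} \<and>
     (\<forall>m v. finite {\<Delta>. Defs.trans M (LRcv m v) \<Delta>}) \<and>
     finite {\<Delta>. Defs.trans M LTau \<Delta>} \<and> finite {\<Delta>. Defs.trans M LSigma \<Delta>}"

inductive_cases sndE: "Defs.trans M (LSnd m v \<nu>) \<Delta>"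
inductive_cases rcvE: "Defs.trans M (LRcv m v) \<Delta>"
inductive_cases tauE: "Defs.trans M LTau \<Delta>"
inductive_cases sigmaE: "Defs.trans M LSigma \<Delta>"
inductive_cases parSndE: "Defs.trans (Par M N) (LSnd m v \<nu>) \<Delta>"
inductive_cases parRcvE: "Defs.trans (Par M N) (LRcv m v) \<Delta>"
inductive_cases parTauE: "Defs.trans (Par M N) LTau \<Delta>"
inductive_cases parSigmaE: "Defs.trans (Par M N) LSigma \<Delta>"

lemma fin_branchingI:
  assumes "finite A" "\<And>m v \<nu> \<Delta>. Defs.trans M (LSnd m v \<nu>) \<Delta> \<Longrightarrow> (m, v, \<nu>, \<Delta>) \<in> A"
    and "\<And>m v. finite (B m v)" "\<And>m v \<Delta>. Defs.trans M (LRcv m v) \<Delta> \<Longrightarrow> \<Delta> \<in> B m v"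
    and "finite C" "\<And>\<Delta>. Defs.trans M LTau \<Delta> \<Longrightarrow> \<Delta> \<in> C \<or> (\<exists>m v. Defs.trans M (LSnd m v {}) \<Delta>)"
    and "finite D" "\<And>\<Delta>. Defs.trans M LSigma \<Delta> \<Longrightarrow> \<Delta> \<in> D"
  shows "fin_branching M"
proof -
  have "{(m, v, \<nu>, \<Delta>). Defs.trans M (LSnd m v \<nu>) \<Delta>} \<subseteq> A" using assms(2) by auto
  moreover have "{\<Delta>. Defs.trans M (LRcv m v) \<Delta>} \<subseteq> B m v" for m v using assms(4) by auto
  moreover have "{\<Delta>. Defs.trans M LTau \<Delta>} \<subseteq> C \<union> (\<lambda>(m, v, \<nu>, \<Delta>). \<Delta>) ` A"
    using assms(2,6) by force
  moreover have "{\<Delta>. Defs.trans M LSigma \<Delta>} \<subseteq> D" using assms(8) by auto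
  ultimately show ?thesis
    unfolding fin_branching_def using assms(1,3,5,7) by (meson finite_UnI finite_imageI finite_subset)
qed

lemma fin_branching_node: "good_proc P \<Longrightarrow> fin_branching (Node n P \<nu>)"
proof (induction "head_fix P" arbitrary: P rule: less_induct)
  case less
  let ?I = "{dirac (Node n P \<nu>)}"
  show ?case
  proof (cases P)
    case PNil
    then show ?thesis
      by (intro fin_branchingI[of "{}" _ "\<lambda>_ _. ?I" "{}" "?I"]) (auto elim: sndE rcvE tauE sigmaE)
  next
    case (PSnd u C)
    then show ?thesis
      by (intro fin_branchingI[of "case u of MVal v \<Rightarrow> {(n, v, \<nu>, sem n C \<nu>)} | _ \<Rightarrow> {}" _ "\<lambda>_ _. ?I" "{}" "{}"])
        ((auto elim: sndE split: msg.splits)[2], auto elim: rcvE sigmaE elim!: tauE)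
  next
    case (PRcv x C D)
    then show ?thesis
      by (intro fin_branchingI[of "{}" _ "\<lambda>_ v. insert (sem n (map (\<lambda>(p, Q). (p, vsubst x v Q)) C) \<nu>) ?I" "{}" "{sem n D \<nu>}"])
        (auto elim: sndE rcvE tauE sigmaE)
  next
    case (PTau C)
    then show ?thesis
      by (intro fin_branchingI[of "{}" _ "\<lambda>_ _. ?I" "{sem n C \<nu>}" "{}"]) (auto elim: sndE rcvE tauE sigmaE)
  next
    case (PSigma C)
    then show ?thesis
      by (intro fin_branchingI[of "{}" _ "\<lambda>_ _. ?I" "{}" "{sem n C \<nu>}"]) (auto elim: sndE rcvE tauE sigmaE)
  next
    case (PVar Y)
    then show ?thesis
      by (intro fin_branchingI[of "{}" _ "\<lambda>_ _. ?I" "{}" "{}"]) (auto elim: sndE rcvE tauE sigmaE)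
  next
    case (PFix X Q)
    let ?N = "Node n (psubst X (PFix X Q) Q) \<nu>"
    have "tguarded X Q" using less.prems PFix by (simp add: good_proc_def)
    then have "fin_branching ?N"
      using less.prems PFix good_proc_unfold by (intro less.hyps) (auto simp: head_fix_psubst)
    then show ?thesis
      using PFix unfolding fin_branching_def[of ?N]
      by (intro fin_branchingI[of "{(m, v, \<nu>, \<Delta>). Defs.trans ?N (LSnd m v \<nu>) \<Delta>}" _
            "\<lambda>m v. insert (dirac (Node n P \<nu>)) {\<Delta>. Defs.trans ?N (LRcv m v) \<Delta>}" "{\<Delta>. Defs.trans ?N LTau \<Delta>}"
            "{\<Delta>. Defs.trans ?N LSigma \<Delta>}"]) (auto elim: sndE rcvE tauE sigmaE)
  qed
qed

lemma fin_branching_par: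
  assumes "fin_branching M" "fin_branching N"
  shows "fin_branching (Par M N)"
proof (rule fin_branchingI)
  let ?S = "\<lambda>M. {(m, v, \<nu>, \<Delta>). Defs.trans M (LSnd m v \<nu>) \<Delta>}"
    and ?R = "\<lambda>M m v. {\<Delta>. Defs.trans M (LRcv m v) \<Delta>}" and ?T = "\<lambda>M. {\<Delta>. Defs.trans M LTau \<Delta>}"
    and ?G = "\<lambda>M. {\<Delta>. Defs.trans M LSigma \<Delta>}"
  have fin: "finite (?S M)" "finite (?S N)" "\<And>m v. finite (?R M m v)" "\<And>m v. finite (?R N m v)"
    "finite (?T M)" "finite (?T N)" "finite (?G M)" "finite (?G N)"
    using assms by (auto simp: fin_branching_def)
  show "finite ((\<Union>(m, v, \<nu>, \<Delta>)\<in>?S M. (\<lambda>\<Theta>. (m, v, \<nu> - nds N, par_dist \<Delta> \<Theta>)) ` ?R N m v) \<union>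
      (\<Union>(m, v, \<nu>, \<Delta>)\<in>?S N. (\<lambda>\<Theta>. (m, v, \<nu> - nds M, par_dist \<Theta> \<Delta>)) ` ?R M m v))"
    using fin by (intro finite_UnI finite_UN_I) auto
  show "finite ((\<lambda>(\<Delta>, \<Theta>). par_dist \<Delta> \<Theta>) ` (?R M m v \<times> ?R N m v))" for m v
    using fin by (intro finite_imageI finite_cartesian_product)
  show "finite ((\<lambda>\<Delta>. par_dist \<Delta> (dirac N)) ` ?T M \<union> (\<lambda>\<Delta>. par_dist (dirac M) \<Delta>) ` ?T N)"
    using fin by blast
  show "finite ((\<lambda>(\<Delta>, \<Theta>). par_dist \<Delta> \<Theta>) ` (?G M \<times> ?G N))"
    using fin by (intro finite_imageI finite_cartesian_product)
  show "(m, v, \<nu>, \<Delta>) \<in> (\<Union>(m, v, \<nu>, \<Delta>)\<in>?S M. (\<lambda>\<Theta>. (m, v, \<nu> - nds N, par_dist \<Delta> \<Theta>)) ` ?R N m v) \<union>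
      (\<Union>(m, v, \<nu>, \<Delta>)\<in>?S N. (\<lambda>\<Theta>. (m, v, \<nu> - nds M, par_dist \<Theta> \<Delta>)) ` ?R M m v)" if "Defs.trans (Par M N) (LSnd m v \<nu>) \<Delta>" for m v \<nu> \<Delta>
    using that by (cases rule: parSndE) fastforce+
  show "\<Delta> \<in> (\<lambda>(\<Delta>, \<Theta>). par_dist \<Delta> \<Theta>) ` (?R M m v \<times> ?R N m v)" if "Defs.trans (Par M N) (LRcv m v) \<Delta>" for m v \<Delta>
    using that by (cases rule: parRcvE) auto
  show "\<Delta> \<in> (\<lambda>\<Delta>. par_dist \<Delta> (dirac N)) ` ?T M \<union> (\<lambda>\<Delta>. par_dist (dirac M) \<Delta>) ` ?T N \<or>
      (\<exists>m v. Defs.trans (Par M N) (LSnd m v {}) \<Delta>)" if "Defs.trans (Par M N) LTau \<Delta>" for \<Delta>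
    using that by (cases rule: parTauE) blast+
  show "\<Delta> \<in> (\<lambda>(\<Delta>, \<Theta>). par_dist \<Delta> \<Theta>) ` (?G M \<times> ?G N)" if "Defs.trans (Par M N) LSigma \<Delta>" for \<Delta>
    using that by (cases rule: parSigmaE) auto
qed

lemma good_fin_branching: "good_net M \<Longrightarrow> fin_branching M"
proof (induction M)
  case Zero
  show ?case
    by (intro fin_branchingI[of "{}" _ "\<lambda>_ _. {dirac Zero}" "{}" "{dirac Zero}"]) (auto elim: sndE rcvE tauE sigmaE)
next
  case Bot
  show ?case
    by (intro fin_branchingI[of "{}" _ "\<lambda>_ _. {}" "{}" "{}"]) (auto elim: sndE rcvE tauE sigmaE)
qed (auto intro: fin_branching_par fin_branching_node)

lemma trans_obs_imp_snd:
  "Defs.trans M l \<Delta> \<Longrightarrow> l = LObs v \<nu> \<Longrightarrow> \<exists>m. Defs.trans M (LSnd m v \<nu>) \<Delta>"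
  by (induction rule: trans.induct) (auto intro: trans.Rec)

lemma good_finite_trans:
  assumes "good_net M"
  shows "finite {\<Delta>. Defs.trans M l \<Delta>}"
proof -
  have S: "finite {(m, v, \<nu>, \<Delta>). Defs.trans M (LSnd m v \<nu>) \<Delta>}" (is "finite ?S")
    using good_fin_branching[OF assms] by (simp add: fin_branching_def)
  show ?thesis
  proof (cases l)
    case (LSnd m v \<nu>)
    then have "{\<Delta>. Defs.trans M l \<Delta>} \<subseteq> (\<lambda>(m, v, \<nu>, \<Delta>). \<Delta>) ` ?S" by force
    then show ?thesis using S by (meson finite_imageI finite_subset)
  next
    case (LObs v \<nu>)
    have "{\<Delta>. Defs.trans M l \<Delta>} \<subseteq> (\<lambda>(m, v, \<nu>, \<Delta>). \<Delta>) ` ?S"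
    proof
      fix \<Delta> assume "\<Delta> \<in> {\<Delta>. Defs.trans M l \<Delta>}"
      then obtain m where "(m, v, \<nu>, \<Delta>) \<in> ?S" using LObs trans_obs_imp_snd[of M l \<Delta> v \<nu>] by auto
      then show "\<Delta> \<in> (\<lambda>(m, v, \<nu>, \<Delta>). \<Delta>) ` ?S" by (rule rev_image_eqI) simp
    qed
    then show ?thesis using S by (meson finite_imageI finite_subset)
  qed (use good_fin_branching[OF assms] in \<open>simp_all add: fin_branching_def\<close>)
qed

section \<open>Stuck networks and reception from fresh senders\<close>

text \<open>Congruence can move a buried \<open>Bot\<close> to the front, so a dead component
  violates the side conditions of \<open>TauParL\<close> and \<open>TauParR\<close>. All other
  parallel rules make both components move, which is why only live networks have
  transitions.\<close>

lemma dead_scong: "\<not> live N \<Longrightarrow> \<exists>N'. scong N (Par Bot N')"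
proof (induction N)
  case (Par M N)
  have left: "\<exists>L'. scong (Par M N) (Par Bot L')" if "scong M (Par Bot M')" for M N M' :: "'a net"
    using sc_trans[OF sc_parL[OF that] sc_assoc] by blast
  show ?case
  proof (cases "live M")
    case False
    then show ?thesis using Par left by blast
  next
    case True
    then show ?thesis using Par left[of N _ M] by (auto intro: sc_trans[OF sc_comm])
  qed
next
  case Bot
  show ?case using sc_sym[OF sc_unit] by blast
qed auto

lemma trans_imp_live: "Defs.trans M l \<Delta> \<Longrightarrow> live M"
  by (induction rule: trans.induct) (use dead_scong in auto)

text \<open>A directed counterpart of \<open>rcv\<close>: congruence allows arbitrary zigzags,
  whereas here recursion is only unfolded forward, step by step as in \<open>Rec\<close>.\<close>

inductive unfolds_to_rcv :: "'v proc \<Rightarrow> bool" where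
  "unfolds_to_rcv (PRcv x C D)"
| "unfolds_to_rcv (psubst X (PFix X P) P) \<Longrightarrow> unfolds_to_rcv (PFix X P)"

text \<open>An invariant of structural congruence that turns \<open>rcv\<close> into the directed
  predicate. Being set-valued, it respects commutativity, associativity and the unit at
  once.\<close>

fun rcv_nodes :: "'v net \<Rightarrow> (nat \<times> nat set) set" where
  "rcv_nodes (Par M N) = rcv_nodes M \<union> rcv_nodes N"
| "rcv_nodes (Node n P \<nu>) = (if unfolds_to_rcv P then {(n, \<nu>)} else {})"
| "rcv_nodes _ = {}"

lemma scong_rcv_nodes: "scong M N \<Longrightarrow> rcv_nodes M = rcv_nodes N"
proof (induction rule: scong.induct)
  case (sc_fix n X P \<nu>)
  have "unfolds_to_rcv (PFix X P) \<longleftrightarrow> unfolds_to_rcv (psubst X (PFix X P) P)"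
    by (auto intro: unfolds_to_rcv.intros elim: unfolds_to_rcv.cases)
  then show ?case by simp
qed auto

lemma unfolds_to_rcv_trans:
  "unfolds_to_rcv P \<Longrightarrow> m \<in> \<nu> \<Longrightarrow> \<exists>\<Delta>. Defs.trans (Node n P \<nu>) (LRcv m v) \<Delta>"
  by (induction rule: unfolds_to_rcv.induct) (blast intro: trans.Rcv trans.Rec)+

text \<open>At a node, \<open>Rcv\<close> and \<open>RcvEnb\<close> are complementary, but the side
  condition of the latter refers to congruence; the invariant above produces a transition in the
  case that it excludes. Freshness of \<open>m\<close> meets the other side condition.\<close>

lemma live_receives: "live M \<Longrightarrow> m \<notin> nds M \<Longrightarrow> \<exists>\<Delta>. Defs.trans M (LRcv m v) \<Delta>"
proof (induction M)
  case Zero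
  show ?case by (blast intro: trans.RcvZero)
next
  case (Par M N)
  then show ?case by (auto intro: trans.RcvPar)
next
  case (Node n P \<nu>)
  show ?case
  proof (cases "m \<in> \<nu> \<and> rcv n \<nu> P")
    case True
    then obtain x C D where "scong (Node n P \<nu>) (Node n (PRcv x C D) \<nu>)" by (auto simp: rcv_def)
    from scong_rcv_nodes[OF this] have "unfolds_to_rcv P"
      by (auto intro: unfolds_to_rcv.intros split: if_splits)
    then show ?thesis
      using unfolds_to_rcv_trans[of P m \<nu> n v] True by simp
  next
    case False
    then show ?thesis using Node by (auto intro: trans.RcvEnb)
  qed
qed auto

section \<open>Weak transitions of networks as liftings\<close>

definition live_nets :: "'v net set" where
  "live_nets = {M \<in> Nets. live M}"

definition hat_derivs :: "'v lab \<Rightarrow> 'v net \<Rightarrow> 'v net pmf set" where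
  "hat_derivs a M = (if \<exists>p. hat_trans M a (pmf p) then {p. hat_trans M a (pmf p)} else {return_pmf Bot})"

lemma Bot_not_live [simp]: "Bot \<notin> live_nets"
  by (simp add: live_nets_def)

lemma trans_live_nets:
  assumes "M \<in> live_nets" "Defs.trans M a \<Delta>"
  shows "\<exists>p. \<Delta> = pmf p \<and> finite (set_pmf p) \<and> set_pmf p \<subseteq> live_nets \<and>
    (\<forall>M'\<in>set_pmf p. decreases a (net_unguarded_size M') (net_unguarded_size M))"
proof -
  have M: "wf_net M" "live M" "good_net M"
    using assms(1) wf_net_iff by (auto simp: live_nets_def Nets_def)
  obtain p where p: "\<Delta> = pmf p" "deriv_ok M a p" using trans_pmf[OF assms(2) M(3)] by blast
  have "wf_net M' \<and> live M'" if "good_net M'" "skel M' = skel M" for M'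
    using that M wf_net_iff[of M] wf_net_iff[of M'] live_skel[of M] live_skel[of M'] by simp
  then show ?thesis
    using p by (intro exI[of _ p]) (auto simp: deriv_ok_def live_nets_def Nets_def)
qed

lemma pmf_eq_iff: "pmf p = pmf q \<longleftrightarrow> p = q"
  by (auto intro: pmf_eqI)

lemma trans_live_nets_pmf:
  assumes "M \<in> live_nets" "Defs.trans M a (pmf p)"
  shows "finite (set_pmf p) \<and> set_pmf p \<subseteq> live_nets \<and> (\<forall>M'\<in>set_pmf p. decreases a (net_unguarded_size M') (net_unguarded_size M))"
  using trans_live_nets[OF assms] by (auto simp: pmf_eq_iff)

lemma no_trans_Bot: "\<not> Defs.trans Bot a \<Delta>"
  using trans_imp_live by fastforce

lemma hat_trans_Bot: "hat_trans Bot a \<Delta> \<longleftrightarrow> a = LTau \<and> \<Delta> = dirac Bot"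
  by (simp add: hat_trans_def no_trans_Bot)

lemma hat_derivs_Bot: "hat_derivs a Bot = {return_pmf Bot}"
  by (auto simp: hat_derivs_def hat_trans_Bot dirac_eq_pmf pmf_eq_iff)

lemma hat_derivsI: "hat_trans M a (pmf p) \<Longrightarrow> p \<in> hat_derivs a M"
  by (auto simp: hat_derivs_def)

lemma hat_derivs_cases:
  assumes "p \<in> hat_derivs a M"
  obtains "Defs.trans M a (pmf p)" | "a = LTau" "p = return_pmf M"
    | "p = return_pmf Bot" "\<nexists>q. hat_trans M a (pmf q)"
  using assms by (auto simp: hat_derivs_def hat_trans_def dirac_eq_pmf pmf_eq_iff split: if_splits)

lemma hat_trans_live_nets_pmf:
  assumes "M \<in> live_nets" "hat_trans M a (pmf p)"
  shows "finite (set_pmf p) \<and> set_pmf p \<subseteq> live_nets"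
  using assms trans_live_nets_pmf[of M a p]
  by (auto simp: hat_trans_def dirac_eq_pmf pmf_eq_iff split: if_splits)

lemma hat_trans_live_nets:
  assumes "M \<in> live_nets" "hat_trans M a \<Delta>"
  shows "\<exists>p. \<Delta> = pmf p"
  using assms trans_live_nets[of M a \<Delta>] by (auto simp: hat_trans_def dirac_eq_pmf split: if_splits)

lemma finitary_hat_derivs: "finitary (insert Bot live_nets) (hat_derivs a)"
  unfolding finitary_def
proof (intro ballI)
  fix M :: "'a net" assume "M \<in> insert Bot live_nets"
  then consider "M = Bot" | "M \<in> live_nets" by auto
  then show "finite (hat_derivs a M) \<and> (\<forall>e\<in>hat_derivs a M. finite (set_pmf e) \<and> set_pmf e \<subseteq> insert Bot live_nets)"
  proof cases
    case 2
    then have "finite {\<Delta>. Defs.trans M a \<Delta>}"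
      using good_finite_trans wf_net_iff by (auto simp: live_nets_def Nets_def)
    then have "finite (pmf -` {\<Delta>. Defs.trans M a \<Delta>})"
      by (rule finite_vimageI) (auto intro: injI simp: pmf_eq_iff)
    moreover have "hat_derivs a M \<subseteq> pmf -` {\<Delta>. Defs.trans M a \<Delta>} \<union> {return_pmf M, return_pmf Bot}"
      by (auto elim!: hat_derivs_cases)
    ultimately have "finite (hat_derivs a M)" by (meson finite.emptyI finite_UnI finite_insert finite_subset)
    moreover have "finite (set_pmf e) \<and> set_pmf e \<subseteq> insert Bot live_nets" if "e \<in> hat_derivs a M" for e
      using that
    proof (cases rule: hat_derivs_cases)
      case 1
      then show ?thesis using trans_live_nets_pmf[OF 2] by auto
    qed (use 2 in auto)
    ultimately show ?thesis by blast
  qed (simp add: hat_derivs_Bot)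
qed

text \<open>Of the networks containing \<open>Bot\<close>, only \<open>Bot\<close> itself is a
  state; the others are identified with it at the end.\<close>

interpretation weak_lts "insert Bot live_nets" Bot hat_derivs LTau net_unguarded_size "Collect obs_lab"
proof
  fix s s' :: "'a net" and e :: "'a net pmf"
  assume *: "s \<in> insert Bot live_nets" "e \<in> hat_derivs LTau s" "e \<noteq> return_pmf s" "s' \<in> set_pmf e"
  have "s \<in> live_nets" using * by (auto simp: hat_derivs_Bot)
  moreover have "Defs.trans s LTau (pmf e)"
    using *(2) by (cases rule: hat_derivs_cases) (use * in \<open>auto simp: hat_trans_def dirac_eq_pmf\<close>)
  ultimately show "net_unguarded_size s' < net_unguarded_size s" using trans_live_nets_pmf[of s LTau e] *(4) by simp
next
  show "return_pmf s \<in> hat_derivs LTau s" for s :: "'a net"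
    by (rule hat_derivsI) (simp add: hat_trans_def dirac_eq_pmf)
  show "hat_derivs a s \<noteq> {}" for a and s :: "'a net"
    by (auto simp: hat_derivs_def)
qed (simp_all add: hat_derivs_Bot finitary_hat_derivs)

abbreviation states :: "'v net set" where
  "states \<equiv> insert Bot live_nets"

text \<open>Sub-distributions on live networks are distributions with the missing mass placed on \<open>Bot\<close>.\<close>

definition strip :: "'v net pmf \<Rightarrow> 'v dist" where
  "strip X = (\<lambda>N. if N = Bot then 0 else pmf X N)"

lemma strip_return: "M \<in> live_nets \<Longrightarrow> strip (return_pmf M) = dirac M"
  by (auto simp: strip_def dirac_def fun_eq_iff)

lemma sum_pmf_minus_Bot:
  assumes "finite (set_pmf X)"
  shows "(\<Sum>N\<in>set_pmf X - {Bot}. pmf X N) = 1 - pmf X Bot"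
proof -
  have "(\<Sum>N\<in>insert Bot (set_pmf X). pmf X N) = 1" using assms by (intro sum_pmf_eq_1) auto
  then show ?thesis using assms by (simp add: sum.insert_remove)
qed

lemma pad_bot_strip:
  assumes "finite (set_pmf X)"
  shows "pad_bot (strip X) = pmf X"
proof -
  have "supp (strip X) = set_pmf X - {Bot}"
    by (auto simp: supp_def strip_def set_pmf_iff)
  then have "mass (strip X) = (\<Sum>N\<in>set_pmf X - {Bot}. pmf X N)"
    unfolding mass_def by (auto simp: strip_def intro!: sum.cong)
  then show ?thesis
    using sum_pmf_minus_Bot[OF assms] by (auto simp: pad_bot_def strip_def)
qed

lemma pmf_bind_finite:
  assumes "finite B" "set_pmf p \<subseteq> B"
  shows "pmf (bind_pmf p f) N = (\<Sum>b\<in>B. pmf p b * pmf (f b) N)"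
  unfolding pmf_bind using assms by (subst integral_measure_pmf[of B]) auto

section \<open>Translating moves of sub-distributions into liftings and back\<close>

text \<open>The indices of the decomposition become a sample space; one additional index carries the
  mass that \<open>X\<close> already has on \<open>Bot\<close>.\<close>

lemma lift_trans_imp_lift_rel:
  fixes X :: "'v net pmf"
  assumes "lift_trans (strip X) a \<Theta>" and X: "finite_on states X"
  shows "\<exists>Y. lift_rel (hat_derivs a) X Y \<and> \<Theta> = strip Y"
proof -
  obtain ps :: "(real \<times> 'v net) list" and \<Theta>s J where pos: "\<And>i. i < length ps \<Longrightarrow> 0 < fst (ps ! i)"
    and stripX: "strip X = (\<lambda>N. \<Sum>i<length ps. fst (ps ! i) * dirac (snd (ps ! i)) N)"
    and J: "J \<subseteq> {..<length ps}" "\<And>j. j \<in> J \<Longrightarrow> hat_trans (snd (ps ! j)) a (\<Theta>s j)"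
      "\<And>i. i < length ps \<Longrightarrow> i \<notin> J \<Longrightarrow> \<not> (\<exists>\<Theta>'. hat_trans (snd (ps ! i)) a \<Theta>')"
    and \<Theta>: "\<Theta> = (\<lambda>N. \<Sum>j\<in>J. fst (ps ! j) * \<Theta>s j N)"
    using assms(1) unfolding lift_trans_def by blast
  define n where "n = length ps"
  define p s where "p i = fst (ps ! i)" and "s i = snd (ps ! i)" for i
  \<comment> \<open>Positive weights cannot cancel, so every listed network has positive mass in
    \<open>strip X\<close>.\<close>
  have sX: "s i \<noteq> Bot \<and> s i \<in> set_pmf X" if "i < n" for i
  proof -
    have "p i * dirac (s i) (s i) \<le> (\<Sum>i'<n. p i' * dirac (s i') (s i))"
      using that pos by (intro member_le_sum) (auto simp: n_def p_def dirac_def intro: less_imp_le)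
    also have "\<dots> = strip X (s i)" by (simp only: stripX n_def p_def s_def)
    finally have "p i \<le> strip X (s i)" by (simp add: dirac_def)
    then have "0 < strip X (s i)" using pos[of i] that by (simp add: n_def p_def)
    then show ?thesis by (auto simp: strip_def set_pmf_iff split: if_splits)
  qed
  then have live: "s i \<in> live_nets" if "i < n" for i using X that by (auto simp: finite_on_def)
  have finX: "finite (set_pmf X)" using X by (simp add: finite_on_def)
  have "1 - pmf X Bot = (\<Sum>N\<in>set_pmf X - {Bot}. strip X N)"
    unfolding sum_pmf_minus_Bot[OF finX, symmetric] by (auto simp: strip_def intro!: sum.cong)
  also have "\<dots> = (\<Sum>i<n. \<Sum>N\<in>set_pmf X - {Bot}. p i * dirac (s i) N)"
    unfolding stripX n_def p_def s_def by (rule sum.swap)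
  also have "\<dots> = (\<Sum>i<n. p i)"
  proof (intro sum.cong refl)
    fix i assume "i \<in> {..<n}"
    then have "s i \<in> set_pmf X - {Bot}" using sX by simp
    moreover have "(\<Sum>N\<in>set_pmf X - {Bot}. p i * dirac (s i) N) = (\<Sum>N\<in>set_pmf X - {Bot}. if N = s i then p i else 0)"
      by (intro sum.cong) (auto simp: dirac_def)
    ultimately show "(\<Sum>N\<in>set_pmf X - {Bot}. p i * dirac (s i) N) = p i"
      using finX by simp
  qed
  finally have sum_p: "1 - pmf X Bot = (\<Sum>i<n. p i)" .
  \<comment> \<open>Index \<open>n\<close> is the additional one; the identity just shown makes the
    total 1.\<close>
  define f where "f i = (if i < n then p i else if i = n then pmf X Bot else 0)" for i
  obtain \<iota> where \<iota>: "pmf \<iota> = f" "set_pmf \<iota> \<subseteq> {..n}"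
  proof (rule finite_support_pmf[of "{..n}" f])
    have "sum f {..n} = f n + sum f {..<n}" by (simp add: lessThan_Suc_atMost[symmetric])
    then show "sum f {..n} = 1" using sum_p by (simp add: f_def)
  qed (use pos in \<open>auto simp: f_def p_def n_def intro: less_imp_le\<close>)
  have "\<exists>q. \<Theta>s j = pmf q" if "j \<in> J" for j
    using hat_trans_live_nets[OF live[of j], of a "\<Theta>s j"] J(1) J(2)[OF that] that by (auto simp: n_def s_def)
  then obtain q where q0: "\<And>j. j \<in> J \<Longrightarrow> \<Theta>s j = pmf (q j)" by metis
  have q: "\<Theta>s j = pmf (q j) \<and> q j \<in> hat_derivs a (s j) \<and> set_pmf (q j) \<subseteq> live_nets" if "j \<in> J" for j
  proof -
    have "hat_trans (s j) a (pmf (q j))" using J(2)[OF that] q0[OF that] by (simp add: s_def)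
    moreover have "s j \<in> live_nets" using live J(1) that by (auto simp: n_def)
    ultimately show ?thesis using q0[OF that] hat_trans_live_nets_pmf by (auto intro: hat_derivsI)
  qed
  define st where "st i = (if i < n then s i else Bot)" for i
  \<comment> \<open>Indices below \<open>n\<close> outside \<open>J\<close> cannot move, so their
    mass is sent to \<open>Bot\<close>; index \<open>n\<close> stays there.\<close>
  define e where "e i = (if i \<in> J then q i else return_pmf Bot)" for i
  define Y where "Y = bind_pmf \<iota> e"
  have split: "(\<Sum>i\<le>n. g i) = g n + (\<Sum>i<n. g i)" for g :: "nat \<Rightarrow> real"
    by (simp add: lessThan_Suc_atMost[symmetric])
  have "X = map_pmf st \<iota>"
  proof (rule pmf_eqI)
    fix N
    have "pmf (map_pmf st \<iota>) N = f n * pmf (return_pmf (st n)) N + (\<Sum>i<n. f i * pmf (return_pmf (st i)) N)"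
      unfolding map_pmf_def pmf_bind_finite[OF finite_atMost \<iota>(2)] \<iota>(1) split ..
    also have "\<dots> = f n * pmf (return_pmf Bot) N + (\<Sum>i<n. p i * dirac (s i) N)"
      by (simp add: st_def f_def dirac_eq_pmf)
    also have "\<dots> = pmf X N"
    proof (cases "N = Bot")
      case True
      then have "(\<Sum>i<n. p i * dirac (s i) N) = 0" using sX by (intro sum.neutral) (force simp: dirac_def)
      then show ?thesis using True by (simp add: f_def)
    next
      case False
      then show ?thesis using fun_cong[OF stripX, of N] by (simp add: strip_def n_def p_def s_def)
    qed
    finally show "pmf X N = pmf (map_pmf st \<iota>) N" ..
  qed
  moreover have "e i \<in> hat_derivs a (st i)" for i
  proof -
    have "hat_derivs a (s i) = {return_pmf Bot}" if "i < n" "i \<notin> J"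
      using J(3) that by (auto simp: hat_derivs_def n_def s_def)
    then show ?thesis using q J by (auto simp: e_def st_def hat_derivs_Bot n_def)
  qed
  ultimately have "lift_rel (hat_derivs a) X Y" by (simp add: Y_def lift_relI)
  moreover have "\<Theta> = strip Y"
  proof
    fix N
    show "\<Theta> N = strip Y N"
    proof (cases "N = Bot")
      case True
      have "\<Theta>s j Bot = 0" if "j \<in> J" for j using q[OF that] by (auto simp: pmf_eq_0_set_pmf)
      then show ?thesis using True by (simp add: \<Theta> strip_def)
    next
      case False
      have "strip Y N = f n * pmf (e n) N + (\<Sum>i<n. f i * pmf (e i) N)"
        using False unfolding strip_def Y_def pmf_bind_finite[OF finite_atMost \<iota>(2)] \<iota>(1) split by simp
      also have "\<dots> = (\<Sum>i<n. f i * pmf (e i) N)"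
        using False J(1) by (auto simp: e_def n_def)
      also have "\<dots> = (\<Sum>i\<in>J. f i * pmf (e i) N)"
        using J(1) False by (intro sum.mono_neutral_right) (auto simp: n_def e_def)
      also have "\<dots> = \<Theta> N"
        unfolding \<Theta> using J(1) q by (intro sum.cong) (auto simp: f_def e_def n_def p_def)
      finally show ?thesis ..
    qed
  qed
  ultimately show ?thesis by blast
qed

text \<open>The support of \<open>\<rho>\<close> is enumerated as a list, so a state with several
  derivatives is listed several times. \<open>Y \<noteq> return_pmf Bot\<close> provides the
  non-empty index set \<open>J\<close>.\<close>

lemma lift_rel_imp_lift_trans:
  fixes X :: "'v net pmf"
  assumes "lift_rel (hat_derivs a) X Y" and X: "finite_on states X" and Y: "Y \<noteq> return_pmf Bot"
  shows "lift_trans (strip X) a (strip Y)"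
proof -
  obtain \<rho> where \<rho>: "map_pmf fst \<rho> = X" "bind_pmf \<rho> snd = Y" "\<forall>(s, e)\<in>set_pmf \<rho>. e \<in> hat_derivs a s"
    using assms(1) by (auto simp: lift_rel_def)
  have st: "fst z \<in> set_pmf X" "snd z \<in> hat_derivs a (fst z)" if "z \<in> set_pmf \<rho>" for z
    using that \<rho> by auto
  have fin: "finite (set_pmf \<rho>)"
  proof (rule finite_subset)
    show "set_pmf \<rho> \<subseteq> (SIGMA s:set_pmf X. hat_derivs a s)" using st by auto
    show "finite (SIGMA s:set_pmf X. hat_derivs a s)"
      using X finitary_hat_derivs[of a] by (intro finite_SigmaI) (auto simp: finite_on_def finitary_def)
  qed
  \<comment> \<open>Mass on \<open>Bot\<close> is invisible to \<open>strip\<close>, so these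
    entries are left out of the list.\<close>
  define Z where "Z = {z \<in> set_pmf \<rho>. fst z \<noteq> Bot}"
  have live: "fst z \<in> live_nets" if "z \<in> Z" for z using st[of z] that X by (auto simp: Z_def finite_on_def)
  obtain zs where zs: "set zs = Z" "distinct zs"
    using finite_distinct_list[of Z] fin by (auto simp: Z_def)
  define n where "n = length zs"
  define H where "H z \<longleftrightarrow> (\<exists>q. hat_trans (fst z) a (pmf q))" for z :: "'v net \<times> 'v net pmf"
  define J where "J = {i. i < n \<and> H (zs ! i)}"
  define ps where "ps = map (\<lambda>z. (pmf \<rho> z, fst z)) zs"
  have zsZ: "zs ! i \<in> Z" if "i < n" for i using that zs by (auto simp: n_def)
  have reindex: "(\<Sum>i<n. g (zs ! i)) = (\<Sum>z\<in>Z. g z)" for g :: "_ \<Rightarrow> real"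
    unfolding n_def by (rule sum.reindex_bij_betw) (use bij_betw_nth[OF zs(2)] zs(1) in auto)
  have noH: "snd z = return_pmf Bot" if "z \<in> set_pmf \<rho>" "z \<notin> Z \<or> \<not> H z" for z
    using st[OF that(1)] that by (auto simp: H_def hat_derivs_def Z_def hat_derivs_Bot hat_trans_Bot pmf_eq_iff dirac_eq_pmf split: if_splits)
  have H: "hat_trans (fst z) a (pmf (snd z))" "pmf (snd z) Bot = 0" if "z \<in> Z" "H z" for z
  proof -
    show *: "hat_trans (fst z) a (pmf (snd z))"
      using st[of z] that by (auto simp: H_def hat_derivs_def Z_def)
    show "pmf (snd z) Bot = 0"
      using hat_trans_live_nets_pmf[OF live[OF that(1)] *] by (auto simp: pmf_eq_0_set_pmf)
  qed
  have sumJ: "(\<Sum>j\<in>J. g (zs ! j)) = (\<Sum>z\<in>Z. if H z then g z else 0)" for g :: "_ \<Rightarrow> real"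
    unfolding reindex[symmetric] J_def by (subst sum.inter_filter[symmetric]) (auto simp: lessThan_def)
  show ?thesis
    unfolding lift_trans_def
  proof (intro exI conjI)
    show "\<forall>i<length ps. 0 < fst (ps ! i)"
      using zsZ by (auto simp: ps_def Z_def n_def pmf_positive)
    show "strip X = (\<lambda>N. \<Sum>i<length ps. fst (ps ! i) * dirac (snd (ps ! i)) N)"
    proof
      fix N
      have "(\<Sum>i<length ps. fst (ps ! i) * dirac (snd (ps ! i)) N) = (\<Sum>i<n. pmf \<rho> (zs ! i) * dirac (fst (zs ! i)) N)"
        by (intro sum.cong) (auto simp: ps_def n_def)
      also have "\<dots> = (\<Sum>z\<in>Z. pmf \<rho> z * dirac (fst z) N)" by (rule reindex)
      also have "\<dots> = strip X N"
      proof (cases "N = Bot")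
        case True
        then show ?thesis by (auto simp: strip_def Z_def dirac_def intro!: sum.neutral)
      next
        case False
        have "strip X N = (\<Sum>z\<in>set_pmf \<rho>. pmf \<rho> z * dirac (fst z) N)"
          using False unfolding strip_def \<rho>(1)[symmetric] map_pmf_def pmf_bind_finite[OF fin order_refl]
          by (simp add: dirac_eq_pmf)
        also have "\<dots> = (\<Sum>z\<in>Z. pmf \<rho> z * dirac (fst z) N)"
          using fin False by (intro sum.mono_neutral_right) (auto simp: Z_def dirac_def)
        finally show ?thesis ..
      qed
      finally show "strip X N = (\<Sum>i<length ps. fst (ps ! i) * dirac (snd (ps ! i)) N)" ..
    qed
    show "J \<subseteq> {..<length ps}" by (auto simp: J_def n_def ps_def)
    show "J \<noteq> {}"
    proof
      assume "J = {}"
      then have "\<not> H z" if "z \<in> Z" for z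
        using that unfolding zs(1)[symmetric] J_def n_def by (auto simp: in_set_conv_nth)
      then have "bind_pmf \<rho> snd = bind_pmf \<rho> (\<lambda>_. return_pmf Bot)"
        using noH by (intro bind_pmf_cong) auto
      then show False using Y \<rho>(2) by simp
    qed
    show "\<forall>j\<in>J. hat_trans (snd (ps ! j)) a (pmf (snd (zs ! j)))"
      using H zsZ by (auto simp: J_def ps_def n_def)
    show "\<forall>i<length ps. i \<notin> J \<longrightarrow> \<not> (\<exists>\<Theta>'. hat_trans (snd (ps ! i)) a \<Theta>')"
    proof (intro allI impI notI)
      fix i assume i: "i < length ps" "i \<notin> J" and "\<exists>\<Theta>'. hat_trans (snd (ps ! i)) a \<Theta>'"
      then obtain \<Theta>' where "hat_trans (fst (zs ! i)) a \<Theta>'" by (auto simp: ps_def)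
      moreover have "i < n" using i by (simp add: ps_def n_def)
      ultimately have "H (zs ! i)"
        using hat_trans_live_nets[OF live[OF zsZ], of i a \<Theta>'] by (auto simp: H_def)
      then show False using i \<open>i < n\<close> by (simp add: J_def)
    qed
    show "strip Y = (\<lambda>N. \<Sum>j\<in>J. fst (ps ! j) * pmf (snd (zs ! j)) N)"
    proof
      fix N
      have "(\<Sum>j\<in>J. fst (ps ! j) * pmf (snd (zs ! j)) N) = (\<Sum>j\<in>J. pmf \<rho> (zs ! j) * pmf (snd (zs ! j)) N)"
        by (intro sum.cong) (auto simp: ps_def J_def n_def)
      also have "\<dots> = (\<Sum>z\<in>Z. if H z then pmf \<rho> z * pmf (snd z) N else 0)" by (rule sumJ)
      also have "\<dots> = strip Y N"
      proof (cases "N = Bot")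
        case True
        then show ?thesis using H(2) by (auto simp: strip_def intro!: sum.neutral)
      next
        case False
        have "strip Y N = (\<Sum>z\<in>set_pmf \<rho>. pmf \<rho> z * pmf (snd z) N)"
          using False unfolding strip_def \<rho>(2)[symmetric] pmf_bind_finite[OF fin order_refl] by simp
        also have "\<dots> = (\<Sum>z\<in>Z. pmf \<rho> z * pmf (snd z) N)"
          using fin False noH by (intro sum.mono_neutral_right) (auto simp: Z_def)
        also have "\<dots> = (\<Sum>z\<in>Z. if H z then pmf \<rho> z * pmf (snd z) N else 0)"
          using False noH by (intro sum.cong) (auto simp: Z_def)
        finally show ?thesis ..
      qed
      finally show "strip Y N = (\<Sum>j\<in>J. fst (ps ! j) * pmf (snd (zs ! j)) N)" ..
    qed
  qed
qed

lemma tau_star_finite_on: "tau_star X Y \<Longrightarrow> finite_on states X \<Longrightarrow> finite_on states Y"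
  using weak_finite_support[of X LTau Y] by (simp add: weak_def)

lemma weak_tau_imp_tau_star:
  assumes "weak_tau (strip X) \<Theta>" "finite_on states X"
  shows "\<exists>Y. tau_star X Y \<and> \<Theta> = strip Y"
  using assms(1) unfolding weak_tau_def
proof (induction rule: rtranclp_induct)
  case base
  show ?case using tau_star_refl by blast
next
  case (step \<Theta>1 \<Theta>2)
  then obtain Y where Y: "tau_star X Y" "\<Theta>1 = strip Y" by blast
  have "lift_trans (strip Y) LTau \<Theta>2" using step.hyps(2) Y(2) by simp
  from lift_trans_imp_lift_rel[OF this tau_star_finite_on[OF Y(1) assms(2)]]
  obtain Y' where Y': "lift_rel (hat_derivs LTau) Y Y'" "\<Theta>2 = strip Y'" by blast
  have "tau_star X Y'"
    using rtranclp.rtrancl_into_rtrancl[OF Y(1)[unfolded tau_star_def] Y'(1)] by (simp only: tau_star_def)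
  then show ?case using Y'(2) by blast
qed

lemma lift_rel_from_Bot: "lift_rel (hat_derivs a) (return_pmf Bot) Y \<Longrightarrow> Y = return_pmf Bot"
proof (elim lift_rel_return_joinE)
  fix \<mu> assume \<mu>: "set_pmf \<mu> \<subseteq> hat_derivs a Bot" "Y = join_pmf \<mu>"
  then have "bind_pmf \<mu> (\<lambda>x. x) = bind_pmf \<mu> (\<lambda>_. return_pmf Bot)"
    by (intro bind_pmf_cong) (auto simp: hat_derivs_Bot)
  then show "Y = return_pmf Bot" using \<mu> by (simp add: join_pmf_def)
qed

text \<open>\<open>Bot\<close> is absorbing: if the last distribution is not entirely
  \<open>Bot\<close>, then no intermediate one is, and each step can be translated.\<close>

lemma tau_star_imp_weak_tau:
  assumes "tau_star X Y" "finite_on states X" "Y \<noteq> return_pmf Bot"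
  shows "weak_tau (strip X) (strip Y)"
  using assms(1,3) unfolding tau_star_def
proof (induction rule: rtranclp_induct)
  case base
  show ?case by (simp add: weak_tau_def)
next
  case (step Y Z)
  have "Y \<noteq> return_pmf Bot" using step.hyps(2) step.prems lift_rel_from_Bot by blast
  moreover have "finite_on states Y"
    using tau_star_finite_on assms(2) step.hyps(1) by (simp add: tau_star_def)
  ultimately show ?case
    using step lift_rel_imp_lift_trans unfolding weak_tau_def by (meson rtranclp.rtrancl_into_rtrancl)
qed

lemma tau_star_from_Bot:
  assumes "tau_star (return_pmf Bot) Y"
  shows "Y = return_pmf Bot"
  using assms unfolding tau_star_def
  by (induction rule: rtranclp_induct) (auto dest: lift_rel_from_Bot)

lemma weak_trans_imp_weak:
  assumes "weak_trans M a \<Theta>" "M \<in> live_nets"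
  shows "\<exists>X. weak a (return_pmf M) X \<and> \<Theta> = strip X"
proof -
  have M: "dirac M = strip (return_pmf M)" "finite_on states (return_pmf M)"
    using assms(2) by (auto simp: strip_return)
  show ?thesis
  proof (cases "a = LTau")
    case True
    then show ?thesis
      using assms M(1) weak_tau_imp_tau_star[OF _ M(2), of \<Theta>] by (simp add: weak_trans_def weak_def)
  next
    case False
    then obtain \<Delta>1 \<Delta>2 where \<Delta>: "weak_tau (dirac M) \<Delta>1" "lift_trans \<Delta>1 a \<Delta>2" "weak_tau \<Delta>2 \<Theta>"
      using assms by (auto simp: weak_trans_def)
    obtain X1 where 1: "tau_star (return_pmf M) X1" "\<Delta>1 = strip X1" "finite_on states X1"
      using weak_tau_imp_tau_star[OF _ M(2)] \<Delta>(1) M tau_star_finite_on by metis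
    obtain X2 where 2: "lift_rel (hat_derivs a) X1 X2" "\<Delta>2 = strip X2"
      using lift_trans_imp_lift_rel[OF _ 1(3)] \<Delta>(2) 1 by metis
    have "finite_on states X2" using lift_rel_finite_support[OF F_finitary 1(3) 2(1)] .
    then obtain X3 where "tau_star X2 X3" "\<Theta> = strip X3"
      using weak_tau_imp_tau_star \<Delta>(3) 2 by metis
    then show ?thesis using 1 2 False by (auto simp: weak_def)
  qed
qed

lemma weak_imp_weak_trans:
  assumes "weak a (return_pmf M) X" "M \<in> live_nets" "X \<noteq> return_pmf Bot"
  shows "weak_trans M a (strip X)"
proof -
  have M: "dirac M = strip (return_pmf M)" "finite_on states (return_pmf M)"
    using assms(2) by (auto simp: strip_return)
  show ?thesis
  proof (cases "a = LTau")
    case True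
    then show ?thesis
      using assms M(1) tau_star_imp_weak_tau[OF _ M(2), of X] by (simp add: weak_trans_def weak_def)
  next
    case False
    then obtain X1 X2 where 1: "tau_star (return_pmf M) X1" "lift_rel (hat_derivs a) X1 X2" "tau_star X2 X"
      using assms by (auto simp: weak_def)
    have 2: "X2 \<noteq> return_pmf Bot" using 1 assms tau_star_from_Bot by blast
    then have 3: "X1 \<noteq> return_pmf Bot" using 1 lift_rel_from_Bot by blast
    have "finite_on states X1" using tau_star_finite_on[OF 1(1) M(2)] .
    moreover from this have "finite_on states X2" using lift_rel_finite_support[OF F_finitary _ 1(2)] by blast
    ultimately show ?thesis
      using False M 1 2 3 assms(3) tau_star_imp_weak_tau lift_rel_imp_lift_trans
      unfolding weak_trans_def by metis
  qed
qed

text \<open>Positive weights force every entry in a decomposition of \<open>dirac N\<close> to be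
  \<open>N\<close>, and a dead \<open>N\<close> has only the idle internal move.\<close>

lemma lift_trans_dead:
  assumes "lift_trans (dirac N) a \<Theta>" "\<not> live N"
  shows "a = LTau \<and> \<Theta> = dirac N"
proof -
  obtain ps :: "(real \<times> 'a net) list" and \<Theta>s J where pos: "\<And>i. i < length ps \<Longrightarrow> 0 < fst (ps ! i)"
    and N: "dirac N = (\<lambda>M. \<Sum>i<length ps. fst (ps ! i) * dirac (snd (ps ! i)) M)"
    and J: "J \<subseteq> {..<length ps}" "J \<noteq> {}" "\<And>j. j \<in> J \<Longrightarrow> hat_trans (snd (ps ! j)) a (\<Theta>s j)"
      "\<And>i. i < length ps \<Longrightarrow> i \<notin> J \<Longrightarrow> \<not> (\<exists>\<Theta>'. hat_trans (snd (ps ! i)) a \<Theta>')"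
    and \<Theta>: "\<Theta> = (\<lambda>M. \<Sum>j\<in>J. fst (ps ! j) * \<Theta>s j M)"
    using assms(1) unfolding lift_trans_def by blast
  have sN: "snd (ps ! i) = N" if "i < length ps" for i
  proof -
    let ?s = "snd (ps ! i)"
    have "fst (ps ! i) * dirac ?s ?s \<le> (\<Sum>i'<length ps. fst (ps ! i') * dirac (snd (ps ! i')) ?s)"
      using that pos by (intro member_le_sum) (auto simp: dirac_def intro: less_imp_le)
    also have "\<dots> = dirac N ?s" by (rule fun_cong[OF N, symmetric])
    finally have "fst (ps ! i) \<le> dirac N ?s" by (simp add: dirac_def[of ?s])
    then have "0 < dirac N ?s" using pos[OF that] by linarith
    then show ?thesis by (auto simp: dirac_def split: if_splits)
  qed
  have no: "\<not> Defs.trans N a \<Delta>" for \<Delta> using assms(2) trans_imp_live by blast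
  obtain j where "j \<in> J" using J(2) by blast
  then have "hat_trans N a (\<Theta>s j)" using J sN by force
  then have a: "a = LTau" using no by (auto simp: hat_trans_def split: if_splits)
  then have "hat_trans N a (dirac N)" by (simp add: hat_trans_def)
  then have Jall: "J = {..<length ps}" using J(1,4) sN by blast
  have "\<Theta>s j = dirac N" if "j \<in> J" for j
    using J(3)[OF that] Jall that sN no a by (auto simp: hat_trans_def)
  then have "\<Theta> M = (\<Sum>i<length ps. fst (ps ! i) * dirac (snd (ps ! i)) M)" for M
    unfolding \<Theta> Jall using sN by (intro sum.cong) auto
  then have "\<Theta> = dirac N" by (intro ext) (simp only: fun_cong[OF N])
  then show ?thesis using a by simp
qed

lemma weak_trans_dead:
  assumes "weak_trans N a \<Theta>" "\<not> live N"
  shows "a = LTau"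
proof (rule ccontr)
  assume "a \<noteq> LTau"
  then obtain \<Delta>1 \<Delta>2 where \<Delta>: "weak_tau (dirac N) \<Delta>1" "lift_trans \<Delta>1 a \<Delta>2"
    using assms by (auto simp: weak_trans_def)
  have "\<Delta>1 = dirac N"
    using \<Delta>(1) unfolding weak_tau_def
    by (induction rule: rtranclp_induct) (use lift_trans_dead[OF _ assms(2)] in auto)
  then show False using \<Delta>(2) lift_trans_dead[OF _ assms(2)] \<open>a \<noteq> LTau\<close> by blast
qed

lemma weak_sim_quasimetric_transfer:
  assumes "weak_sim_quasimetric d" "M \<in> Nets" "N \<in> Nets" "d M N < 1" "obs_lab a" "Defs.trans M a \<Delta>"
  obtains \<Theta> where "weak_trans N a \<Theta>" "kantorovich d \<Delta> (pad_bot \<Theta>) \<le> d M N"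
  using assms unfolding weak_sim_quasimetric_def by blast

lemma sim_quasimetric_live_dead:
  assumes d: "weak_sim_quasimetric d" and M: "M \<in> live_nets" and N: "N \<in> Nets" "\<not> live N"
  shows "d M N = 1"
proof (rule ccontr)
  assume "d M N \<noteq> 1"
  then have "d M N < 1"
    using d M N by (auto simp: weak_sim_quasimetric_def pseudoquasimetric_def live_nets_def less_le)
  obtain m where "m \<notin> nds M" using finite_nds[of M] by (meson ex_new_if_finite infinite_UNIV_nat)
  then obtain \<Delta> where "Defs.trans M (LRcv m undefined) \<Delta>"
    using live_receives[of M m undefined] M by (auto simp: live_nets_def)
  then obtain \<Theta> where "weak_trans N (LRcv m undefined) \<Theta>"
    using weak_sim_quasimetric_transfer[of d M N "LRcv m undefined" \<Delta>] d N \<open>d M N < 1\<close> M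
    by (auto simp: live_nets_def)
  then show False using weak_trans_dead N by blast
qed

section \<open>Matchings as couplings\<close>

lemma matching_pmf_iff:
  assumes "finite (set_pmf w)"
  shows "pmf w \<in> matching (pmf p) (pmf q) \<longleftrightarrow> map_pmf fst w = p \<and> map_pmf snd w = q"
proof -
  have supp: "supp (pmf w) = set_pmf w" by (auto simp: supp_def set_pmf_iff)
  have fin: "finite {N. pmf w (M, N) \<noteq> 0}" "finite {N. pmf w (N, M) \<noteq> 0}" for M
  proof -
    have "{N. pmf w (M, N) \<noteq> 0} \<subseteq> snd ` set_pmf w" "{N. pmf w (N, M) \<noteq> 0} \<subseteq> fst ` set_pmf w"
      by (force simp: set_pmf_iff)+
    then show "finite {N. pmf w (M, N) \<noteq> 0}" "finite {N. pmf w (N, M) \<noteq> 0}"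
      using assms by (meson finite_imageI finite_subset)+
  qed
  have 1: "pmf (map_pmf fst w) M = (\<Sum>N\<in>{N. pmf w (M, N) \<noteq> 0}. pmf w (M, N))" for M
  proof -
    have "pmf (map_pmf fst w) M = (\<Sum>z\<in>set_pmf w. if fst z = M then pmf w z else 0)"
      unfolding map_pmf_def pmf_bind_finite[OF assms order_refl] by (intro sum.cong) (auto simp: indicator_def)
    also have "\<dots> = (\<Sum>z\<in>{z\<in>set_pmf w. fst z = M}. pmf w z)"
      using assms by (simp add: sum.inter_filter)
    also have "{z\<in>set_pmf w. fst z = M} = Pair M ` {N. pmf w (M, N) \<noteq> 0}"
      by (auto simp: set_pmf_iff)
    finally show ?thesis by (simp add: sum.reindex inj_on_def)
  qed
  have 2: "pmf (map_pmf snd w) N = (\<Sum>M\<in>{M. pmf w (M, N) \<noteq> 0}. pmf w (M, N))" for N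
  proof -
    have "pmf (map_pmf snd w) N = (\<Sum>z\<in>set_pmf w. if snd z = N then pmf w z else 0)"
      unfolding map_pmf_def pmf_bind_finite[OF assms order_refl] by (intro sum.cong) (auto simp: indicator_def)
    also have "\<dots> = (\<Sum>z\<in>{z\<in>set_pmf w. snd z = N}. pmf w z)"
      using assms by (simp add: sum.inter_filter)
    also have "{z\<in>set_pmf w. snd z = N} = (\<lambda>M. (M, N)) ` {M. pmf w (M, N) \<noteq> 0}"
      by (auto simp: set_pmf_iff)
    finally show ?thesis by (simp add: sum.reindex inj_on_def)
  qed
  show ?thesis
    unfolding matching_def mem_Collect_eq supp 1[symmetric] 2[symmetric]
    using assms by (auto intro: pmf_eqI)
qed

text \<open>A matching is given as a bare function; that its total mass is 1 follows by summing
  along the fibres of the first projection.\<close>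

lemma matching_is_pmf:
  assumes "\<omega> \<in> matching (pmf p) (pmf q)"
  obtains w where "\<omega> = pmf w" "finite (set_pmf w)"
proof -
  have fin: "finite (supp \<omega>)" and nn: "\<And>z. 0 \<le> \<omega> z"
    and p: "\<And>M. pmf p M = (\<Sum>N\<in>{N. \<omega> (M, N) \<noteq> 0}. \<omega> (M, N))"
    using assms by (auto simp: matching_def)
  have S: "supp \<omega> = (SIGMA M:fst ` supp \<omega>. {N. \<omega> (M, N) \<noteq> 0})" by (force simp: supp_def)
  have finN: "finite {N. \<omega> (M, N) \<noteq> 0}" for M
    by (rule finite_subset[OF _ finite_imageI[OF fin, of snd]]) (force simp: supp_def)
  have "sum \<omega> (supp \<omega>) = sum \<omega> (SIGMA M:fst ` supp \<omega>. {N. \<omega> (M, N) \<noteq> 0})" using S by simp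
  also have "\<dots> = (\<Sum>M\<in>fst ` supp \<omega>. \<Sum>N\<in>{N. \<omega> (M, N) \<noteq> 0}. \<omega> (M, N))"
    using fin finN by (subst sum.Sigma) auto
  also have "\<dots> = (\<Sum>M\<in>fst ` supp \<omega>. pmf p M)" by (simp add: p)
  also have "\<dots> = 1"
  proof (rule sum_pmf_eq_1)
    show "set_pmf p \<subseteq> fst ` supp \<omega>"
    proof
      fix M assume "M \<in> set_pmf p"
      then have "(\<Sum>N\<in>{N. \<omega> (M, N) \<noteq> 0}. \<omega> (M, N)) \<noteq> 0" by (simp add: p[symmetric] set_pmf_iff)
      then obtain N where "\<omega> (M, N) \<noteq> 0" by (metis (mono_tags, lifting) sum.neutral)
      then show "M \<in> fst ` supp \<omega>" by (force simp: supp_def)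
    qed
  qed (use fin in simp)
  finally obtain w where "pmf w = \<omega>" "set_pmf w \<subseteq> supp \<omega>"
    using nn by (elim finite_support_pmf[OF fin, rotated 2]) (auto simp: supp_def)
  then show thesis using that[of w] fin by (auto intro: finite_subset)
qed

lemma matching_cost:
  assumes "finite (set_pmf w)"
  shows "(\<Sum>(M, N)\<in>supp (pmf w). pmf w (M, N) * d M N) = measure_pmf.expectation w (\<lambda>(M, N). d M N)"
proof -
  have "supp (pmf w) = set_pmf w" by (auto simp: supp_def set_pmf_iff)
  then show ?thesis
    using assms by (subst integral_measure_pmf[of "set_pmf w"]) (auto intro!: sum.cong)
qed

lemma coupling_le_imp_kantorovich_le:
  assumes "coupling_le d p q c" "finite (set_pmf p)" "finite (set_pmf q)" "\<And>M N. 0 \<le> d M N"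
  shows "kantorovich d (pmf p) (pmf q) \<le> c"
proof -
  obtain w where w: "map_pmf fst w = p" "map_pmf snd w = q" "measure_pmf.expectation w (\<lambda>(M, N). d M N) \<le> c"
    using assms(1) by (auto simp: coupling_le_def)
  have fin: "finite (set_pmf w)" using finite_set_pmf_marginals w assms by metis
  have "kantorovich d (pmf p) (pmf q) \<le> (\<Sum>(M, N)\<in>supp (pmf w). pmf w (M, N) * d M N)"
    unfolding kantorovich_def
  proof (rule cINF_lower)
    show "bdd_below ((\<lambda>\<omega>. \<Sum>(M, N)\<in>supp \<omega>. \<omega> (M, N) * d M N) ` matching (pmf p) (pmf q))"
      using assms(4) by (intro bdd_belowI2[of _ 0]) (auto simp: matching_def intro!: sum_nonneg)
    show "pmf w \<in> matching (pmf p) (pmf q)" using matching_pmf_iff[OF fin] w by simp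
  qed
  also have "\<dots> \<le> c" using w matching_cost[OF fin] by simp
  finally show ?thesis .
qed

text \<open>An infimum yields a matching only strictly above its value, which is the slack that
  \<open>sim\<close> grants. The product matching shows that the infimum ranges over a non-empty
  set.\<close>

lemma kantorovich_less_imp_coupling_le:
  assumes "kantorovich d (pmf p) (pmf q) < c" "finite (set_pmf p)" "finite (set_pmf q)"
  shows "coupling_le d p q c"
proof -
  have "pmf (pair_pmf p q) \<in> matching (pmf p) (pmf q)"
    using assms by (subst matching_pmf_iff) (auto simp: map_fst_pair_pmf map_snd_pair_pmf)
  then have "(\<lambda>\<omega>. \<Sum>(M, N)\<in>supp \<omega>. \<omega> (M, N) * d M N) ` matching (pmf p) (pmf q) \<noteq> {}" by blast
  from cInf_lessD[OF this assms(1)[unfolded kantorovich_def]]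
  obtain \<omega> where \<omega>: "\<omega> \<in> matching (pmf p) (pmf q)" "(\<Sum>(M, N)\<in>supp \<omega>. \<omega> (M, N) * d M N) < c" by blast
  obtain w where w: "\<omega> = pmf w" "finite (set_pmf w)" by (rule matching_is_pmf[OF \<omega>(1)])
  then show ?thesis
    using \<omega> matching_pmf_iff[OF w(2), of p q] matching_cost[OF w(2), of d] by (auto simp: coupling_le_def)
qed

section \<open>Passing between distances on networks and on states\<close>

lemma Bot_in_Nets: "Bot \<in> Nets"
  by (simp add: Nets_def wf_net_def)

text \<open>Overwrites \<open>d\<close> at \<open>Bot\<close> with the values that
  \<open>sim\<close> prescribes. Couplings of proper transitions keep their cost: the derivatives
  are live, and a live network already has distance 1 from \<open>Bot\<close>.\<close>

lemma sim_of_quasimetric: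
  fixes d :: "'v net \<Rightarrow> 'v net \<Rightarrow> real"
  assumes d: "weak_sim_quasimetric d"
  shows "sim (\<lambda>x y. if x = Bot then 0 else if y = Bot then 1 else d x y)" (is "sim ?d")
  unfolding sim_def
proof (intro conjI ballI allI impI)
  fix x y :: "'v net" assume "x \<in> states" "y \<in> states"
  then show "0 \<le> ?d x y" "?d x y \<le> 1"
    using d by (auto simp: weak_sim_quasimetric_def pseudoquasimetric_def live_nets_def)
next
  fix x y :: "'v net" and a e c
  assume xy: "x \<in> states" "y \<in> states" and a: "a \<in> Collect obs_lab" and e: "e \<in> hat_derivs a x"
    and c: "?d x y < c" "c < 1"
  have fin_e: "finite_on states e"
    using finitary_hat_derivs[of a] xy e by (auto simp: finitary_def finite_on_def)
  have "0 \<le> ?d x y"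
    using xy d by (auto simp: weak_sim_quasimetric_def pseudoquasimetric_def live_nets_def)
  then have c0: "0 \<le> c" using c(1) by linarith
  \<comment> \<open>Fallback for a state without the move: its derivative is \<open>Bot\<close>, at
    distance 0 from every state, so any weak move of \<open>y\<close> will do.\<close>
  obtain \<Theta>0 where \<Theta>0: "weak a (return_pmf y) \<Theta>0" using weak_total[OF xy(2)] by blast
  have "finite_on states \<Theta>0" using weak_finite_support[OF _ \<Theta>0] xy by simp
  then have Bot: "e = return_pmf Bot \<Longrightarrow> coupling_le ?d e \<Theta>0 c"
    using c0 by (intro coupling_le_product) (auto simp: finite_on_def)
  show "\<exists>\<Theta>. weak a (return_pmf y) \<Theta> \<and> coupling_le ?d e \<Theta> c"
    using e
  proof (cases rule: hat_derivs_cases)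
    case 1
    then have "live x" by (rule trans_imp_live)
    then have x: "x \<noteq> Bot" "x \<in> live_nets" using xy by auto
    then have y: "y \<noteq> Bot" "y \<in> live_nets" "d x y < c" using c xy by (auto split: if_splits)
    obtain \<Theta> where \<Theta>: "weak_trans y a \<Theta>" "kantorovich d (pmf e) (pad_bot \<Theta>) \<le> d x y"
      using weak_sim_quasimetric_transfer[OF d, of x y a "pmf e"] x y a 1 c by (auto simp: live_nets_def)
    obtain X where X: "weak a (return_pmf y) X" "\<Theta> = strip X"
      using weak_trans_imp_weak[OF \<Theta>(1) y(2)] by blast
    have fin: "finite_on states X" using weak_finite_support[OF _ X(1)] xy by simp
    have "coupling_le d e X c"
      using \<Theta>(2) y(3) fin fin_e unfolding X(2)
      by (intro kantorovich_less_imp_coupling_le) (auto simp: finite_on_def pad_bot_strip)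
    moreover have "set_pmf e \<subseteq> live_nets" using trans_live_nets_pmf[OF x(2) 1] by simp
    then have "?d u v \<le> d u v" if "u \<in> set_pmf e" "v \<in> set_pmf X" for u v
      using that sim_quasimetric_live_dead[OF d, of u Bot] Bot_in_Nets by force
    ultimately have "coupling_le ?d e X c"
      using fin fin_e by (elim coupling_le_mono) (auto simp: finite_on_def)
    then show ?thesis using X by blast
  next
    case 2
    have "coupling_le ?d e (return_pmf y) (?d x y)" using 2 by (intro coupling_le_product) auto
    then have "coupling_le ?d e (return_pmf y) c" using c(1) 2 by (elim coupling_le_mono) auto
    then show ?thesis using 2 tau_star_refl by (auto simp: weak_def)
  next
    case 3
    then show ?thesis using Bot \<Theta>0 by blast
  qed
qed auto

text \<open>Extends distances on \<open>states\<close> to all networks, ill-formed ones included;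
  the extension is then non-negative everywhere, as \<open>coupling_le_imp_kantorovich_le\<close>
  demands.\<close>

definition collapse :: "'v net \<Rightarrow> 'v net" where
  "collapse M = (if M \<in> live_nets then M else Bot)"

lemma collapse_states [simp]: "collapse M \<in> states"
  by (simp add: collapse_def)

lemma collapse_id: "M \<in> states \<Longrightarrow> collapse M = M"
  by (auto simp: collapse_def)

definition min_quasimetric :: "'v net \<Rightarrow> 'v net \<Rightarrow> real" where
  "min_quasimetric M N = min_sim (collapse M) (collapse N)"

lemma weak_sim_quasimetric_min: "weak_sim_quasimetric min_quasimetric"
  unfolding weak_sim_quasimetric_def
proof (intro conjI ballI allI impI)
  show "pseudoquasimetric min_quasimetric"
    unfolding pseudoquasimetric_def min_quasimetric_def
    using sim_bounds[OF sim_min_sim collapse_states collapse_states] min_sim_refl[OF collapse_states]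
      min_sim_triangle[OF collapse_states collapse_states collapse_states] by blast
next
  fix M N :: "'v net" and a \<Delta>
  assume M: "M \<in> Nets" and N: "N \<in> Nets" and lt: "min_quasimetric M N < 1"
    and a: "obs_lab a" and tr: "Defs.trans M a \<Delta>"
  have M_live: "M \<in> live_nets" using M trans_imp_live[OF tr] by (simp add: live_nets_def)
  then have M': "collapse M = M" "M \<in> states - {Bot}" by (auto simp: collapse_def)
  have N_live: "N \<in> live_nets"
  proof (rule ccontr)
    assume "N \<notin> live_nets"
    then have "min_quasimetric M N = min_sim M Bot"
      by (simp add: min_quasimetric_def collapse_def M_live)
    also have "\<dots> = 1" using sim_min_sim M'(2) unfolding sim_def by blast
    finally show False using lt by simp
  qed
  then have N': "collapse N = N" "N \<in> states" by (auto simp: collapse_def)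
  obtain e where e: "\<Delta> = pmf e" "finite (set_pmf e)" "set_pmf e \<subseteq> live_nets"
    using trans_live_nets[OF M_live tr] by blast
  have "hat_trans M a (pmf e)" using tr unfolding e(1) hat_trans_def by auto
  then have "e \<in> hat_derivs a M" by (rule hat_derivsI)
  then obtain X where X: "weak a (return_pmf N) X" "coupling_le min_sim e X (min_sim M N)"
    using min_sim_transfer[of M N a e] M'(2) N'(2) a by auto
  have fin: "finite_on states X" using weak_finite_support[OF _ X(1)] N'(2) by simp
  have eq: "min_quasimetric x y \<le> min_sim x y" if "x \<in> set_pmf e" "y \<in> set_pmf X" for x y
  proof -
    have "x \<in> states" "y \<in> states" using that e(3) fin by (auto simp: finite_on_def)
    then show ?thesis by (simp only: min_quasimetric_def collapse_id)
  qed
  have nn: "0 \<le> min_quasimetric x y" for x y :: "'v net"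
    unfolding min_quasimetric_def by (rule min_sim_nonneg[OF collapse_states collapse_states])
  \<comment> \<open>The translation back to \<open>weak_trans\<close> excludes losing all mass; here
    a coupling into the sink would cost exactly 1, more than \<open>min_sim M N\<close>.\<close>
  have "X \<noteq> return_pmf Bot"
  proof
    assume Bot: "X = return_pmf Bot"
    obtain w where w: "map_pmf fst w = e" "map_pmf snd w = return_pmf Bot"
        "measure_pmf.expectation w (\<lambda>(x, y). min_sim x y) \<le> min_sim M N"
      using X(2) unfolding Bot coupling_le_def by blast
    have "(case z of (x, y) \<Rightarrow> min_sim x y) = 1" if "z \<in> set_pmf w" for z
    proof -
      obtain x y where z: "z = (x, y)" by (cases z)
      have "x \<in> set_pmf e" "y = Bot" using set_pmf_marginals[of x y w] that w z by auto
      then have "x \<in> states - {Bot}" using e(3) by auto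
      then show ?thesis using sim_min_sim \<open>y = Bot\<close> z unfolding sim_def by auto
    qed
    then have "measure_pmf.expectation w (\<lambda>(x, y). min_sim x y) = 1"
      by (rule expectation_finite_const)
    then show False using w(3) lt by (simp add: min_quasimetric_def M' N')
  qed
  then have "weak_trans N a (strip X)" using weak_imp_weak_trans X(1) N_live by blast
  moreover have "coupling_le min_quasimetric e X (min_sim M N)"
    using X(2) fin e(2) eq by (elim coupling_le_mono) (auto simp: finite_on_def)
  then have "kantorovich min_quasimetric (pmf e) (pmf X) \<le> min_sim M N"
    using e(2) fin nn by (intro coupling_le_imp_kantorovich_le) (auto simp: finite_on_def)
  moreover have "pad_bot (strip X) = pmf X" using fin by (simp add: pad_bot_strip finite_on_def)
  ultimately show "\<exists>\<Theta>. weak_trans N a \<Theta> \<and> kantorovich min_quasimetric \<Delta> (pad_bot \<Theta>) \<le> min_quasimetric M N"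
    using e(1) by (intro exI[of _ "strip X"]) (simp add: min_quasimetric_def M' N')
qed

text \<open>A dead \<open>M\<close> has minimal distance 0 from everything, and for live
  \<open>M\<close> and dead \<open>N\<close> every competitor already has value 1. This leaves live
  pairs, on which the overwritten competitor equals \<open>d\<close>.\<close>

lemma min_quasimetric_le:
  assumes d: "weak_sim_quasimetric d" and M: "M \<in> Nets" and N: "N \<in> Nets"
  shows "min_quasimetric M N \<le> d M N"
proof -
  have nn: "0 \<le> d M N" using d M N by (simp add: weak_sim_quasimetric_def pseudoquasimetric_def)
  have le: "min_quasimetric M N \<le> (if collapse M = Bot then 0 else if collapse N = Bot then 1 else d (collapse M) (collapse N))"
    unfolding min_quasimetric_def using min_sim_le[OF sim_of_quasimetric[OF d] collapse_states collapse_states] .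
  show ?thesis
  proof (cases "M \<in> live_nets")
    case False
    then show ?thesis using le nn by (simp add: collapse_def)
  next
    case M_live: True
    show ?thesis
    proof (cases "N \<in> live_nets")
      case True
      then have "M \<noteq> Bot" "N \<noteq> Bot" using M_live by auto
      then show ?thesis using le M_live True by (simp add: collapse_def)
    next
      case False
      then have "d M N = 1" using sim_quasimetric_live_dead[OF d M_live N] N by (simp add: live_nets_def)
      then show ?thesis using le False by (simp add: collapse_def split: if_splits)
    qed
  qed
qed

theorem theorem2p8:
  "\<exists>m :: 'v net \<Rightarrow> 'v net \<Rightarrow> real. weak_sim_quasimetric m \<and>
     (\<forall>d. weak_sim_quasimetric d \<longrightarrow> (\<forall>M\<in>Nets. \<forall>N\<in>Nets. m M N \<le> d M N))"
  using weak_sim_quasimetric_min min_quasimetric_le by blast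

end
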